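(* Let $\pmb\lambda$ be a $d$-tuple of partitions of $m$ with $\ell(\lambda^{(i)})\le n$ for all $i$. (i) For odd $d$: $\mathrm{HWV}_{\pmb\lambda}\bigvee(\mathbb C^n)^{\otimes d}=\mathrm{span}\{\Delta_T: T\in B^+(\pmb\lambda')\}$ and $\mathrm{HWV}_{\pmb\lambda}\bigwedge(\mathbb C^n)^{\otimes d}=\mathrm{span}\{\nabla_S:S\in A^+(\pmb\lambda')\}$. (ii) For even $d$: $\mathrm{HWV}_{\pmb\lambda}\bigvee(\mathbb C^n)^{\otimes d}=\mathrm{span}\{\Delta_T:T\in A^+(\pmb\lambda')\}$ and $\mathrm{HWV}_{\pmb\lambda}\bigwedge(\mathbb C^n)^{\otimes d}=\mathrm{span}\{\nabla_S:S\in B^+(\pmb\lambda')\}$.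
   Context: $V=(\mathbb C^n)^{\otimes d}$ with basis $e_{\mathbf i}=e_{i_1}\otimes\cdots\otimes e_{i_d}$, $\mathbf i\in[n]^d$; $\bigvee V$ is the symmetric algebra (polynomial ring in commuting variables $e_{\mathbf i}$), $\bigwedge V$ the exterior algebra; $G=\mathrm{GL}(n,\mathbb C)^{\times d}$ acts factorwise on $V$ and by algebra automorphisms on $\bigvee V,\bigwedge V$. $\mathrm{HWV}_{\pmb\lambda}W$ is the space of vectors of weight $\pmb\lambda$ (for the torus of $d$-tuples of diagonal matrices) fixed by $U(n)^{\times d}$, $U(n)$ upper unitriangular. $\pmb\lambda'$ is the componentwise conjugate. Words/tables: for a sequence $\alpha$ of nonnegative integers with sum $m$, $A(\alpha)$ is the set of words of length $m$ in which letter $i$ occurs $\alpha_i$ times; a word is lattice if every prefix contains at least as many letters $i$ as letters $i+1$, for all $i$. $A(\pmb\alpha)=A(\alpha^{(1)})\times\cdots\times A(\alpha^{(d)})$, viewed as $d\times m$ tables with columns $S(1),\dots,S(m)$; $B(\pmb\alpha)$: tables with pairwise distinct columns; $A^+(\pmb\alpha)$: tables all of whose rows are lattice words; $B^+(\pmb\alpha)=A^+(\pmb\alpha)\cap B(\pmb\alpha)$. $\|T\|=\prod_{\mathbf c}(\#\{j:T(j)=\mathbf c\})!$. $\bigvee e_X=e_{X(1)}\cdots e_{X(m)}$, $\bigwedge e_X=e_{X(1)}\wedge\cdots\wedge e_{X(m)}$. Signs: $(-1)^w=(-1)^{\#\{i<j:w_i>w_j\}}$; $(-1)^T=\prod_i(-1)^{t_i}$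 over rows. For words $s,x$ of length $m$, $\mathrm{sgn}_s(x)=\prod_c\mathrm{sgn}(x_{b_1},\dots,x_{b_k})$ over letters $c$ of $s$ with positions $b_1<\dots<b_k$, where $\mathrm{sgn}(a_1,\dots,a_k)$ is the permutation sign if $(a_1,\dots,a_k)$ is a permutation of $[k]$ and $0$ otherwise; $\mathrm{sgn}_T(X)=\prod_i\mathrm{sgn}_{t_i}(x_i)$. Vectors: for a $d\times m$ table $T$ of positive integers, $\Delta_T=\frac{(-1)^T}{\|T\|}\sum_X\mathrm{sgn}_T(X)\bigvee e_X$ and $\nabla_T=\frac{(-1)^T}{\|T\|}\sum_X\mathrm{sgn}_T(X)\bigwedge e_X$, sums over all $d\times m$ tables $X$ with entries in $[n]$. *)

theory Defs
  imports
    Complex_Main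
    "HOL-Library.Poly_Mapping"
    "HOL-Library.FSet"
    "HOL-Library.List_Lexorder"
    "HOL-Combinatorics.Permutations"
    "Jordan_Normal_Form.Matrix"
begin

section \<open>Complex vector spaces of finitely supported functions\<close>

definition scale :: "complex \<Rightarrow> ('a \<Rightarrow>\<^sub>0 complex) \<Rightarrow> ('a \<Rightarrow>\<^sub>0 complex)" where
  "scale c f = Poly_Mapping.map ((*) c) f"

lemma lookup_scale: "poly_mapping.lookup (scale c f) x = c * poly_mapping.lookup f x"
  by (simp add: scale_def map.rep_eq when_def)

interpretation cvec: vector_space scale
  by unfold_locales (auto intro!: poly_mapping_eqI simp: lookup_scale lookup_add algebra_simps)

section \<open>Partitions, words and tables\<close>

definition is_partition :: "nat \<Rightarrow> nat list \<Rightarrow> bool" where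
  "is_partition m p \<longleftrightarrow> sorted_wrt (\<ge>) p \<and> 0 \<notin> set p \<and> sum_list p = m"

definition conjugate_partition :: "nat list \<Rightarrow> nat list" where
  "conjugate_partition p =
     map (\<lambda>j. length (filter (\<lambda>x. j \<le> x) p)) [1..<Suc (Max (insert 0 (set p)))]"

text \<open>Letters are positive integers, so the multiplicity of the letter \<open>i\<close> is \<open>\<alpha> ! (i - 1)\<close>.
  A table is the list of its rows; \<^const>\<open>List.transpose\<close> gives the list of its columns.\<close>

definition words :: "nat list \<Rightarrow> nat list set" where
  "words \<alpha> = {w. length w = sum_list \<alpha> \<and> set w \<subseteq> {1..length \<alpha>} \<and>
                (\<forall>i\<in>{1..length \<alpha>}. count_list w i = \<alpha> ! (i - 1))}"

definition lattice_word :: "nat list \<Rightarrow> bool" where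
  "lattice_word w \<longleftrightarrow>
     (\<forall>k\<le>length w. \<forall>i\<ge>1. count_list (take k w) (Suc i) \<le> count_list (take k w) i)"

definition tables_A :: "nat list list \<Rightarrow> nat list list set" where
  "tables_A \<alpha>s = {T. length T = length \<alpha>s \<and> (\<forall>k<length \<alpha>s. T ! k \<in> words (\<alpha>s ! k))}"

definition tables_B :: "nat list list \<Rightarrow> nat list list set" where
  "tables_B \<alpha>s = {T \<in> tables_A \<alpha>s. distinct (List.transpose T)}"

definition tables_A_plus :: "nat list list \<Rightarrow> nat list list set" where
  "tables_A_plus \<alpha>s = {T \<in> tables_A \<alpha>s. \<forall>t\<in>set T. lattice_word t}"

definition tables_B_plus :: "nat list list \<Rightarrow> nat list list set" where
  "tables_B_plus \<alpha>s = tables_A_plus \<alpha>s \<inter> tables_B \<alpha>s"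

definition tables :: "nat \<Rightarrow> nat \<Rightarrow> nat \<Rightarrow> nat list list set" where
  "tables n d m = {X. length X = d \<and> (\<forall>x\<in>set X. length x = m \<and> set x \<subseteq> {1..n})}"

definition table_norm :: "nat list list \<Rightarrow> nat" where
  "table_norm T = (\<Prod>c\<in>set (List.transpose T). fact (count_list (List.transpose T) c))"

section \<open>Signs\<close>

definition word_sign :: "nat list \<Rightarrow> int" where
  "word_sign w = (- 1) ^ card {(i, j). i < j \<and> j < length w \<and> w ! i > w ! j}"

definition table_sign :: "nat list list \<Rightarrow> int" where
  "table_sign T = (\<Prod>t\<leftarrow>T. word_sign t)"

definition perm_sgn :: "nat list \<Rightarrow> int" where
  "perm_sgn a = (if distinct a \<and> set a = {1..length a}
                 then sign_on {1..length a} (\<lambda>i. a ! (i - 1)) else 0)"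

definition word_sgn :: "nat list \<Rightarrow> nat list \<Rightarrow> int" where
  "word_sgn s x = (\<Prod>c\<in>set s. perm_sgn (nths x {b. b < length s \<and> s ! b = c}))"

definition table_sgn :: "nat list list \<Rightarrow> nat list list \<Rightarrow> int" where
  "table_sgn T X = (\<Prod>k<length T. word_sgn (T ! k) (X ! k))"

section \<open>The group\<close>

definition GL :: "nat \<Rightarrow> nat \<Rightarrow> complex mat list set" where
  "GL n d = {g. length g = d \<and> (\<forall>h\<in>set g. h \<in> carrier_mat n n \<and> invertible_mat h)}"

definition torus :: "nat \<Rightarrow> nat \<Rightarrow> complex mat list set" where
  "torus n d = {g \<in> GL n d. \<forall>h\<in>set g. diagonal_mat h}"

definition unipotent :: "nat \<Rightarrow> nat \<Rightarrow> complex mat list set" where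
  "unipotent n d = {g \<in> GL n d. \<forall>h\<in>set g. upper_triangular h \<and> (\<forall>i<n. h $$ (i, i) = 1)}"

text \<open>The index set of the basis of the \<open>d\<close>-th tensor power of \<open>\<complex>\<^sup>n\<close>, and the coefficient of
  \<open>e\<^sub>j\<close> in \<open>g \<cdot> e\<^sub>i\<close>.  Matrix entries are numbered from 0.\<close>

definition idx :: "nat \<Rightarrow> nat \<Rightarrow> nat list set" where
  "idx n d = {i. length i = d \<and> set i \<subseteq> {1..n}}"

definition act_coeff :: "complex mat list \<Rightarrow> nat list \<Rightarrow> nat list \<Rightarrow> complex" where
  "act_coeff g j i = (\<Prod>k<length g. (g ! k) $$ (j ! k - 1, i ! k - 1))"

section \<open>The symmetric algebra\<close>

type_synonym sym = "(nat list \<Rightarrow>\<^sub>0 nat) \<Rightarrow>\<^sub>0 complex"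

definition sym_space :: "nat \<Rightarrow> nat \<Rightarrow> sym set" where
  "sym_space n d = {p. \<forall>a\<in>Poly_Mapping.keys p. Poly_Mapping.keys a \<subseteq> idx n d}"

definition sym_e :: "nat list \<Rightarrow> sym" where
  "sym_e i = Poly_Mapping.single (Poly_Mapping.single i 1) 1"

definition sym_act_e :: "nat \<Rightarrow> complex mat list \<Rightarrow> nat list \<Rightarrow> sym" where
  "sym_act_e n g i = (\<Sum>j\<in>idx n (length g). scale (act_coeff g j i) (sym_e j))"

definition sym_act :: "nat \<Rightarrow> complex mat list \<Rightarrow> sym \<Rightarrow> sym" where
  "sym_act n g p = (\<Sum>a\<in>Poly_Mapping.keys p. scale (poly_mapping.lookup p a)
     (\<Prod>i\<in>Poly_Mapping.keys a. sym_act_e n g i ^ poly_mapping.lookup a i))"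

definition sym_monom :: "nat list list \<Rightarrow> sym" where
  "sym_monom X = (\<Prod>c\<leftarrow>List.transpose X. sym_e c)"

section \<open>The exterior algebra\<close>

text \<open>The basis vector attached to a finite set \<open>S\<close> of indices is the wedge product of the
  generators indexed by \<open>S\<close> in increasing order; the order on indices is lexicographic.
  Multiplying two such vectors needs one transposition for each pair in
  \<open>shuffle_inv\<close> to restore the increasing order.\<close>

type_synonym 'i ext = "'i fset \<Rightarrow>\<^sub>0 complex"

definition shuffle_inv :: "'i::linorder fset \<Rightarrow> 'i fset \<Rightarrow> nat" where
  "shuffle_inv S T = card {(a, b). a \<in> fset S \<and> b \<in> fset T \<and> b < a}"

definition wedge_basis :: "'i::linorder fset \<Rightarrow> 'i fset \<Rightarrow> 'i ext" where
  "wedge_basis S T = (if S |\<inter>| T = {||}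
     then Poly_Mapping.single (S |\<union>| T) ((- 1) ^ shuffle_inv S T) else 0)"

definition wedge :: "'i::linorder ext \<Rightarrow> 'i ext \<Rightarrow> 'i ext"  (infixr \<open>\<diamondop>\<close> 70) where
  "f \<diamondop> g = (\<Sum>S\<in>Poly_Mapping.keys f. \<Sum>T\<in>Poly_Mapping.keys g.
     scale (poly_mapping.lookup f S * poly_mapping.lookup g T) (wedge_basis S T))"

definition ext_one :: "'i ext" where
  "ext_one = Poly_Mapping.single {||} 1"

definition ext_e :: "'i \<Rightarrow> 'i ext" where
  "ext_e i = Poly_Mapping.single {|i|} 1"

definition wedge_list :: "'i::linorder ext list \<Rightarrow> 'i ext" where
  "wedge_list fs = foldr (\<diamondop>) fs ext_one"

definition ext_space :: "nat \<Rightarrow> nat \<Rightarrow> nat list ext set" where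
  "ext_space n d = {f. \<forall>S\<in>Poly_Mapping.keys f. fset S \<subseteq> idx n d}"

definition ext_act_e :: "nat \<Rightarrow> complex mat list \<Rightarrow> nat list \<Rightarrow> nat list ext" where
  "ext_act_e n g i = (\<Sum>j\<in>idx n (length g). scale (act_coeff g j i) (ext_e j))"

definition ext_act :: "nat \<Rightarrow> complex mat list \<Rightarrow> nat list ext \<Rightarrow> nat list ext" where
  "ext_act n g f = (\<Sum>S\<in>Poly_Mapping.keys f. scale (poly_mapping.lookup f S)
     (wedge_list (map (ext_act_e n g) (sorted_list_of_fset S))))"

definition ext_monom :: "nat list list \<Rightarrow> nat list ext" where
  "ext_monom X = wedge_list (map ext_e (List.transpose X))"

subsection \<open>Algebra laws\<close>

lemma scale_single [simp]: "scale c (Poly_Mapping.single x a) = Poly_Mapping.single x (c * a)"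
  by (simp add: scale_def)

lemma poly_mapping_eq_sum_single:
  fixes f :: "'a \<Rightarrow>\<^sub>0 complex"
  shows "f = (\<Sum>x\<in>Poly_Mapping.keys f. Poly_Mapping.single x (poly_mapping.lookup f x))"
  by (rule poly_mapping_eqI) (auto simp: lookup_sum lookup_single when_def in_keys_iff)

lemma wedge_superset:
  assumes "finite A" "Poly_Mapping.keys f \<subseteq> A" "finite B" "Poly_Mapping.keys g \<subseteq> B"
  shows "f \<diamondop> g = (\<Sum>S\<in>A. \<Sum>T\<in>B.
      scale (poly_mapping.lookup f S * poly_mapping.lookup g T) (wedge_basis S T))"
proof -
  have "f \<diamondop> g = (\<Sum>S\<in>A. \<Sum>T\<in>Poly_Mapping.keys g.
      scale (poly_mapping.lookup f S * poly_mapping.lookup g T) (wedge_basis S T))"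
    unfolding wedge_def by (rule sum.mono_neutral_left) (use assms in \<open>auto simp: in_keys_iff\<close>)
  also have "\<dots> = (\<Sum>S\<in>A. \<Sum>T\<in>B.
      scale (poly_mapping.lookup f S * poly_mapping.lookup g T) (wedge_basis S T))"
    by (intro sum.cong refl sum.mono_neutral_left) (use assms in \<open>auto simp: in_keys_iff\<close>)
  finally show ?thesis .
qed

lemma wedge_add_left: "(f + g) \<diamondop> h = f \<diamondop> h + g \<diamondop> h"
proof -
  let ?A = "Poly_Mapping.keys f \<union> Poly_Mapping.keys g" and ?B = "Poly_Mapping.keys h"
  have "Poly_Mapping.keys (f + g) \<subseteq> ?A" by (rule Poly_Mapping.keys_add)
  then show ?thesis
    by (simp add: wedge_superset[of ?A _ ?B] lookup_add distrib_right cvec.scale_left_distrib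
        sum.distrib)
qed

lemma wedge_add_right: "f \<diamondop> (g + h) = f \<diamondop> g + f \<diamondop> h"
proof -
  let ?A = "Poly_Mapping.keys f" and ?B = "Poly_Mapping.keys g \<union> Poly_Mapping.keys h"
  have "Poly_Mapping.keys (g + h) \<subseteq> ?B" by (rule Poly_Mapping.keys_add)
  then show ?thesis
    by (simp add: wedge_superset[of ?A _ ?B] lookup_add distrib_left cvec.scale_left_distrib
        sum.distrib)
qed

lemma wedge_zero [simp]: "0 \<diamondop> f = 0" "f \<diamondop> 0 = 0"
  by (simp_all add: wedge_def)

lemma wedge_single:
  "Poly_Mapping.single S a \<diamondop> Poly_Mapping.single T b = scale (a * b) (wedge_basis S T)"
  by (cases "a = 0"; cases "b = 0") (simp_all add: wedge_def)

lemma wedge_scale_left: "scale c f \<diamondop> g = scale c (f \<diamondop> g)"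
proof -
  have "Poly_Mapping.keys (scale c f) \<subseteq> Poly_Mapping.keys f"
    by (auto simp: in_keys_iff lookup_scale)
  then show ?thesis
    by (simp add: wedge_superset[of "Poly_Mapping.keys f" _ "Poly_Mapping.keys g"] lookup_scale
        cvec.scale_sum_right mult.assoc)
qed

lemma wedge_scale_right: "f \<diamondop> scale c g = scale c (f \<diamondop> g)"
proof -
  have "Poly_Mapping.keys (scale c g) \<subseteq> Poly_Mapping.keys g"
    by (auto simp: in_keys_iff lookup_scale)
  then show ?thesis
    by (simp add: wedge_superset[of "Poly_Mapping.keys f" _ "Poly_Mapping.keys g"] lookup_scale
        cvec.scale_sum_right mult.left_commute)
qed

lemma wedge_sum_left: "sum f A \<diamondop> g = (\<Sum>x\<in>A. f x \<diamondop> g)"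
  by (induction A rule: infinite_finite_induct) (auto simp: wedge_add_left)

lemma wedge_sum_right: "g \<diamondop> sum f A = (\<Sum>x\<in>A. g \<diamondop> f x)"
  by (induction A rule: infinite_finite_induct) (auto simp: wedge_add_right)

lemma shuffle_inv_union_left:
  assumes "S |\<inter>| T = {||}"
  shows "shuffle_inv (S |\<union>| T) U = shuffle_inv S U + shuffle_inv T U"
proof -
  let ?P = "\<lambda>S U. {(a, b). a \<in> fset S \<and> b \<in> fset U \<and> b < (a::'a)}"
  have fin: "finite (?P S U)" for S U
    by (rule finite_subset[of _ "fset S \<times> fset U"]) auto
  have "?P (S |\<union>| T) U = ?P S U \<union> ?P T U" by auto
  moreover have "?P S U \<inter> ?P T U = {}" using assms by (auto simp: fset_eq_iff)
  ultimately show ?thesis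
    unfolding shuffle_inv_def by (simp add: card_Un_disjoint fin)
qed

lemma shuffle_inv_union_right:
  assumes "T |\<inter>| U = {||}"
  shows "shuffle_inv S (T |\<union>| U) = shuffle_inv S T + shuffle_inv S U"
proof -
  let ?P = "\<lambda>S U. {(a, b). a \<in> fset S \<and> b \<in> fset U \<and> b < (a::'a)}"
  have fin: "finite (?P S U)" for S U
    by (rule finite_subset[of _ "fset S \<times> fset U"]) auto
  have "?P S (T |\<union>| U) = ?P S T \<union> ?P S U" by auto
  moreover have "?P S T \<inter> ?P S U = {}" using assms by (auto simp: fset_eq_iff)
  ultimately show ?thesis
    unfolding shuffle_inv_def by (simp add: card_Un_disjoint fin)
qed

lemma wedge_assoc_basis:
  "wedge_basis S T \<diamondop> Poly_Mapping.single U 1 = Poly_Mapping.single S 1 \<diamondop> wedge_basis T U"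
proof (cases "S |\<inter>| T = {||} \<and> T |\<inter>| U = {||} \<and> S |\<inter>| U = {||}")
  case True
  then have "(S |\<union>| T) |\<inter>| U = {||}" "S |\<inter>| (T |\<union>| U) = {||}" by auto
  with True show ?thesis
    by (simp add: wedge_basis_def wedge_single shuffle_inv_union_left shuffle_inv_union_right
        power_add sup_assoc mult.commute mult.left_commute)
next
  case False
  then have "S |\<inter>| T = {||} \<Longrightarrow> (S |\<union>| T) |\<inter>| U \<noteq> {||}"
    "T |\<inter>| U = {||} \<Longrightarrow> S |\<inter>| (T |\<union>| U) \<noteq> {||}" by auto
  then show ?thesis
    by (auto simp: wedge_basis_def wedge_single)
qed

lemma wedge_assoc: "(f \<diamondop> g) \<diamondop> h = f \<diamondop> (g \<diamondop> h)"
proof -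
  have single: "Poly_Mapping.single x c = scale c (Poly_Mapping.single x 1)"
    for x :: "'a fset" and c
    by simp
  have basis: "(scale a (Poly_Mapping.single S 1) \<diamondop> scale b (Poly_Mapping.single T 1))
      \<diamondop> scale c (Poly_Mapping.single U 1) = scale a (Poly_Mapping.single S 1) \<diamondop>
      (scale b (Poly_Mapping.single T 1) \<diamondop> scale c (Poly_Mapping.single U 1))"
    for a b c and S T U :: "'a fset"
    by (simp only: wedge_scale_left wedge_scale_right wedge_single wedge_assoc_basis)
       (simp add: wedge_scale_left wedge_scale_right wedge_assoc_basis ac_simps)
  show ?thesis
    apply (subst (1 2) poly_mapping_eq_sum_single[of f])
    apply (subst (1 2) poly_mapping_eq_sum_single[of g])
    apply (subst (1 2) poly_mapping_eq_sum_single[of h])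
    apply (simp only: wedge_sum_left wedge_sum_right)
    apply (subst (1 2 3 4 5 6) single)
    apply (simp only: basis)
    done
qed

lemma wedge_one [simp]: "ext_one \<diamondop> f = f" "f \<diamondop> ext_one = f"
proof -
  have [simp]: "wedge_basis {||} S = Poly_Mapping.single S 1"
    "wedge_basis S {||} = Poly_Mapping.single S 1" for S :: "'a fset"
    by (simp_all add: wedge_basis_def shuffle_inv_def)
  show "ext_one \<diamondop> f = f" "f \<diamondop> ext_one = f"
    by (simp_all add: wedge_def ext_one_def flip: poly_mapping_eq_sum_single)
qed

lemma ext_e_square: "ext_e i \<diamondop> ext_e i = 0"
  by (simp add: ext_e_def wedge_single wedge_basis_def)

lemma ext_e_anticommute: "ext_e i \<diamondop> ext_e j = - (ext_e j \<diamondop> ext_e i)"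
proof (cases "i = j")
  case False
  have "shuffle_inv {|a|} {|b|} = (if b < a then 1 else 0)" for a b :: 'a
  proof -
    have "{(x, y). x \<in> fset {|a|} \<and> y \<in> fset {|b|} \<and> y < x} = (if b < a then {(a, b)} else {})"
      by auto
    then show ?thesis by (simp add: shuffle_inv_def)
  qed
  with False show ?thesis
    by (auto simp: ext_e_def wedge_single wedge_basis_def single_uminus finsert_commute
        not_less_iff_gr_or_eq)
qed (simp add: ext_e_square)

section \<open>Highest weight vectors\<close>

definition weight :: "nat list list \<Rightarrow> complex mat list \<Rightarrow> complex" where
  "weight lam t = (\<Prod>k<length lam. \<Prod>j<length (lam ! k). (t ! k) $$ (j, j) ^ (lam ! k ! j))"

definition HWV :: "nat \<Rightarrow> nat list list \<Rightarrow> ('a \<Rightarrow>\<^sub>0 complex) set \<Rightarrow>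
    (complex mat list \<Rightarrow> ('a \<Rightarrow>\<^sub>0 complex) \<Rightarrow> ('a \<Rightarrow>\<^sub>0 complex)) \<Rightarrow> ('a \<Rightarrow>\<^sub>0 complex) set" where
  "HWV n lam W act = {v \<in> W.
     (\<forall>t\<in>torus n (length lam). act t v = scale (weight lam t) v) \<and>
     (\<forall>u\<in>unipotent n (length lam). act u v = v)}"

definition HWV_sym :: "nat \<Rightarrow> nat list list \<Rightarrow> sym set" where
  "HWV_sym n lam = HWV n lam (sym_space n (length lam)) (sym_act n)"

definition HWV_ext :: "nat \<Rightarrow> nat list list \<Rightarrow> nat list ext set" where
  "HWV_ext n lam = HWV n lam (ext_space n (length lam)) (ext_act n)"

definition Delta :: "nat \<Rightarrow> nat list list \<Rightarrow> sym" where
  "Delta n T = scale (of_int (table_sign T) / of_nat (table_norm T))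
     (\<Sum>X\<in>tables n (length T) (length (List.transpose T)).
        scale (of_int (table_sgn T X)) (sym_monom X))"

definition Nabla :: "nat \<Rightarrow> nat list list \<Rightarrow> nat list ext" where
  "Nabla n T = scale (of_int (table_sign T) / of_nat (table_norm T))
     (\<Sum>X\<in>tables n (length T) (length (List.transpose T)).
        scale (of_int (table_sgn T X)) (ext_monom X))"

end

theory Submission
  imports Defs "Jordan_Normal_Form.Determinant"
begin

text \<open>Both algebras are quotients of the tensor algebra on which the torus and the unipotent group
  act through (anti)symmetric functions of the list of columns, so a highest weight vector lifts to
  a function \<open>F\<close> on tables each of whose rows is a highest weight vector in a tensor power of
  \<open>\<complex>\<^sup>n\<close>. The functions \<open>x \<mapsto> sgn\<^sub>s(x)\<close> are products of leading principal minors, hence highest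
  weight vectors. Conversely, a vector killed by all raising operators vanishes as soon as its
  coefficients at lattice words vanish. On lattice words the functions \<open>sgn\<^sub>s\<close> are unitriangular for
  the lexicographic order, the diagonal position of \<open>s\<close> being the lattice word that records which
  occurrence of its letter stands at each place of \<open>s\<close>. Row by row this makes \<open>F\<close> a combination of
  the functions \<open>sgn\<^sub>T\<close> with \<open>T\<close> in \<open>A\<^sup>+\<close>. If \<open>T\<close> has two equal columns, exchanging them changes
  the summand by \<open>(-1)\<^sup>d\<close> times the sign of the exchange in the algebra, which kills the vector of
  \<open>T\<close> for odd \<open>d\<close> in the symmetric and for even \<open>d\<close> in the exterior algebra.\<close>

section \<open>Raising operators\<close>

text \<open>Lattice words suffice for an sl_2 reason: when appending a letter to a lattice word
  breaks the lattice condition, the weight of the new word for some pair of letters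
  \<open>i\<close>, \<open>Suc i\<close> is negative, and on negative weights the raising operator
  is injective. The raising operators enter as derivatives at 0 of elementary unipotent matrices
  placed in a single factor of the group. Spanning comes from triangular interpolation alone, so
  neither linear independence nor a dimension count enters. Signs of permutations of columns are
  never computed: two functions that react alike to adjacent swaps pick up the same factor along any
  chain of swaps, and this is how the sorted basis of the exterior algebra is handled. Lifting
  divides by the number of orderings of a monomial, so characteristic zero is used. The lifts live
  on lists of columns of all lengths up to a bound, because the degree \<open>m\<close> is not given
  in advance: it is forced by the weight, which fixes the content of every row.\<close>

fun raising :: "nat \<Rightarrow> (nat list \<Rightarrow> complex) \<Rightarrow> nat list \<Rightarrow> complex" where
  "raising i w [] = 0"
| "raising i w (a # y) = raising i (\<lambda>x. w (a # x)) y + (if a = i then w (Suc i # y) else 0)"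

lemma raising_add: "raising i (\<lambda>x. f x + g x) y = raising i f y + raising i g y"
  by (induction y arbitrary: f g) auto

lemma raising_cmult: "raising i (\<lambda>x. c * f x) y = c * raising i f y"
  by (induction y arbitrary: f) (auto simp: algebra_simps)

text \<open>Only words over the letters of \<open>y\<close> and \<open>Suc i\<close> are evaluated.
  This locality allows a function to be cut off outside the alphabet \<open>1..n\<close>.\<close>

lemma raising_cong_letters:
  "(\<And>x. length x = length y \<Longrightarrow> set x \<subseteq> insert (Suc i) (set y) \<Longrightarrow> f x = g x) \<Longrightarrow>
     raising i f y = raising i g y"
proof (induction y arbitrary: f g)
  case (Cons a y)
  have "raising i (\<lambda>x. f (a # x)) y = raising i (\<lambda>x. g (a # x)) y"
    by (rule Cons.IH, rule Cons.prems) auto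
  moreover have "f (Suc i # y) = g (Suc i # y)"
    by (rule Cons.prems) auto
  ultimately show ?case by simp
qed simp

lemma raising_cong:
  "(\<And>x. length x = length y \<Longrightarrow> f x = g x) \<Longrightarrow> raising i f y = raising i g y"
  by (rule raising_cong_letters) blast

text \<open>Some word of the support arises from \<open>y\<close> by turning one \<open>i\<close>
  into \<open>Suc i\<close>. For a support over the alphabet \<open>1..n\<close> this bounds
  \<open>i\<close> below \<open>n\<close>.\<close>

lemma raising_nonzeroD:
  "raising i w y \<noteq> 0 \<Longrightarrow>
     \<exists>x. w x \<noteq> 0 \<and> length x = length y \<and> Suc i \<in> set x \<and> set y \<subseteq> insert i (set x)"
proof (induction y arbitrary: w)
  case (Cons a y)
  from Cons.prems consider "raising i (\<lambda>x. w (a # x)) y \<noteq> 0" | "a = i" "w (Suc i # y) \<noteq> 0"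
    by (cases "a = i") fastforce+
  then show ?case
  proof cases
    case 1
    from Cons.IH[OF this] obtain x where "w (a # x) \<noteq> 0" "length x = length y" "Suc i \<in> set x"
      "set y \<subseteq> insert i (set x)" by blast
    then show ?thesis by (intro exI[of _ "a # x"]) auto
  next
    case 2
    then show ?thesis by (intro exI[of _ "Suc i # y"]) auto
  qed
qed simp

lemma raising_snoc:
  "raising i w (y @ [r]) = raising i (\<lambda>x. w (x @ [r])) y + (if r = i then w (y @ [Suc i]) else 0)"
  by (induction y arbitrary: w) auto

lemma raising_funpow_cong:
  "(\<And>x. length x = length y \<Longrightarrow> f x = g x) \<Longrightarrow> (raising i ^^ k) f y = (raising i ^^ k) g y"
proof (induction k arbitrary: y)
  case (Suc k)
  have "raising i ((raising i ^^ k) f) y = raising i ((raising i ^^ k) g) y"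
    by (rule raising_cong) (rule Suc.IH, simp add: Suc.prems)
  then show ?case by simp
qed simp

lemma raising_funpow_zero: "(raising i ^^ k) (\<lambda>x. 0) y = 0"
proof (induction k arbitrary: y)
  case (Suc k)
  have "(raising i ^^ k) (\<lambda>x. 0) = (\<lambda>x. 0)" using Suc by blast
  with raising_cmult[of i 0 "\<lambda>x. 0"] show ?case by simp
qed simp

lemma raising_funpow_add:
  "(raising i ^^ k) (\<lambda>x. f x + g x) y = (raising i ^^ k) f y + (raising i ^^ k) g y"
proof (induction k arbitrary: y)
  case (Suc k)
  have "(raising i ^^ k) (\<lambda>x. f x + g x) = (\<lambda>x. (raising i ^^ k) f x + (raising i ^^ k) g x)"
    using Suc by blast
  then show ?case by (simp add: raising_add)
qed simp

text \<open>\<open>raising i\<close> is the matrix unit E_{i,i+1} acting on tensors as a derivation.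
  It squares to zero on a single letter, so in the binomial expansion of its k-th power the first
  letter carries exponent 0 or 1.\<close>

lemma raising_funpow_Cons:
  "(raising i ^^ k) w (a # y) = (raising i ^^ k) (\<lambda>x. w (a # x)) y
     + (if a = i then of_nat k * (raising i ^^ (k - 1)) (\<lambda>x. w (Suc i # x)) y else 0)"
proof (induction k arbitrary: w)
  case (Suc k)
  have "(raising i ^^ Suc k) w (a # y) = (raising i ^^ k) (raising i w) (a # y)"
    by (simp add: funpow_swap1)
  also have "\<dots> = (raising i ^^ k) (\<lambda>x. raising i w (a # x)) y
      + (if a = i then of_nat k * (raising i ^^ (k - 1)) (raising i (\<lambda>x. w (Suc i # x))) y else 0)"
    by (simp add: Suc)
  also have "(raising i ^^ k) (\<lambda>x. raising i w (a # x)) y = (raising i ^^ Suc k) (\<lambda>x. w (a # x)) y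
      + (if a = i then (raising i ^^ k) (\<lambda>x. w (Suc i # x)) y else 0)"
    by (simp add: raising_funpow_add raising_funpow_zero funpow_swap1)
  also have "of_nat k * (raising i ^^ (k - 1)) (raising i (\<lambda>x. w (Suc i # x))) y
      = of_nat k * (raising i ^^ k) (\<lambda>x. w (Suc i # x)) y"
    by (cases k) (simp_all add: funpow_swap1)
  finally show ?case by (simp add: algebra_simps)
qed simp

text \<open>In terms of \<open>sl\<^sub>2\<close>: the \<open>k\<close>-th power of the raising operator is injective on weights at
  most \<open>-k\<close>.\<close>

lemma raising_funpow_injective:
  assumes "\<And>y. length y = l \<Longrightarrow> (raising i ^^ k) w y = 0"
    and "\<And>y. length y = l \<Longrightarrow> w y \<noteq> 0 \<Longrightarrow> count_list y i + k \<le> count_list y (Suc i)"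
    and "length y = l"
  shows "w y = 0"
  using assms
proof (induction l arbitrary: w k y)
  case 0
  then show ?case by (cases k) auto
next
  case (Suc l)
  show ?case
  proof (cases k)
    case 0
    then show ?thesis using Suc.prems by simp
  next
    case (Suc k')
    let ?w = "\<lambda>a x. w (a # x)"
    \<comment> \<open>After slicing by the first letter, the hypothesis couples only the slices of
      \<open>i\<close> and \<open>Suc i\<close>.\<close>
    have kill: "(raising i ^^ k) (?w a) x
        + (if a = i then of_nat k * (raising i ^^ k') (?w (Suc i)) x else 0) = 0"
      if "length x = l" for a x
      using Suc.prems(1)[of "a # x"] that by (simp only: raising_funpow_Cons Suc length_Cons diff_Suc_1)
    have supp: "count_list (a # x) i + k \<le> count_list (a # x) (Suc i)"
      if "length x = l" "?w a x \<noteq> 0" for a x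
      using Suc.prems(2)[of "a # x"] that by simp
    have rest: "?w a x = 0" if "length x = l" "a \<noteq> i" "a \<noteq> Suc i" for a x
    proof (rule Suc.IH[where k = k and w = "?w a"])
      show "(raising i ^^ k) (?w a) y = 0" if "length y = l" for y
        using kill[of y a] that \<open>a \<noteq> i\<close> by simp
      show "count_list y i + k \<le> count_list y (Suc i)" if "length y = l" "?w a y \<noteq> 0" for y
        using supp[of y a] that \<open>a \<noteq> i\<close> \<open>a \<noteq> Suc i\<close> by simp
    qed (use that in auto)
    have kill_Suc: "(raising i ^^ k) (?w (Suc i)) x = 0" if "length x = l" for x
      using kill[of x "Suc i"] that by simp
    \<comment> \<open>Applying the operator once more removes the slice of \<open>Suc i\<close> from
      the coupled equation. Dropping a letter \<open>i\<close> improves the weight bound by one, so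
      the induction hypothesis applies with \<open>Suc k\<close>.\<close>
    have low: "?w i x = 0" if "length x = l" for x
    proof (rule Suc.IH[where k = "Suc k" and w = "?w i"])
      fix y :: "nat list" assume y: "length y = l"
      have "(raising i ^^ Suc k) (?w i) y = raising i (\<lambda>x. (raising i ^^ k) (?w i) x) y" by simp
      also have "\<dots> = raising i (\<lambda>x. - of_nat k * (raising i ^^ k') (?w (Suc i)) x) y"
        by (rule raising_cong) (use kill[of _ i] y in \<open>simp add: add_eq_0_iff2\<close>)
      also have "\<dots> = - of_nat k * (raising i ^^ k) (?w (Suc i)) y"
        by (simp only: raising_cmult Suc funpow.simps o_apply)
      finally show "(raising i ^^ Suc k) (?w i) y = 0" using kill_Suc[OF y] by simp
      show "count_list y i + Suc k \<le> count_list y (Suc i)" if "?w i y \<noteq> 0"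
        using supp[of y i] that y by simp
    qed (use that in auto)
    \<comment> \<open>With the slice of \<open>i\<close> gone, dividing by \<open>k\<close> leaves
      the power \<open>k'\<close>, which matches the bound after a letter \<open>Suc i\<close> has
      been dropped.\<close>
    have high: "?w (Suc i) x = 0" if "length x = l" for x
    proof (rule Suc.IH[where k = k' and w = "?w (Suc i)"])
      fix y :: "nat list" assume y: "length y = l"
      have "(raising i ^^ k) (?w i) y = (raising i ^^ k) (\<lambda>x. 0) y"
        by (rule raising_funpow_cong) (simp add: low y)
      then show "(raising i ^^ k') (?w (Suc i)) y = 0"
        using kill[of y i] y Suc by (simp add: raising_funpow_zero del: funpow.simps of_nat_Suc)
      show "count_list y i + k' \<le> count_list y (Suc i)" if "?w (Suc i) y \<noteq> 0"
        using supp[of y "Suc i"] that y Suc by simp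
    qed (use that in auto)
    obtain a x where "y = a # x" "length x = l" using Suc.prems(3) by (cases y) auto
    then show ?thesis using rest[of x a] low[of x] high[of x] by blast
  qed
qed

lemma lattice_word_snoc:
  "lattice_word (y @ [r]) \<longleftrightarrow>
     lattice_word y \<and> (\<forall>i\<ge>1. r = Suc i \<longrightarrow> count_list y (Suc i) < count_list y i)"
proof -
  have "lattice_word (y @ [r]) \<longleftrightarrow> lattice_word y \<and>
      (\<forall>i\<ge>1. count_list (y @ [r]) (Suc i) \<le> count_list (y @ [r]) i)"
    unfolding lattice_word_def by (auto simp: le_Suc_eq)
  also have "\<dots> \<longleftrightarrow> lattice_word y \<and>
      (\<forall>i\<ge>1. r = Suc i \<longrightarrow> count_list y (Suc i) < count_list y i)"
  proof (intro conj_cong refl)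
    assume "lattice_word y"
    then have "\<forall>i\<ge>1. count_list y (Suc i) \<le> count_list y i"
      unfolding lattice_word_def by (metis order_refl take_all)
    then show "(\<forall>i\<ge>1. count_list (y @ [r]) (Suc i) \<le> count_list (y @ [r]) i) \<longleftrightarrow>
        (\<forall>i\<ge>1. r = Suc i \<longrightarrow> count_list y (Suc i) < count_list y i)"
      by (auto simp: Suc_le_eq less_Suc_eq_le le_SucI)
  qed
  finally show ?thesis .
qed

lemma lattice_word_Nil [simp]: "lattice_word []"
  by (simp add: lattice_word_def)

text \<open>Among the slices of \<open>w\<close> by the last letter, the nonzero one with the largest letter is
  again killed by all raising operators.\<close>

lemma highest_weight_eq_zero:
  assumes "\<And>y. w y \<noteq> 0 \<Longrightarrow> length y = l \<and> set y \<subseteq> {1..n} \<and> (\<forall>i. count_list y i = \<mu> i)"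
    and "\<And>i y. i \<ge> 1 \<Longrightarrow> raising i w y = 0"
    and "\<And>y. lattice_word y \<Longrightarrow> w y = 0"
  shows "w y = 0"
  using assms
proof (induction l arbitrary: w \<mu> y)
  case 0
  then show ?case by (metis lattice_word_Nil length_0_conv)
next
  case (Suc l)
  show ?case
  proof (rule ccontr)
    assume "w y \<noteq> 0"
    let ?w = "\<lambda>r x. w (x @ [r])"
    have slice: "\<exists>x. ?w (last y) x \<noteq> 0 \<and> last y \<in> {1..n}" if "w y \<noteq> 0" for y
      using Suc.prems(1)[OF that] that by (metis append_butlast_last_id last_in_set list.size(3)
          nat.simps(3) subsetD)
    define K where "K = {r \<in> {1..n}. \<exists>x. ?w r x \<noteq> 0}"
    have K: "finite K" "K \<noteq> {}" using slice[OF \<open>w y \<noteq> 0\<close>] by (auto simp: K_def)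
    define R where "R = Max K"
    have "R \<in> K" using Max_in[OF K] by (simp add: R_def)
    then obtain x where x: "?w R x \<noteq> 0" and R: "R \<ge> 1" by (auto simp: K_def)
    \<comment> \<open>For \<open>i = R\<close>, raising \<open>w\<close> at a word ending in
      \<open>R\<close> has an extra term from the slice of \<open>Suc R\<close>. Maximality of
      \<open>R\<close> removes it.\<close>
    have above: "?w (Suc R) x = 0" for x
    proof (rule ccontr)
      assume "?w (Suc R) x \<noteq> 0"
      with slice[of "x @ [Suc R]"] have "Suc R \<in> K" by (auto simp: K_def)
      with Max_ge[OF K(1) this] show False by (simp add: R_def)
    qed
    have "?w R x = 0"
    proof (rule Suc.IH[where \<mu> = "\<mu>(R := \<mu> R - 1)" and w = "?w R"])
      fix y assume "?w R y \<noteq> 0"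
      from Suc.prems(1)[OF this] have y: "length y = l" "set y \<subseteq> {1..n}"
        and c: "count_list (y @ [R]) i = \<mu> i" for i
        by simp_all
      have "count_list y i = (\<mu>(R := \<mu> R - 1)) i" for i
        using c[of i] by (cases "i = R") auto
      with y show "length y = l \<and> set y \<subseteq> {1..n} \<and> (\<forall>i. count_list y i = (\<mu>(R := \<mu> R - 1)) i)"
        by blast
    next
      fix i :: nat and y assume "1 \<le> i"
      with Suc.prems(2)[of i "y @ [R]"] above[of y] show "raising i (?w R) y = 0"
        by (auto simp: raising_snoc split: if_splits)
    next
      fix y assume y: "lattice_word y"
      show "?w R y = 0"
      proof (rule ccontr)
        assume nz: "?w R y \<noteq> 0"
        with Suc.prems(3) have "\<not> lattice_word (y @ [R])" by blast
        with y obtain i where i: "i \<ge> 1" "R = Suc i" "count_list y i \<le> count_list y (Suc i)"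
          by (auto simp: lattice_word_snoc not_less)
        have mu: "count_list (y @ [R]) j = \<mu> j" for j using Suc.prems(1)[OF nz] by blast
        \<comment> \<open>All words in the support have the same content, so \<open>w\<close> as a
          whole has negative weight for the pair \<open>i\<close>, \<open>Suc i\<close>. Injectivity
          with \<open>k = 1\<close> then applies to \<open>w\<close> itself, not to the
          slice.\<close>
        have "\<mu> i + 1 \<le> \<mu> (Suc i)" using i mu[of i] mu[of "Suc i"] by simp
        then have "w (y @ [R]) = 0"
          by (intro raising_funpow_injective[where w = w and k = 1 and i = i and l = "length (y @ [R])"])
            (use Suc.prems(1,2) i in auto)
        with nz show False by blast
      qed
    qed
    with x show False by blast
  qed
qed

section \<open>Action of a matrix on a tensor power\<close>

text \<open>The first index of \<open>u\<close> belongs to the word at which the result is read, the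
  second to the word summed over. The index type is open because the operator serves both for
  letters of one row and for whole columns.\<close>

fun tensor_act ::
    "'a set \<Rightarrow> ('a \<Rightarrow> 'a \<Rightarrow> complex) \<Rightarrow> ('a list \<Rightarrow> complex) \<Rightarrow> 'a list \<Rightarrow> complex" where
  "tensor_act I u F [] = F []"
| "tensor_act I u F (a # y) = (\<Sum>b\<in>I. u a b * tensor_act I u (\<lambda>x. F (b # x)) y)"

definition tensor_coeff :: "('a \<Rightarrow> 'a \<Rightarrow> complex) \<Rightarrow> 'a list \<Rightarrow> 'a list \<Rightarrow> complex" where
  "tensor_coeff u y x = prod_list (map2 u y x)"

definition lists_of :: "'a set \<Rightarrow> nat \<Rightarrow> 'a list set" where
  "lists_of I l = {x. set x \<subseteq> I \<and> length x = l}"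

lemma finite_lists_of: "finite I \<Longrightarrow> finite (lists_of I l)"
  unfolding lists_of_def by (rule finite_lists_length_eq)

lemma lists_of_0 [simp]: "lists_of I 0 = {[]}"
  by (auto simp: lists_of_def)

lemma sum_lists_of_Suc:
  "(\<Sum>x\<in>lists_of I (Suc l). g x) = (\<Sum>b\<in>I. \<Sum>x\<in>lists_of I l. g (b # x))"
proof -
  have "lists_of I (Suc l) = (\<lambda>(b, x). b # x) ` (I \<times> lists_of I l)"
    by (auto simp: lists_of_def length_Suc_conv image_iff)
  moreover have "inj_on (\<lambda>(b, x). b # x) (I \<times> lists_of I l)"
    by (auto simp: inj_on_def)
  ultimately show ?thesis
    by (simp add: sum.reindex sum.cartesian_product case_prod_unfold)
qed

lemma tensor_coeff_Nil [simp]: "tensor_coeff u [] x = 1"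
  by (simp add: tensor_coeff_def)

lemma tensor_coeff_Cons [simp]: "tensor_coeff u (a # y) (b # x) = u a b * tensor_coeff u y x"
  by (simp add: tensor_coeff_def)

lemma tensor_coeff_nth:
  "length x = length y \<Longrightarrow> tensor_coeff u y x = (\<Prod>j<length y. u (y ! j) (x ! j))"
  by (induction y x rule: list_induct2')
    (auto simp: prod.lessThan_Suc_shift simp del: prod.lessThan_Suc)

lemma tensor_act_eq_sum:
  "tensor_act I u F y = (\<Sum>x\<in>lists_of I (length y). tensor_coeff u y x * F x)"
  by (induction y arbitrary: F) (simp_all add: sum_lists_of_Suc sum_distrib_left mult.assoc)

lemma tensor_act_cong:
  "(\<And>x. x \<in> lists_of I (length y) \<Longrightarrow> F x = G x) \<Longrightarrow> tensor_act I u F y = tensor_act I u G y"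
  by (simp add: tensor_act_eq_sum)

lemma tensor_act_cmult: "tensor_act I u (\<lambda>x. c * F x) y = c * tensor_act I u F y"
  by (simp add: tensor_act_eq_sum sum_distrib_left mult_ac)

lemma tensor_act_sum:
  "tensor_act I u (\<lambda>x. \<Sum>t\<in>A. F t x) y = (\<Sum>t\<in>A. tensor_act I u (F t) y)"
  by (simp add: tensor_act_eq_sum sum_distrib_left sum.swap[of _ A])

lemma tensor_act_diff:
  "tensor_act I u (\<lambda>x. F x - G x) y = tensor_act I u F y - tensor_act I u G y"
  by (simp add: tensor_act_eq_sum right_diff_distrib sum_subtractf)

lemma tensor_act_diagonal:
  assumes "\<And>a b. a \<in> I \<Longrightarrow> b \<in> I \<Longrightarrow> a \<noteq> b \<Longrightarrow> u a b = 0" "set y \<subseteq> I" "finite I"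
  shows "tensor_act I u F y = (\<Prod>a\<leftarrow>y. u a a) * F y"
  using assms(2)
proof (induction y arbitrary: F)
  case (Cons a y)
  then have "(\<Sum>b\<in>I. u a b * tensor_act I u (\<lambda>x. F (b # x)) y)
      = (\<Sum>b\<in>I. if b = a then u a a * tensor_act I u (\<lambda>x. F (a # x)) y else 0)"
    by (intro sum.cong refl) (use assms(1) in auto)
  then show ?case using Cons assms(3) by simp
qed simp

section \<open>Symmetric and antisymmetric functions of a list\<close>

definition swap_sym :: "complex \<Rightarrow> ('a list \<Rightarrow> complex) \<Rightarrow> bool" where
  "swap_sym \<epsilon> F \<longleftrightarrow> (\<forall>xs a b ys. F (xs @ a # b # ys) = \<epsilon> * F (xs @ b # a # ys))"

lemma swap_symD: "swap_sym \<epsilon> F \<Longrightarrow> F (xs @ a # b # ys) = \<epsilon> * F (xs @ b # a # ys)"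
  unfolding swap_sym_def by blast

lemma swap_sym_Cons: "swap_sym \<epsilon> F \<Longrightarrow> swap_sym \<epsilon> (\<lambda>x. F (c # x))"
  unfolding swap_sym_def append_Cons[symmetric] by blast

text \<open>The same \<open>u\<close> acts at every position, so the action commutes with permuting
  the positions.\<close>

lemma tensor_act_swap_sym:
  assumes "swap_sym \<epsilon> F"
  shows "swap_sym \<epsilon> (tensor_act I u F)"
proof -
  have "tensor_act I u F (xs @ a # b # ys) = \<epsilon> * tensor_act I u F (xs @ b # a # ys)" for xs a b ys
    using assms
  proof (induction xs arbitrary: F)
    case Nil
    have "tensor_act I u F (a # b # ys)
        = (\<Sum>c\<in>I. \<Sum>d\<in>I. u a c * (u b d * tensor_act I u (\<lambda>x. F (c # d # x)) ys))"
      by (simp add: sum_distrib_left)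
    also have "\<dots> = (\<Sum>c\<in>I. \<Sum>d\<in>I. u a c * (u b d * (\<epsilon> * tensor_act I u (\<lambda>x. F (d # c # x)) ys)))"
    proof (intro sum.cong refl)
      fix c d
      have "(\<lambda>x. F (c # d # x)) = (\<lambda>x. \<epsilon> * F (d # c # x))"
        using swap_symD[OF Nil, of "[]" c d] by simp
      then show "u a c * (u b d * tensor_act I u (\<lambda>x. F (c # d # x)) ys)
          = u a c * (u b d * (\<epsilon> * tensor_act I u (\<lambda>x. F (d # c # x)) ys))"
        by (simp only: tensor_act_cmult)
    qed
    also have "\<dots> = \<epsilon> * tensor_act I u F (b # a # ys)"
      by (subst sum.swap) (simp add: sum_distrib_left mult_ac)
    finally show ?case by simp
  next
    case (Cons c xs)
    show ?case
      using Cons.IH[OF swap_sym_Cons[OF Cons.prems]] by (simp add: sum_distrib_left mult_ac)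
  qed
  then show ?thesis unfolding swap_sym_def by blast
qed

text \<open>Bubble sort, phrased as an induction principle for a reflexive and transitive
  relation.\<close>

lemma mset_eq_adjacent_swaps:
  assumes "mset xs = mset ys"
    and refl: "\<And>xs. R xs xs"
    and trans: "\<And>xs ys zs. R xs ys \<Longrightarrow> R ys zs \<Longrightarrow> R xs zs"
    and swap: "\<And>xs a b ys. R (xs @ a # b # ys) (xs @ b # a # ys)"
  shows "R xs ys"
proof -
  have bubble: "R (ps @ a # us @ vs) (ps @ us @ a # vs)" for ps us vs a
  proof (induction us arbitrary: ps)
    case (Cons b us)
    show ?case
      using trans[OF swap[of ps a b "us @ vs"]] Cons[of "ps @ [b]"] by simp
  qed (simp add: refl)
  have "R (ps @ xs) (ps @ ys)" if "mset xs = mset ys" for ps xs ys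
    using that
  proof (induction xs arbitrary: ps ys)
    case (Cons a xs)
    then have "a \<in> set ys" by (metis list.set_intros(1) set_mset_mset)
    then obtain us vs where ys: "ys = us @ a # vs" by (meson split_list)
    with Cons.prems have "mset xs = mset (us @ vs)" by simp
    from Cons.IH[OF this, of "ps @ [a]"] bubble[of ps a us vs] show ?case
      using trans ys by simp
  qed (simp add: refl)
  from this[of xs ys "[]"] assms(1) show ?thesis by simp
qed

text \<open>The factor depends on the chain of swaps chosen, but one chain serves both functions.
  Knowing them at one arrangement thus compares them at all others, without any permutation
  sign.\<close>

lemma swap_sym_common_sign:
  assumes "swap_sym \<epsilon> F" "swap_sym \<epsilon> G" "\<epsilon> \<noteq> 0" "mset xs = mset ys"
  shows "\<exists>e\<noteq>0. F xs = e * F ys \<and> G xs = e * G ys"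
  using assms(4)
proof (rule mset_eq_adjacent_swaps, goal_cases)
  case (2 xs ys zs)
  then obtain e e' where "e \<noteq> 0" "e' \<noteq> 0" "F xs = e * F ys" "G xs = e * G ys"
    "F ys = e' * F zs" "G ys = e' * G zs" by blast
  then show ?case by (intro exI[of _ "e * e'"]) simp
next
  case (3 xs a b ys)
  show ?case
    using swap_symD[OF assms(1), of xs a b ys] swap_symD[OF assms(2), of xs a b ys] assms(3) by blast
qed (auto intro: exI[of _ 1])

text \<open>Exchanging two entries across a block of length l takes 2l + 1 adjacent swaps, and the
  factors \<epsilon> cancel in pairs.\<close>

lemma swap_sym_distant:
  assumes "swap_sym \<epsilon> F" "\<epsilon> * \<epsilon> = 1"
  shows "F (xs @ a # ys @ b # zs) = \<epsilon> * F (xs @ b # ys @ a # zs)"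
proof (induction ys arbitrary: xs)
  case Nil
  then show ?case using swap_symD[OF assms(1), of xs a b zs] by simp
next
  case (Cons c ys)
  have "F (xs @ a # (c # ys) @ b # zs) = \<epsilon> * F ((xs @ [c]) @ a # ys @ b # zs)"
    using swap_symD[OF assms(1), of xs a c] by simp
  also have "\<dots> = \<epsilon> * (\<epsilon> * F ((xs @ [c]) @ b # ys @ a # zs))" by (simp only: Cons)
  also have "\<dots> = \<epsilon> * (\<epsilon> * (\<epsilon> * F (xs @ b # (c # ys) @ a # zs)))"
    using swap_symD[OF assms(1), of xs c b] by simp
  finally show ?case by (metis assms(2) mult.assoc mult.left_neutral)
qed

lemma swap_sym_not_distinct:
  assumes "swap_sym (- 1) F" "\<not> distinct xs"
  shows "F xs = 0"
proof -
  obtain ps a qs rs where xs: "xs = ps @ [a] @ qs @ [a] @ rs"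
    using not_distinct_decomp[OF assms(2)] by blast
  have "F xs = - 1 * F xs"
    using swap_sym_distant[OF assms(1), of ps a qs a rs] unfolding xs append_Cons append_Nil
    by (simp only: minus_mult_minus mult_1 simp_thms)
  then have "F xs + F xs = 0" by (metis add.right_inverse mult_minus1)
  then show ?thesis by (simp flip: mult_2)
qed

section \<open>The sign of a word\<close>

lemma perm_sgn_swap: "perm_sgn (xs @ a # b # ys) = - perm_sgn (xs @ b # a # ys)"
proof (cases "distinct (xs @ b # a # ys) \<and> set (xs @ b # a # ys) = {1..length (xs @ b # a # ys)}")
  case True
  let ?l = "xs @ a # b # ys" and ?l' = "xs @ b # a # ys" and ?k = "Suc (length xs)"
  let ?N = "{1..length ?l'}" and ?\<tau> = "Transposition.transpose ?k (Suc ?k)"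
  have nth: "?l ! (i - 1) = (\<lambda>i. ?l' ! (i - 1)) (?\<tau> i)" if "i \<in> ?N" for i
    using that
    by (auto simp: nth_append nth_Cons' Transposition.transpose_def)
  have "sign_on ?N (\<lambda>i. ?l ! (i - 1)) = sign_on ?N ((\<lambda>i. ?l' ! (i - 1)) \<circ> ?\<tau>)"
    by (rule sign_on_cong) (use nth in auto)
  also have "\<dots> = sign_on ?N (\<lambda>i. ?l' ! (i - 1)) * sign_on ?N ?\<tau>"
  proof (rule sign_on_compose)
    have "bij_betw (\<lambda>i. i - 1) {1..length ?l'} {..<length ?l'}"
      by (rule bij_betw_byWitness[where f' = Suc]) auto
    moreover have "bij_betw ((!) ?l') {..<length ?l'} (set ?l')"
      by (rule bij_betw_nth) (use True in auto)
    ultimately have "bij_betw ((!) ?l' \<circ> (\<lambda>i. i - 1)) ?N (set ?l')"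
      by (rule bij_betw_trans)
    then show "bij_betw (\<lambda>i. ?l' ! (i - 1)) ?N ?N" using True by (simp add: comp_def)
    show "bij_betw ?\<tau> ?N ?N" by (rule permutes_imp_bij, rule permutes_swap_id) auto
  qed simp
  also have "sign_on ?N ?\<tau> = -1" by (rule sign_on_transpose) auto
  finally show ?thesis using True by (auto simp: perm_sgn_def insert_commute)
next
  case False
  then have "\<not> (distinct (xs @ a # b # ys) \<and> set (xs @ a # b # ys) = {1..length (xs @ a # b # ys)})"
    by (auto simp: insert_commute)
  then show ?thesis using False by (simp only: perm_sgn_def if_False minus_zero)
qed

lemma swap_sym_perm_sgn: "swap_sym (- 1) (\<lambda>x. of_int (perm_sgn x))"
  unfolding swap_sym_def by (intro allI) (subst perm_sgn_swap, simp)

lemma perm_sgn_nonzeroD: "perm_sgn x \<noteq> 0 \<Longrightarrow> distinct x \<and> set x = {1..length x}"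
  by (auto simp: perm_sgn_def split: if_splits)

lemma perm_sgn_upt [simp]: "perm_sgn [1..<Suc k] = 1"
proof -
  have "sign_on {1..k} (\<lambda>i. [1..<Suc k] ! (i - 1)) = sign_on {1..k} (\<lambda>i. i)"
    by (rule sign_on_cong) (auto simp del: upt_Suc)
  then show ?thesis by (auto simp: perm_sgn_def simp del: upt_Suc)
qed

lemma mset_eq_upt_iff: "mset x = mset [1..<Suc (length x)] \<longleftrightarrow> distinct x \<and> set x = {1..length x}"
proof
  assume "mset x = mset [1..<Suc (length x)]"
  then show "distinct x \<and> set x = {1..length x}"
    by (metis atLeastLessThanSuc_atLeastAtMost distinct_upt mset_eq_imp_distinct_iff mset_eq_setD set_upt)
next
  assume "distinct x \<and> set x = {1..length x}"
  then show "mset x = mset [1..<Suc (length x)]"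
    using set_eq_iff_mset_eq_distinct[of x "[1..<Suc (length x)]"]
    by (simp add: atLeastLessThanSuc_atLeastAtMost del: upt_Suc mset_upt)
qed

text \<open>Up to the sign that both sides acquire under permutations of \<open>y\<close>, this is the
  expansion of the leading principal minor of an upper triangular matrix.\<close>

lemma tensor_act_perm_sgn:
  assumes upper: "\<And>a b. a \<in> {1..n} \<Longrightarrow> b \<in> {1..n} \<Longrightarrow> b < a \<Longrightarrow> u a b = 0" and y: "set y \<subseteq> {1..n}"
  shows "tensor_act {1..n} u (\<lambda>x. of_int (perm_sgn x)) y = (\<Prod>a\<leftarrow>y. u a a) * of_int (perm_sgn y)"
proof -
  let ?k = "length y" and ?p = "\<lambda>x. complex_of_int (perm_sgn x)"
  have coeff0: "tensor_coeff u z x = 0"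
    if "x \<in> lists_of {1..n} (length z)" "j < length z" "x ! j < z ! j" "set z \<subseteq> {1..n}" for x z j
  proof -
    have "u (z ! j) (x ! j) = 0"
    proof (rule upper)
      show "z ! j \<in> {1..n}" using that by (meson nth_mem subsetD)
      have "j < length x" "set x \<subseteq> {1..n}" using that by (simp_all add: lists_of_def)
      then show "x ! j \<in> {1..n}" by (meson nth_mem subsetD)
    qed (use that in simp)
    then show ?thesis using that by (auto simp: tensor_coeff_nth lists_of_def)
  qed
  consider "\<not> set y \<subseteq> {1..?k}" | "\<not> distinct y" | "distinct y" "set y \<subseteq> {1..?k}" by blast
  then show ?thesis
  proof cases
    case 1
    \<comment> \<open>A row index beyond \<open>?k\<close> meets only column indices up to
      \<open>?k\<close>, hence only entries strictly below the diagonal.\<close>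
    then obtain j where j: "j < ?k" "?k < y ! j"
      using y by (fastforce simp: in_set_conv_nth subset_iff not_le)
    have "tensor_coeff u y x * ?p x = 0" if "x \<in> lists_of {1..n} ?k" for x
    proof (cases "perm_sgn x = 0")
      case False
      then have "x ! j < y ! j"
        using perm_sgn_nonzeroD[OF False] j that nth_mem[of j x] by (auto simp: lists_of_def)
      then show ?thesis using coeff0[OF that j(1) _ y] by simp
    qed simp
    then have "tensor_act {1..n} u ?p y = 0"
      unfolding tensor_act_eq_sum by (intro sum.neutral ballI)
    moreover have "perm_sgn y = 0" using 1 perm_sgn_nonzeroD by blast
    ultimately show ?thesis by simp
  next
    case 2
    then have "tensor_act {1..n} u ?p y = 0"
      by (rule swap_sym_not_distinct[OF tensor_act_swap_sym[OF swap_sym_perm_sgn]])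
    moreover have "perm_sgn y = 0" using 2 perm_sgn_nonzeroD by blast
    ultimately show ?thesis by simp
  next
    case 3
    \<comment> \<open>Both sides pick up the same factor when \<open>y\<close> is rearranged, so the
      increasing arrangement \<open>z\<close> suffices. There a nonzero term has
      \<open>z ! j \<le> x ! j\<close> everywhere and equal sums, which leaves only the diagonal
      term.\<close>
    define z where "z = [1..<Suc ?k]"
    have "set y = {1..?k}"
      using 3 by (intro card_subset_eq) (auto simp: distinct_card)
    with 3 have ms: "mset y = mset z" using mset_eq_upt_iff[of y] unfolding z_def by blast
    then have z: "length z = ?k" "set z \<subseteq> {1..n}" using y by (metis mset_eq_length, metis mset_eq_setD)
    have "tensor_coeff u z x * ?p x = 0" if x: "x \<in> lists_of {1..n} ?k" "x \<noteq> z" for x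
    proof (rule ccontr)
      assume "tensor_coeff u z x * ?p x \<noteq> 0"
      then have nz: "tensor_coeff u z x \<noteq> 0" and "perm_sgn x \<noteq> 0" by auto
      have lx: "length x = ?k" using x by (simp add: lists_of_def)
      have "mset x = mset z"
        using perm_sgn_nonzeroD[OF \<open>perm_sgn x \<noteq> 0\<close>] lx mset_eq_upt_iff[of x] by (simp only: z_def) 
      then have "sum_list x = sum_list z" by (metis sum_mset_sum_list)
      then have eq: "(\<Sum>j<?k. z ! j) = (\<Sum>j<?k. x ! j)"
        using lx z by (simp add: sum_list_sum_nth atLeast0LessThan)
      have le: "z ! j \<le> x ! j" if "j < ?k" for j
        using coeff0[of x z j] nz x that z by (metis not_le_imp_less)
      have "z ! j = x ! j" if "j < ?k" for j
        using sum_mono_inv[OF eq, of j] le that by auto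
      then have "x = z" by (intro nth_equalityI) (use lx z in auto)
      with x show False by simp
    qed
    then have "(\<Sum>x\<in>lists_of {1..n} ?k. tensor_coeff u z x * ?p x)
        = (\<Sum>x\<in>{z}. tensor_coeff u z x * ?p x)"
      using z by (intro sum.mono_neutral_right) (auto simp: finite_lists_of, simp add: lists_of_def)
    then have act_z: "tensor_act {1..n} u ?p z = (\<Prod>a\<leftarrow>z. u a a) * ?p z"
      using z by (simp add: tensor_act_eq_sum tensor_coeff_def zip_same_conv_map comp_def)
    obtain e where "tensor_act {1..n} u ?p y = e * tensor_act {1..n} u ?p z" "?p y = e * ?p z"
      using swap_sym_common_sign[OF tensor_act_swap_sym[OF swap_sym_perm_sgn] swap_sym_perm_sgn _ ms]
      by auto
    moreover have "(\<Prod>a\<leftarrow>y. u a a) = (\<Prod>a\<leftarrow>z. u a a)"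
      unfolding prod_mset_prod_list[symmetric] mset_map by (simp only: ms)
    ultimately show ?thesis using act_z by simp
  qed
qed

section \<open>Restriction of a word to the positions of one letter\<close>

fun letters_at :: "'b \<Rightarrow> 'b list \<Rightarrow> 'a list \<Rightarrow> 'a list" where
  "letters_at c (a # s) (b # x) = (if a = c then b # letters_at c s x else letters_at c s x)"
| "letters_at c _ _ = []"

text \<open>Trades a set of positions for a recursion on both words, which the inductions below can
  follow.\<close>

lemma nths_eq_letters_at:
  "length x = length s \<Longrightarrow> nths x {b. b < length s \<and> s ! b = c} = letters_at c s x"
  by (induction s x rule: list_induct2') (auto simp: nths_Cons)

lemma perm_sgn_Nil [simp]: "perm_sgn [] = 1"
  using perm_sgn_upt[of 0] by simp

lemma letters_at_notin: "c \<notin> set s \<Longrightarrow> letters_at c s x = []"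
  by (induction c s x rule: letters_at.induct) auto

lemma word_sgn_superset:
  assumes "length x = length s" "finite C" "set s \<subseteq> C"
  shows "word_sgn s x = (\<Prod>c\<in>C. perm_sgn (letters_at c s x))"
  unfolding word_sgn_def nths_eq_letters_at[OF assms(1)]
  by (rule prod.mono_neutral_left) (use assms in \<open>auto simp: letters_at_notin\<close>)

lemma word_sgn_eq:
  "length x = length s \<Longrightarrow> word_sgn s x = (\<Prod>c\<in>set s. perm_sgn (letters_at c s x))"
  by (rule word_sgn_superset) auto

text \<open>Positions carrying different letters of \<open>s\<close> are independent tensor factors.
  The family \<open>f\<close> and the superset \<open>C\<close> are kept general because the
  induction prepends a letter in one member of the family and may lose a letter of
  \<open>s\<close>.\<close>

lemma tensor_act_letters_at:
  assumes "length s = length y" "finite C" "set s \<subseteq> C"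
  shows "tensor_act I u (\<lambda>x. \<Prod>c\<in>C. f c (letters_at c s x)) y
    = (\<Prod>c\<in>C. tensor_act I u (f c) (letters_at c s y))"
  using assms(1,3)
proof (induction s y arbitrary: f rule: list_induct2)
  case (Cons a s q y)
  then have a: "a \<in> C" by simp
  let ?f = "\<lambda>b c. if c = a then (\<lambda>z. f a (b # z)) else f c"
  have "f c (letters_at c (a # s) (b # x)) = ?f b c (letters_at c s x)" for b c x by simp
  then have "tensor_act I u (\<lambda>x. \<Prod>c\<in>C. f c (letters_at c (a # s) x)) (q # y)
      = (\<Sum>b\<in>I. u q b * tensor_act I u (\<lambda>x. \<Prod>c\<in>C. ?f b c (letters_at c s x)) y)"
    by (simp only: tensor_act.simps)
  also have "\<dots> = (\<Sum>b\<in>I. u q b * (\<Prod>c\<in>C. tensor_act I u (?f b c) (letters_at c s y)))"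
  proof (rule sum.cong[OF refl])
    fix b
    have "tensor_act I u (\<lambda>x. \<Prod>c\<in>C. ?f b c (letters_at c s x)) y
        = (\<Prod>c\<in>C. tensor_act I u (?f b c) (letters_at c s y))"
      by (rule Cons.IH) (use Cons.prems in simp)
    then show "u q b * tensor_act I u (\<lambda>x. \<Prod>c\<in>C. ?f b c (letters_at c s x)) y
        = u q b * (\<Prod>c\<in>C. tensor_act I u (?f b c) (letters_at c s y))"
      by (rule arg_cong)
  qed
  also have "\<dots> = (\<Sum>b\<in>I. u q b * (tensor_act I u (\<lambda>z. f a (b # z)) (letters_at a s y)
      * (\<Prod>c\<in>C - {a}. tensor_act I u (f c) (letters_at c s y))))"
  proof (rule sum.cong[OF refl])
    fix b
    have "(\<Prod>c\<in>C - {a}. tensor_act I u (?f b c) (letters_at c s y))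
        = (\<Prod>c\<in>C - {a}. tensor_act I u (f c) (letters_at c s y))"
      by (rule prod.cong) auto
    then show "u q b * (\<Prod>c\<in>C. tensor_act I u (?f b c) (letters_at c s y))
        = u q b * (tensor_act I u (\<lambda>z. f a (b # z)) (letters_at a s y)
          * (\<Prod>c\<in>C - {a}. tensor_act I u (f c) (letters_at c s y)))"
      by (simp add: prod.remove[OF assms(2) a])
  qed
  also have "\<dots> = tensor_act I u (f a) (letters_at a (a # s) (q # y))
      * (\<Prod>c\<in>C - {a}. tensor_act I u (f c) (letters_at c (a # s) (q # y)))"
  proof -
    have "(\<Prod>c\<in>C - {a}. tensor_act I u (f c) (letters_at c (a # s) (q # y)))
        = (\<Prod>c\<in>C - {a}. tensor_act I u (f c) (letters_at c s y))"
      by (rule prod.cong) auto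
    then show ?thesis by (simp add: sum_distrib_left mult_ac)
  qed
  also have "\<dots> = (\<Prod>c\<in>C. tensor_act I u (f c) (letters_at c (a # s) (q # y)))"
    by (rule prod.remove[symmetric]) (use assms(2) a in auto)
  finally show ?case .
qed simp

lemma prod_letters_at:
  fixes g :: "'a \<Rightarrow> 'c::comm_monoid_mult"
  assumes "length s = length y" "finite C" "set s \<subseteq> C"
  shows "(\<Prod>c\<in>C. \<Prod>a\<leftarrow>letters_at c s y. g a) = (\<Prod>a\<leftarrow>y. g a)"
  using assms(1,3)
proof (induction s y rule: list_induct2)
  case (Cons a s q y)
  then have a: "a \<in> C" by simp
  have "(\<Prod>c\<in>C. \<Prod>a\<leftarrow>letters_at c (a # s) (q # y). g a)
      = (\<Prod>c\<in>C. (if c = a then g q else 1) * (\<Prod>a\<leftarrow>letters_at c s y. g a))"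
    by (rule prod.cong) auto
  also have "\<dots> = g q * (\<Prod>c\<in>C. \<Prod>a\<leftarrow>letters_at c s y. g a)"
    using a assms(2) by (simp add: prod.distrib)
  finally show ?case using Cons by simp
qed simp

lemma set_letters_at_subset: "set (letters_at c s y) \<subseteq> set y"
  by (induction c s y rule: letters_at.induct) auto

text \<open>Each letter of \<open>s\<close> contributes a leading principal minor, an eigenvector of
  every upper triangular matrix. The diagonal entries of all the minors recombine to one product
  along \<open>y\<close>.\<close>

lemma tensor_act_word_sgn:
  assumes "\<And>a b. a \<in> {1..n} \<Longrightarrow> b \<in> {1..n} \<Longrightarrow> b < a \<Longrightarrow> u a b = 0"
    and "set y \<subseteq> {1..n}" "length s = length y"
  shows "tensor_act {1..n} u (\<lambda>x. of_int (word_sgn s x)) y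
    = (\<Prod>a\<leftarrow>y. u a a) * of_int (word_sgn s y)"
proof -
  have "tensor_act {1..n} u (\<lambda>x. of_int (word_sgn s x)) y
      = tensor_act {1..n} u (\<lambda>x. \<Prod>c\<in>set s. of_int (perm_sgn (letters_at c s x))) y"
    by (rule tensor_act_cong) (simp add: lists_of_def word_sgn_eq assms(3))
  also have "\<dots> = (\<Prod>c\<in>set s. tensor_act {1..n} u (\<lambda>x. of_int (perm_sgn x)) (letters_at c s y))"
    by (rule tensor_act_letters_at) (use assms in auto)
  also have "\<dots> = (\<Prod>c\<in>set s. (\<Prod>a\<leftarrow>letters_at c s y. u a a) * of_int (perm_sgn (letters_at c s y)))"
    by (intro prod.cong refl tensor_act_perm_sgn) (use assms set_letters_at_subset in fastforce)+
  also have "\<dots> = (\<Prod>a\<leftarrow>y. u a a) * of_int (word_sgn s y)"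
    using assms(3) by (simp add: prod.distrib prod_letters_at word_sgn_eq)
  finally show ?thesis .
qed

section \<open>Lattice words\<close>

definition running_count :: "nat list \<Rightarrow> nat list" where
  "running_count w = map (\<lambda>j. count_list (take (Suc j) w) (w ! j)) [0..<length w]"

lemma length_running_count [simp]: "length (running_count w) = length w"
  by (simp add: running_count_def)

lemma running_count_Nil [simp]: "running_count [] = []"
  by (simp add: running_count_def)

lemma running_count_snoc [simp]: "running_count (w @ [a]) = running_count w @ [Suc (count_list w a)]"
proof (rule nth_equalityI)
  fix j assume "j < length (running_count (w @ [a]))"
  then consider "j < length w" | "j = length w" by force
  then show "running_count (w @ [a]) ! j = (running_count w @ [Suc (count_list w a)]) ! j"
    by cases (simp_all add: running_count_def nth_append del: upt_Suc)
qed simp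

lemma letters_at_snoc [simp]:
  "length s = length x \<Longrightarrow>
     letters_at c (s @ [a]) (x @ [b]) = letters_at c s x @ (if a = c then [b] else [])"
  by (induction s x rule: list_induct2) auto

text \<open>At the positions of each letter the running count is the identity arrangement, where the
  sign is 1. This provides the diagonal of the triangular system.\<close>

lemma letters_at_running_count: "letters_at c s (running_count s) = [1..<Suc (count_list s c)]"
  by (induction s rule: rev_induct) auto

lemma length_letters_at: "length s = length x \<Longrightarrow> length (letters_at c s x) = count_list s c"
  by (induction s x rule: list_induct2) auto

lemma word_sgn_running_count [simp]: "word_sgn s (running_count s) = 1"
  by (simp add: word_sgn_eq letters_at_running_count del: upt_Suc One_nat_def)

lemma word_sgn_nonzeroD:
  assumes "word_sgn s y \<noteq> 0" "length y = length s"
  shows "distinct (letters_at c s y) \<and> set (letters_at c s y) = {1..count_list s c}"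
proof (cases "c \<in> set s")
  case True
  then have "perm_sgn (letters_at c s y) \<noteq> 0" using assms by (auto simp: word_sgn_eq)
  from perm_sgn_nonzeroD[OF this] show ?thesis using assms by (simp add: length_letters_at)
qed (simp add: letters_at_notin)

lemma append_le_append_left: "xs @ ys \<le> xs @ zs \<longleftrightarrow> ys \<le> (zs :: 'a::linorder list)"
  by (induction xs) auto

text \<open>The running count is the lexicographically least such word: while the prefixes agree,
  the values up to \<open>count_list s a\<close> are used up at the positions of \<open>a\<close>,
  so the next entry cannot be smaller.\<close>

lemma running_count_le:
  assumes "length s = length y"
    and "\<And>c. distinct (letters_at c s y) \<and> 0 \<notin> set (letters_at c s y)"
  shows "running_count s \<le> y"
  using assms
proof (induction s arbitrary: y rule: rev_induct)
  case (snoc a s)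
  obtain z b where y: "y = z @ [b]" and z: "length s = length z"
    using snoc.prems(1) by (metis length_append_singleton length_Suc_conv_rev)
  have letters: "distinct (letters_at c s z) \<and> 0 \<notin> set (letters_at c s z)"
    "c = a \<Longrightarrow> b \<notin> set (letters_at c s z) \<and> b \<noteq> 0" for c
    using snoc.prems(2)[of c] z by (auto simp: y split: if_splits)
  have "running_count s \<le> z" by (rule snoc.IH) (use z letters in auto)
  then consider "running_count s < z" | "z = running_count s" by force
  then show ?case
  proof cases
    case 1
    then have "running_count (s @ [a]) < z @ [b]"
      unfolding list_less_def by (simp add: lexord_sufI z)
    then show ?thesis by (simp add: y)
  next
    case 2
    then have "b \<notin> {1..count_list s a}" "b \<noteq> 0"
      using letters(2)[of a] by (auto simp: letters_at_running_count)
    then have "Suc (count_list s a) \<le> b" by auto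
    then show ?thesis
      unfolding y 2 running_count_snoc append_le_append_left by (simp add: le_less)
  qed
qed simp

lemma running_count_le_of_word_sgn:
  "word_sgn s y \<noteq> 0 \<Longrightarrow> length y = length s \<Longrightarrow> running_count s \<le> y"
  by (rule running_count_le) (use word_sgn_nonzeroD in auto)

lemma count_list_letters_at:
  assumes "length s = length y" "finite C" "set s \<subseteq> C"
  shows "count_list y i = (\<Sum>c\<in>C. count_list (letters_at c s y) i)"
  using assms(1,3)
proof (induction s y rule: list_induct2)
  case (Cons a s q y)
  have "(\<Sum>c\<in>C. count_list (letters_at c (a # s) (q # y)) i)
      = (\<Sum>c\<in>C. (if c = a then (if q = i then 1 else 0) else 0) + count_list (letters_at c s y) i)"
    by (rule sum.cong) auto
  also have "\<dots> = (if q = i then 1 else 0) + (\<Sum>c\<in>C. count_list (letters_at c s y) i)"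
    using Cons assms(2) by (simp add: sum.distrib)
  finally show ?case using Cons by simp
qed simp

lemma count_list_distinct: "distinct x \<Longrightarrow> count_list x i = (if i \<in> set x then 1 else 0)"
  by (induction x) auto

text \<open>Each letter \<open>c\<close> of \<open>s\<close> accounts for the values from 1 to
  \<open>count_list s c\<close>, once each, so the content of \<open>y\<close> is conjugate to that
  of \<open>s\<close>.\<close>

lemma count_list_of_word_sgn:
  assumes "word_sgn s y \<noteq> 0" "length y = length s"
  shows "count_list y i = (if i = 0 then 0 else card {c \<in> set s. i \<le> count_list s c})"
proof -
  have "count_list y i = (\<Sum>c\<in>set s. count_list (letters_at c s y) i)"
    by (rule count_list_letters_at) (use assms in auto)
  also have "\<dots> = (\<Sum>c\<in>set s. if 1 \<le> i \<and> i \<le> count_list s c then 1 else 0)"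
    using word_sgn_nonzeroD[OF assms] by (intro sum.cong refl) (simp add: count_list_distinct)
  also have "\<dots> = (if i = 0 then 0 else card {c \<in> set s. i \<le> count_list s c})"
    by (auto simp: sum.If_cases Int_def)
  finally show ?thesis .
qed

lemma count_list_running_count:
  "i \<ge> 1 \<Longrightarrow> count_list (running_count s) i = card {c \<in> set s. i \<le> count_list s c}"
  by (subst count_list_of_word_sgn[of s]) auto

lemma lattice_word_count_antimono:
  assumes "lattice_word w" "1 \<le> a" "a \<le> b"
  shows "count_list w b \<le> count_list w a"
  using assms(3)
proof (induction b rule: dec_induct)
  case (step b)
  have "count_list w (Suc b) \<le> count_list w b"
    using assms(1,2) step by (auto simp: lattice_word_def dest: spec[of _ "length w"])
  with step show ?case by simp
qed simp

text \<open>The counts of a lattice word form a partition and \<open>a\<close> is appended at an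
  addable cell, so the rows longer than row \<open>a\<close> are exactly those above it.\<close>

lemma lattice_word_snoc_above:
  assumes "lattice_word (w @ [a])" "0 \<notin> set w" "a \<ge> 1"
  shows "{c \<in> set w. Suc (count_list w a) \<le> count_list w c} = {1..<a}"
proof -
  have w: "lattice_word w" using assms(1) by (simp add: lattice_word_snoc)
  have A: "count_list w c > count_list w a" if "1 \<le> c" "c < a" for c
  proof -
    have "count_list w (Suc (a - 1)) < count_list w (a - 1)"
      using assms(1) that unfolding lattice_word_snoc by (cases a) auto
    also have "count_list w (a - 1) \<le> count_list w c"
      using lattice_word_count_antimono[OF w] that by simp
    finally show ?thesis using that by simp
  qed
  have B: "c \<in> set w" if "count_list w c > count_list w a" for c
    using that by (metis count_list_0_iff not_less_zero)
  have C: "c \<ge> 1 \<and> c < a" if "c \<in> set w" "count_list w c > count_list w a" for c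
  proof -
    have "c \<noteq> 0" using that(1) assms(2) by metis
    then have "c \<ge> 1" by simp
    then show ?thesis
      using lattice_word_count_antimono[OF w assms(3), of c] that by (cases "c < a") auto
  qed
  show ?thesis
  proof (intro equalityI subsetI)
    fix c assume "c \<in> {c \<in> set w. Suc (count_list w a) \<le> count_list w c}"
    then show "c \<in> {1..<a}" using C[of c] by simp
  next
    fix c assume "c \<in> {1..<a}"
    then have "1 \<le> c" "c < a" by simp_all
    from A[OF this] show "c \<in> {c \<in> set w. Suc (count_list w a) \<le> count_list w c}"
      using B[OF A[OF \<open>1 \<le> c\<close> \<open>c < a\<close>]] by simp
  qed
qed

text \<open>Read as a standard Young tableau, a lattice word records the row of each entry, and
  \<open>running_count\<close> records its column.\<close>

lemma running_count_lattice:
  assumes "lattice_word w" "0 \<notin> set w"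
  shows "running_count (running_count w) = w \<and> lattice_word (running_count w)"
  using assms
proof (induction w rule: rev_induct)
  case (snoc a w)
  have w: "lattice_word w" "0 \<notin> set w" and a: "a \<ge> 1"
    using snoc.prems by (auto simp: lattice_word_snoc Suc_le_eq intro: ccontr)
  note IH = snoc.IH[OF w]
  \<comment> \<open>The new cell lies in column \<open>Suc (count_list w a)\<close>, which so far
    consists of the rows above \<open>a\<close>. Its running count in the column word is therefore
    \<open>a\<close>.\<close>
  have above: "count_list (running_count w) (Suc (count_list w a)) = a - 1"
    using lattice_word_snoc_above[OF snoc.prems(1) w(2) a] by (simp add: count_list_running_count)
  \<comment> \<open>Row \<open>a\<close> ends in column \<open>i\<close>, so that column is strictly
    longer than column \<open>Suc i\<close>, which may then receive a cell.\<close>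
  have "count_list (running_count w) (Suc i) < count_list (running_count w) i"
    if "i \<ge> 1" "count_list w a = i" for i
  proof -
    have "a \<in> set w" using that count_list_0_iff[of w a] by linarith
    then have "a \<in> {c \<in> set w. i \<le> count_list w c} - {c \<in> set w. Suc i \<le> count_list w c}"
      using that by simp
    moreover have "{c \<in> set w. Suc i \<le> count_list w c} \<subseteq> {c \<in> set w. i \<le> count_list w c}"
      using Suc_leD by blast
    ultimately have "{c \<in> set w. Suc i \<le> count_list w c} \<subset> {c \<in> set w. i \<le> count_list w c}"
      by blast
    then show ?thesis
      using that by (simp add: count_list_running_count psubset_card_mono)
  qed
  then show ?case using IH above a by (auto simp: lattice_word_snoc)
qed simp

section \<open>Partitions\<close>

text \<open>Numbering from 1 and extension by 0 let contents of words be compared at all letters,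
  without range conditions.\<close>

definition part :: "nat list \<Rightarrow> nat \<Rightarrow> nat" where
  "part p i = (if 1 \<le> i \<and> i \<le> length p then p ! (i - 1) else 0)"

lemma sum_list_eq_sum_part: "sum_list p = (\<Sum>i\<in>{1..length p}. part p i)"
proof -
  have "sum_list p = (\<Sum>i<length p. p ! i)" by (simp add: sum_list_sum_nth atLeast0LessThan)
  also have "\<dots> = (\<Sum>i\<in>{1..length p}. part p i)"
    by (rule sum.reindex_bij_witness[of _ "\<lambda>i. i - 1" Suc]) (auto simp: part_def)
  finally show ?thesis .
qed

text \<open>The letter counts determine the alphabet, because \<open>part\<close> vanishes off the
  listed parts, and then the length as their sum.\<close>

lemma words_iff: "w \<in> words \<alpha> \<longleftrightarrow> (\<forall>i. count_list w i = part \<alpha> i)"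
proof
  assume w: "w \<in> words \<alpha>"
  show "\<forall>i. count_list w i = part \<alpha> i"
  proof
    fix i
    show "count_list w i = part \<alpha> i"
    proof (cases "i \<in> {1..length \<alpha>}")
      case False
      then have "i \<notin> set w" using w by (auto simp: words_def)
      then show ?thesis using False by (auto simp: part_def count_list_0_iff)
    qed (use w in \<open>auto simp: words_def part_def\<close>)
  qed
next
  assume w: "\<forall>i. count_list w i = part \<alpha> i"
  have sub: "set w \<subseteq> {1..length \<alpha>}"
  proof
    fix i assume "i \<in> set w"
    then have "part \<alpha> i \<noteq> 0" using w by (metis count_list_0_iff)
    then show "i \<in> {1..length \<alpha>}" by (auto simp: part_def split: if_splits)
  qed
  have "length w = (\<Sum>i\<in>set w. count_list w i)" by (simp add: sum_count_set[symmetric])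
  also have "\<dots> = (\<Sum>i\<in>{1..length \<alpha>}. count_list w i)"
    by (rule sum.mono_neutral_left) (use sub in \<open>auto simp: count_list_0_iff\<close>)
  finally have "length w = sum_list \<alpha>" using w by (simp add: sum_list_eq_sum_part)
  then show "w \<in> words \<alpha>" using w sub by (auto simp: words_def part_def)
qed

lemma part_conjugate: "j \<ge> 1 \<Longrightarrow> part (conjugate_partition p) j = length (filter (\<lambda>x. j \<le> x) p)"
proof (cases "j \<le> Max (insert 0 (set p))")
  case False
  then have "filter (\<lambda>x. j \<le> x) p = []"
    by (auto simp: filter_empty_conv) (metis Max_ge List.finite_set finite_insert insertCI order_trans)
  then show ?thesis using False by (simp add: part_def conjugate_partition_def)
next
  case True
  assume "j \<ge> 1"
  then have "[1..<Suc (Max (insert 0 (set p)))] ! (j - 1) = j"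
    using True by (subst nth_upt) auto
  then show ?thesis
    using True \<open>j \<ge> 1\<close> by (simp add: part_def conjugate_partition_def del: upt_Suc)
qed

text \<open>In a weakly decreasing list the entries that are at least \<open>c\<close> form an
  initial segment.\<close>

lemma filter_ge_length_iff:
  "sorted_wrt (\<ge>) p \<Longrightarrow> k < length p \<Longrightarrow> k < length (filter (\<lambda>x. c \<le> x) p) \<longleftrightarrow> c \<le> p ! k"
  for p :: "nat list"
proof (induction p arbitrary: k)
  case (Cons x xs)
  show ?case
  proof (cases "c \<le> x")
    case True
    then show ?thesis using Cons by (cases k) auto
  next
    case False
    then have "filter (\<lambda>x. c \<le> x) xs = []" "\<not> c \<le> (x # xs) ! k"
      using Cons.prems by (auto simp: filter_empty_conv nth_Cons' dest: nth_mem) 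
        (metis One_nat_def Suc_pred le_trans less_Suc_eq_0_disj less_Suc_eq_le not_less_eq nth_mem)
    then show ?thesis using False by simp
  qed
qed simp

lemma part_eq_card_conjugate:
  assumes "sorted_wrt (\<ge>) p" "i \<ge> 1"
  shows "part p i = card {c. c \<ge> 1 \<and> i \<le> part (conjugate_partition p) c}"
proof (cases "i \<le> length p")
  case True
  have "{c. c \<ge> 1 \<and> i \<le> part (conjugate_partition p) c} = {1..p ! (i - 1)}"
  proof (rule Set.set_eqI)
    fix c
    have "i \<le> length (filter (\<lambda>x. c \<le> x) p) \<longleftrightarrow> c \<le> p ! (i - 1)"
      using filter_ge_length_iff[OF assms(1), of "i - 1" c] True assms(2) by linarith
    then show "c \<in> {c. c \<ge> 1 \<and> i \<le> part (conjugate_partition p) c} \<longleftrightarrow> c \<in> {1..p ! (i - 1)}"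
      by (auto simp: part_conjugate)
  qed
  then show ?thesis using True assms(2) by (simp add: part_def)
next
  case False
  have "\<not> i \<le> part (conjugate_partition p) c" if "c \<ge> 1" for c
    using False length_filter_le[of "\<lambda>x. c \<le> x" p] part_conjugate[OF that, of p] by linarith
  then have "{c. c \<ge> 1 \<and> i \<le> part (conjugate_partition p) c} = {}" by auto
  then show ?thesis using False by (simp add: part_def)
qed

lemma part_conjugate_eq_card:
  assumes "j \<ge> 1"
  shows "part (conjugate_partition p) j = card {c. c \<ge> 1 \<and> j \<le> part p c}"
proof -
  have "{c. c \<ge> 1 \<and> j \<le> part p c} = Suc ` {k. k < length p \<and> j \<le> p ! k}"
  proof (intro equalityI subsetI)
    fix c assume "c \<in> {c. c \<ge> 1 \<and> j \<le> part p c}"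
    then show "c \<in> Suc ` {k. k < length p \<and> j \<le> p ! k}"
      using assms by (cases c) (auto simp: part_def split: if_splits)
  qed (auto simp: part_def)
  then show ?thesis
    using assms by (simp add: part_conjugate length_filter_conv_card card_image)
qed

lemma words_superlevel:
  assumes "t \<in> words p" "i \<ge> 1"
  shows "{c \<in> set t. i \<le> count_list t c} = {c. c \<ge> 1 \<and> i \<le> part p c}"
proof (intro Collect_cong)
  fix c
  have "count_list t c = part p c" using assms by (simp add: words_iff)
  then show "c \<in> set t \<and> i \<le> count_list t c \<longleftrightarrow> 1 \<le> c \<and> i \<le> part p c"
    using assms(2) count_list_0_iff[of t c] by (cases "c = 0") (auto simp: part_def)
qed

lemma count_list_of_word_sgn_conjugate:
  assumes "s \<in> words (conjugate_partition p)" "sorted_wrt (\<ge>) p"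
    and "word_sgn s y \<noteq> 0" "length y = length s"
  shows "count_list y i = part p i"
proof (cases "i = 0")
  case False
  have "{c \<in> set s. i \<le> count_list s c} = {c. c \<ge> 1 \<and> i \<le> part (conjugate_partition p) c}"
    using assms(1) False by (intro words_superlevel) auto
  then show ?thesis
    using False count_list_of_word_sgn[OF assms(3,4)] part_eq_card_conjugate[OF assms(2), of i] by simp
qed (use count_list_of_word_sgn[OF assms(3,4)] in \<open>simp add: part_def\<close>)

lemma running_count_words:
  assumes "t \<in> words p"
  shows "running_count t \<in> words (conjugate_partition p)"
  unfolding words_iff
proof
  fix i
  show "count_list (running_count t) i = part (conjugate_partition p) i"
  proof (cases "i = 0")
    case True
    then show ?thesis by (simp add: count_list_of_word_sgn[of t] part_def)
  next
    case False
    have "{c \<in> set t. i \<le> count_list t c} = {c. c \<ge> 1 \<and> i \<le> part p c}"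
      using assms False by (intro words_superlevel) auto
    then show ?thesis
      using False by (simp add: count_list_running_count part_conjugate_eq_card)
  qed
qed

section \<open>Interpolation and elementary matrices\<close>

text \<open>Elements are added in increasing order. The function of the new maximum \<open>m\<close>
  vanishes at all smaller points, so its coefficient can be adjusted to fit the value at
  \<open>m\<close> without disturbing the earlier equations.\<close>

lemma unitriangular_interpolation:
  fixes v :: "'x::linorder \<Rightarrow> 'x \<Rightarrow> complex"
  assumes "finite A" "\<And>a. a \<in> A \<Longrightarrow> v a a = 1"
    and "\<And>a b. a \<in> A \<Longrightarrow> b \<in> A \<Longrightarrow> v a b \<noteq> 0 \<Longrightarrow> a \<le> b"
  shows "\<exists>c. \<forall>b\<in>A. (\<Sum>a\<in>A. c a * v a b) = f b"
  using assms
proof (induction A rule: finite_linorder_max_induct)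
  case (insert m A)
  then obtain c where c: "\<forall>b\<in>A. (\<Sum>a\<in>A. c a * v a b) = f b" by (meson insertI2)
  define c' where "c' = c(m := f m - (\<Sum>a\<in>A. c a * v a m))"
  have m: "m \<notin> A" using insert by blast
  have eq: "(\<Sum>a\<in>insert m A. c' a * v a b) = c' m * v m b + (\<Sum>a\<in>A. c a * v a b)" for b
  proof -
    have "(\<Sum>a\<in>A. c' a * v a b) = (\<Sum>a\<in>A. c a * v a b)"
      by (rule sum.cong) (use m in \<open>auto simp: c'_def\<close>)
    then show ?thesis using insert.hyps(1) m by simp
  qed
  have "v m b = 0" if "b \<in> A" for b
    using insert.hyps(2) insert.prems(2)[of m b] that by force
  then have "\<forall>b\<in>insert m A. (\<Sum>a\<in>insert m A. c' a * v a b) = f b"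
    using c by (auto simp: eq insert.prems(1)) (simp add: c'_def)
  then show ?case by blast
qed simp

text \<open>The one-parameter group of matrices I + z E_{i,i+1}, with indices starting at 1 like the
  letters.\<close>

definition elementary :: "nat \<Rightarrow> complex \<Rightarrow> nat \<Rightarrow> nat \<Rightarrow> complex" where
  "elementary i z a b = (if a = b then 1 else if a = i \<and> b = Suc i then z else 0)"

text \<open>By the product rule each position holding \<open>i\<close> contributes the word with
  that letter replaced by \<open>Suc i\<close>, the other positions being evaluated at the identity
  matrix.\<close>

lemma tensor_act_elementary_deriv:
  assumes "1 \<le> i" "i < n" "set y \<subseteq> {1..n}"
  shows "((\<lambda>z. tensor_act {1..n} (elementary i z) w y) has_field_derivative raising i w y) (at 0)"
  using assms(3)
proof (induction y arbitrary: w)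
  case (Cons a y)
  let ?w = "\<lambda>b x. w (b # x)"
  have step: "tensor_act {1..n} (elementary i z) w (a # y) = tensor_act {1..n} (elementary i z) (?w a) y
      + (if a = i then z * tensor_act {1..n} (elementary i z) (?w (Suc i)) y else 0)" for z
  proof -
    have "tensor_act {1..n} (elementary i z) w (a # y)
      = (\<Sum>b\<in>{1..n}. (if b = a then tensor_act {1..n} (elementary i z) (?w a) y else 0)
        + (if b = Suc i then (if a = i then z * tensor_act {1..n} (elementary i z) (?w (Suc i)) y else 0) else 0))"
      unfolding tensor_act.simps by (rule sum.cong) (auto simp: elementary_def)
    also have "\<dots> = tensor_act {1..n} (elementary i z) (?w a) y
      + (if a = i then z * tensor_act {1..n} (elementary i z) (?w (Suc i)) y else 0)"
      using Cons.prems assms by (simp add: sum.distrib)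
    finally show ?thesis .
  qed
  have at0: "tensor_act {1..n} (elementary i 0) f y = f y" for f
  proof -
    have "(\<Prod>a\<leftarrow>y. elementary i 0 a a) = 1" by (induction y) (auto simp: elementary_def)
    then show ?thesis
      using Cons.prems by (subst tensor_act_diagonal) (auto simp: elementary_def)
  qed
  have IH: "((\<lambda>z. tensor_act {1..n} (elementary i z) f y) has_field_derivative raising i f y) (at 0)" for f
    by (rule Cons.IH) (use Cons.prems in auto)
  have "((\<lambda>z. z * tensor_act {1..n} (elementary i z) (?w (Suc i)) y) has_field_derivative w (Suc i # y)) (at 0)"
    using DERIV_mult[OF DERIV_ident IH[of "?w (Suc i)"]] by (simp add: at0 del: One_nat_def)
  then have "((\<lambda>z. if a = i then z * tensor_act {1..n} (elementary i z) (?w (Suc i)) y else 0)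
      has_field_derivative (if a = i then w (Suc i # y) else 0)) (at 0)"
    by auto
  from DERIV_add[OF IH[of "?w a"] this] show ?case by (simp only: step raising.simps)
qed simp

lemma raising_eq_zero_of_invariant:
  assumes "1 \<le> i" "i < n" "set y \<subseteq> {1..n}"
    and "\<And>z. tensor_act {1..n} (elementary i z) w y = w y"
  shows "raising i w y = 0"
  using tensor_act_elementary_deriv[OF assms(1-3), of w] unfolding assms(4)
  by (rule DERIV_unique) simp

section \<open>Functions of lists of columns\<close>

text \<open>A table is given by the list of its columns, so that the factor \<open>GL(n)\<close> number \<open>k\<close> acts
  through \<open>table_row k\<close>.\<close>

definition table_row :: "nat \<Rightarrow> nat list list \<Rightarrow> nat list" where
  "table_row k cs = map (\<lambda>c. c ! k) cs"

definition put_row :: "nat \<Rightarrow> nat list list \<Rightarrow> nat list \<Rightarrow> nat list list" where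
  "put_row k cs x = map2 (\<lambda>c q. c[k := q]) cs x"

lemma table_row_simps [simp]:
  "table_row k [] = []" "table_row k (c # cs) = c ! k # table_row k cs"
  "length (table_row k cs) = length cs"
  by (simp_all add: table_row_def)

lemma put_row_simps [simp]:
  "put_row k [] x = []" "put_row k (c # cs) (q # x) = c[k := q] # put_row k cs x"
  by (simp_all add: put_row_def)

lemma idx_length: "c \<in> idx n d \<Longrightarrow> length c = d"
  by (simp add: idx_def)

lemma idx_nth: "c \<in> idx n d \<Longrightarrow> k < d \<Longrightarrow> c ! k \<in> {1..n}"
  by (rule subsetD[of "set c"]) (auto simp: idx_def)

lemma idx_eq_lists_of: "idx n d = lists_of {1..n} d"
  by (auto simp: idx_def lists_of_def)

lemma finite_idx [simp]: "finite (idx n d)"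
  by (simp add: idx_eq_lists_of finite_lists_of)

lemma idx_list_update: "c \<in> idx n d \<Longrightarrow> q \<in> {1..n} \<Longrightarrow> c[k := q] \<in> idx n d"
  using set_update_subset_insert[of c k q] by (auto simp: idx_def)

lemma set_table_row: "set cs \<subseteq> idx n d \<Longrightarrow> k < d \<Longrightarrow> set (table_row k cs) \<subseteq> {1..n}"
  using idx_nth unfolding table_row_def by fastforce

lemma table_row_put_row_same:
  "length x = length cs \<Longrightarrow> set cs \<subseteq> idx n d \<Longrightarrow> k < d \<Longrightarrow> table_row k (put_row k cs x) = x"
  by (induction x cs rule: list_induct2) (auto simp: idx_length)

lemma table_row_put_row_other:
  "length x = length cs \<Longrightarrow> l \<noteq> k \<Longrightarrow> table_row l (put_row k cs x) = table_row l cs"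
  by (induction x cs rule: list_induct2) auto

lemma put_row_table_row [simp]: "put_row k cs (table_row k cs) = cs"
  by (induction cs) auto

lemma put_row_put_row:
  "length x = length cs \<Longrightarrow> length y = length cs \<Longrightarrow>
     put_row k (put_row k cs x) y = put_row k cs y"
proof (induction x cs arbitrary: y rule: list_induct2)
  case (Cons q x c cs)
  then show ?case by (cases y) auto
qed simp

lemma set_put_row:
  "length x = length cs \<Longrightarrow> set cs \<subseteq> idx n d \<Longrightarrow> set x \<subseteq> {1..n} \<Longrightarrow>
     set (put_row k cs x) \<subseteq> idx n d"
  by (induction x cs rule: list_induct2) (auto simp: idx_list_update)

lemma tensor_act_cong_matrix:
  assumes "\<And>a b. a \<in> I \<Longrightarrow> b \<in> I \<Longrightarrow> u a b = u' a b" "set y \<subseteq> I"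
  shows "tensor_act I u F y = tensor_act I u' F y"
  using assms(2) by (induction y arbitrary: F) (simp_all add: assms(1) cong: sum.cong)

definition entry :: "complex mat \<Rightarrow> nat \<Rightarrow> nat \<Rightarrow> complex" where
  "entry A a b = A $$ (a - 1, b - 1)"

definition in_row :: "nat \<Rightarrow> nat \<Rightarrow> nat \<Rightarrow> complex mat \<Rightarrow> complex mat list" where
  "in_row n d k A = (replicate d (1\<^sub>m n))[k := A]"

lemma act_coeff_in_row:
  assumes "a \<in> idx n d" "b \<in> idx n d" "k < d"
  shows "act_coeff (in_row n d k A) a b
    = (if \<forall>l<d. l \<noteq> k \<longrightarrow> b ! l = a ! l then entry A (a ! k) (b ! k) else 0)"
proof -
  have one: "1\<^sub>m n $$ (a ! l - 1, b ! l - 1) = (if b ! l = a ! l then 1 else (0::complex))"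
    if "l < d" for l
    using idx_nth[OF assms(1) that] idx_nth[OF assms(2) that] by auto
  have "act_coeff (in_row n d k A) a b
      = (\<Prod>l<d. if l = k then entry A (a ! k) (b ! k) else if b ! l = a ! l then 1 else 0)"
    unfolding act_coeff_def in_row_def by (rule prod.cong) (auto simp: one entry_def simp del: One_nat_def)
  also have "\<dots> = entry A (a ! k) (b ! k) * (\<Prod>l\<in>{..<d} - {k}. if b ! l = a ! l then 1 else 0)"
    using assms(3) by (subst prod.remove[of _ k]) (auto intro!: prod.cong)
  also have "(\<Prod>l\<in>{..<d} - {k}. if b ! l = a ! l then 1 else (0::complex))
      = (if \<forall>l<d. l \<noteq> k \<longrightarrow> b ! l = a ! l then 1 else 0)"
    by (auto intro!: prod.neutral)
  finally show ?thesis by (simp only: if_distrib mult_1_right mult_zero_right)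
qed

text \<open>Identity matrices in the other factors force the summed columns to agree with
  \<open>cs\<close> off row \<open>k\<close>, so only the sum over the entries of row
  \<open>k\<close> remains.\<close>

lemma tensor_act_in_row:
  assumes "set cs \<subseteq> idx n d" "k < d"
  shows "tensor_act (idx n d) (act_coeff (in_row n d k A)) F cs
    = tensor_act {1..n} (entry A) (\<lambda>x. F (put_row k cs x)) (table_row k cs)"
  using assms(1)
proof (induction cs arbitrary: F)
  case (Cons a cs)
  let ?P = "\<lambda>b. \<forall>l<d. l \<noteq> k \<longrightarrow> b ! l = a ! l"
  let ?G = "\<lambda>b. tensor_act (idx n d) (act_coeff (in_row n d k A)) (\<lambda>x. F (b # x)) cs"
  have a: "a \<in> idx n d" using Cons.prems by simp
  have bij: "bij_betw (\<lambda>q. a[k := q]) {1..n} {b \<in> idx n d. ?P b}"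
  proof (rule bij_betw_byWitness[where f' = "\<lambda>b. b ! k"])
    show "\<forall>b\<in>{b \<in> idx n d. ?P b}. a[k := b ! k] = b"
    proof
      fix b assume b: "b \<in> {b \<in> idx n d. ?P b}"
      show "a[k := b ! k] = b"
      proof (rule nth_equalityI)
        fix l assume "l < length (a[k := b ! k])"
        then show "a[k := b ! k] ! l = b ! l"
          using a b by (cases "l = k") (auto simp: idx_length)
      qed (use a b in \<open>auto simp: idx_length\<close>)
    qed
    show "(\<lambda>q. a[k := q]) ` {1..n} \<subseteq> {b \<in> idx n d. ?P b}" using a idx_list_update by auto
    show "(\<lambda>b. b ! k) ` {b \<in> idx n d. ?P b} \<subseteq> {1..n}" using idx_nth assms(2) by blast
  qed (use a assms(2) in \<open>auto simp: idx_length\<close>)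
  have "tensor_act (idx n d) (act_coeff (in_row n d k A)) F (a # cs)
      = (\<Sum>b\<in>idx n d. if ?P b then entry A (a ! k) (b ! k) * ?G b else 0)"
    unfolding tensor_act.simps
    by (rule sum.cong) (use a assms(2) in \<open>auto simp: act_coeff_in_row\<close>)
  also have "\<dots> = (\<Sum>b\<in>{b \<in> idx n d. ?P b}. entry A (a ! k) (b ! k) * ?G b)"
    by (simp add: sum.inter_filter)
  also have "\<dots> = (\<Sum>q\<in>{1..n}. entry A (a ! k) (a[k := q] ! k) * ?G (a[k := q]))"
    by (rule sum.reindex_bij_betw[OF bij, symmetric])
  also have "\<dots> = (\<Sum>q\<in>{1..n}. entry A (a ! k) q *
      tensor_act {1..n} (entry A) (\<lambda>x. F (a[k := q] # put_row k cs x)) (table_row k cs))"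
    using Cons a assms(2) by (simp add: idx_length)
  finally show ?case by simp
qed simp

lemma sum_idx_prod:
  fixes h :: "nat \<Rightarrow> nat \<Rightarrow> complex"
  shows "(\<Sum>b\<in>idx n d. \<Prod>k<d. h k (b ! k)) = (\<Prod>k<d. \<Sum>q\<in>{1..n}. h k q)"
  unfolding idx_eq_lists_of
proof (induction d arbitrary: h)
  case (Suc d)
  have "(\<Sum>b\<in>lists_of {1..n} (Suc d). \<Prod>k<Suc d. h k (b ! k))
      = (\<Sum>q\<in>{1..n}. h 0 q * (\<Sum>x\<in>lists_of {1..n} d. \<Prod>k<d. h (Suc k) (x ! k)))"
    by (simp add: sum_lists_of_Suc prod.lessThan_Suc_shift sum_distrib_left del: prod.lessThan_Suc)
  also have "\<dots> = (\<Prod>k<Suc d. \<Sum>q\<in>{1..n}. h k q)"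
    by (simp add: Suc[of "\<lambda>k. h (Suc k)"] prod.lessThan_Suc_shift sum_distrib_right del: prod.lessThan_Suc One_nat_def)
  finally show ?case .
qed simp

text \<open>A product of functions of separate rows is a pure tensor for the \<open>d\<close>
  factors of the group, and \<open>sum_idx_prod\<close> splits the sum over each column
  accordingly.\<close>

lemma tensor_act_rows:
  assumes "length g = d"
  shows "tensor_act (idx n d) (act_coeff g) (\<lambda>cs. \<Prod>k<d. f k (table_row k cs)) cs
    = (\<Prod>k<d. tensor_act {1..n} (entry (g ! k)) (f k) (table_row k cs))"
proof (induction cs arbitrary: f)
  case (Cons a cs)
  have coeff: "act_coeff g a b = (\<Prod>k<d. entry (g ! k) (a ! k) (b ! k))" for b
    by (simp add: act_coeff_def assms entry_def)
  have "tensor_act (idx n d) (act_coeff g) (\<lambda>cs. \<Prod>k<d. f k (table_row k cs)) (a # cs)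
      = (\<Sum>b\<in>idx n d. (\<Prod>k<d. entry (g ! k) (a ! k) (b ! k))
        * (\<Prod>k<d. tensor_act {1..n} (entry (g ! k)) (\<lambda>x. f k (b ! k # x)) (table_row k cs)))"
    using Cons[of "\<lambda>k x. f k (b ! k # x)" for b] by (simp add: coeff)
  also have "\<dots> = (\<Sum>b\<in>idx n d. \<Prod>k<d. (\<lambda>k q. entry (g ! k) (a ! k) q
        * tensor_act {1..n} (entry (g ! k)) (\<lambda>x. f k (q # x)) (table_row k cs)) k (b ! k))"
    by (simp add: prod.distrib)
  also have "\<dots> = (\<Prod>k<d. \<Sum>q\<in>{1..n}. entry (g ! k) (a ! k) q
        * tensor_act {1..n} (entry (g ! k)) (\<lambda>x. f k (q # x)) (table_row k cs))"
    by (rule sum_idx_prod)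
  finally show ?case by simp
qed simp

section \<open>Highest weight functions\<close>

definition hw_fun :: "nat \<Rightarrow> nat list list \<Rightarrow> (nat list list \<Rightarrow> complex) \<Rightarrow> bool" where
  "hw_fun n lam F \<longleftrightarrow> (\<forall>cs. set cs \<subseteq> idx n (length lam) \<longrightarrow>
     (\<forall>t\<in>torus n (length lam). tensor_act (idx n (length lam)) (act_coeff t) F cs = weight lam t * F cs) \<and>
     (\<forall>u\<in>unipotent n (length lam). tensor_act (idx n (length lam)) (act_coeff u) F cs = F cs))"

lemma hw_fun_diff_sum:
  assumes "hw_fun n lam F" "\<And>a. a \<in> A \<Longrightarrow> hw_fun n lam (G a)"
  shows "hw_fun n lam (\<lambda>cs. F cs - (\<Sum>a\<in>A. c a * G a cs))"
  using assms unfolding hw_fun_def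
  by (simp add: tensor_act_diff tensor_act_sum tensor_act_cmult sum_distrib_left right_diff_distrib
      mult.left_commute)

lemma invertible_upper_triangular:
  fixes A :: "complex mat"
  assumes "A \<in> carrier_mat n n" "upper_triangular A" "\<And>i. i < n \<Longrightarrow> A $$ (i, i) \<noteq> 0"
  shows "invertible_mat A"
proof -
  have "det A \<noteq> 0"
    using assms by (auto simp: det_upper_triangular diag_mat_def prod_list_zero_iff)
  from det_non_zero_imp_unit[OF assms(1) this, of "()"]
  obtain B where "B \<in> carrier_mat n n" "B * A = 1\<^sub>m n" "A * B = 1\<^sub>m n"
    by (auto simp: Units_def ring_mat_def)
  then show ?thesis
    using assms(1) unfolding invertible_mat_def inverts_mat_def by auto
qed

lemma in_row_GL:
  assumes "A \<in> carrier_mat n n" "upper_triangular A" "\<And>i. i < n \<Longrightarrow> A $$ (i, i) \<noteq> 0"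
  shows "in_row n d k A \<in> GL n d"
proof -
  have "set (in_row n d k A) \<subseteq> insert A {1\<^sub>m n}"
    unfolding in_row_def using set_update_subset_insert[of "replicate d (1\<^sub>m n)" k A]
    by (auto split: if_splits)
  moreover have "invertible_mat (1\<^sub>m n :: complex mat)"
    by (rule invertible_upper_triangular) (auto simp: upper_triangular_def)
  ultimately show ?thesis
    using assms(1) invertible_upper_triangular[OF assms] by (auto simp: GL_def in_row_def)
qed

lemma in_row_unipotent:
  assumes "A \<in> carrier_mat n n" "upper_triangular A" "\<And>i. i < n \<Longrightarrow> A $$ (i, i) = 1"
  shows "in_row n d k A \<in> unipotent n d"
proof -
  have "set (in_row n d k A) \<subseteq> insert A {1\<^sub>m n}"
    unfolding in_row_def using set_update_subset_insert[of "replicate d (1\<^sub>m n)" k A]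
    by (auto split: if_splits)
  then show ?thesis
    using in_row_GL[of A n d k] assms by (auto simp: unipotent_def upper_triangular_def)
qed

lemma in_row_torus:
  assumes "A \<in> carrier_mat n n" "diagonal_mat A" "\<And>i. i < n \<Longrightarrow> A $$ (i, i) \<noteq> 0"
  shows "in_row n d k A \<in> torus n d"
proof -
  have "set (in_row n d k A) \<subseteq> insert A {1\<^sub>m n}"
    unfolding in_row_def using set_update_subset_insert[of "replicate d (1\<^sub>m n)" k A]
    by (auto split: if_splits)
  moreover have "upper_triangular A" using assms by (auto simp: upper_triangular_def diagonal_mat_def)
  ultimately show ?thesis
    using in_row_GL[of A n d k] assms by (auto simp: torus_def diagonal_mat_def)
qed

lemma prod_list_eq_prod_count:
  fixes h :: "'b \<Rightarrow> 'c::comm_monoid_mult"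
  assumes "set x \<subseteq> C" "finite C"
  shows "(\<Prod>a\<leftarrow>x. h a) = (\<Prod>i\<in>C. h i ^ count_list x i)"
  using assms(1)
proof (induction x)
  case (Cons a x)
  have "(\<Prod>i\<in>C. h i ^ count_list (a # x) i) = (\<Prod>i\<in>C. (if i = a then h a else 1) * h i ^ count_list x i)"
    by (rule prod.cong) auto
  also have "\<dots> = h a * (\<Prod>i\<in>C. h i ^ count_list x i)"
    using Cons assms(2) by (simp add: prod.distrib)
  finally show ?case using Cons by simp
qed simp

lemma hw_fun_content:
  assumes hw: "hw_fun n lam F" and len: "\<And>p. p \<in> set lam \<Longrightarrow> length p \<le> n"
    and cs: "set cs \<subseteq> idx n (length lam)" and nz: "F cs \<noteq> 0" and k: "k < length lam"
  shows "count_list (table_row k cs) i = part (lam ! k) i"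
proof (cases "i \<in> {1..n}")
  case False
  then have "i \<notin> set (table_row k cs)" using set_table_row[OF cs k] by blast
  moreover have "part (lam ! k) i = 0"
    using False len[of "lam ! k"] k by (auto simp: part_def)
  ultimately show ?thesis by (simp add: count_list_0_iff)
next
  case True
  let ?d = "length lam" and ?x = "table_row k cs"
  \<comment> \<open>The entry 2 at place \<open>i\<close> turns the eigenvalue into a power of 2
    whose exponent counts the letters \<open>i\<close>. Distinct exponents give distinct powers, so
    the count can be read off.\<close>
  define A :: "complex mat" where "A = mat n n (\<lambda>(r, c). if r = c then if r = i - 1 then 2 else 1 else 0)"
  have entry: "entry A a b = (if a = b then if a = i then 2 else 1 else 0)"
    if "a \<in> {1..n}" "b \<in> {1..n}" for a b
    using that True by (auto simp: entry_def A_def)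
  have torus: "in_row n ?d k A \<in> torus n ?d"
    by (rule in_row_torus) (auto simp: A_def diagonal_mat_def)
  have x: "set ?x \<subseteq> {1..n}" by (rule set_table_row[OF cs k])
  have "weight lam (in_row n ?d k A) * F cs = tensor_act (idx n ?d) (act_coeff (in_row n ?d k A)) F cs"
    using hw torus cs by (simp add: hw_fun_def)
  also have "\<dots> = (\<Prod>a\<leftarrow>?x. entry A a a) * F cs"
  proof -
    have "tensor_act {1..n} (entry A) (\<lambda>x. F (put_row k cs x)) ?x
        = (\<Prod>a\<leftarrow>?x. entry A a a) * F (put_row k cs ?x)"
      by (rule tensor_act_diagonal) (use x entry in auto)
    then show ?thesis by (simp add: tensor_act_in_row[OF cs k] del: One_nat_def)
  qed
  also have "(\<Prod>a\<leftarrow>?x. entry A a a) = (\<Prod>a\<leftarrow>?x. if a = i then 2 else 1)"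
    using x by (intro arg_cong[of _ _ prod_list] map_cong refl) (auto simp: entry)
  also have "\<dots> = (\<Prod>a\<in>{1..n}. if a = i then 2 ^ count_list ?x i else 1)"
    unfolding prod_list_eq_prod_count[OF x finite_atLeastAtMost] by (rule prod.cong) auto
  also have "\<dots> = 2 ^ count_list ?x i" using True by simp
  finally have "weight lam (in_row n ?d k A) = 2 ^ count_list ?x i" using nz by simp
  moreover have "weight lam (in_row n ?d k A) = 2 ^ part (lam ! k) i"
  proof -
    have "(\<Prod>j<length (lam ! l). (in_row n ?d k A ! l) $$ (j, j) ^ (lam ! l ! j))
        = (if l = k then 2 ^ part (lam ! k) i else 1)" if l: "l < ?d" for l
    proof -
      have le: "length (lam ! l) \<le> n" using len l by simp
      show ?thesis
      proof (cases "l = k")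
        case False
        then show ?thesis using l le by (auto simp: in_row_def intro!: prod.neutral)
      next
        case lk: True
        have "(\<Prod>j<length (lam ! k). A $$ (j, j) ^ (lam ! k ! j))
            = (\<Prod>j<length (lam ! k). if j = i - 1 then 2 ^ (lam ! k ! (i - 1)) else 1)"
          using le lk by (intro prod.cong) (auto simp: A_def)
        also have "\<dots> = 2 ^ part (lam ! k) i"
          using True by (auto simp: part_def)
        finally show ?thesis using lk k by (simp add: in_row_def)
      qed
    qed
    then have "weight lam (in_row n ?d k A) = (\<Prod>l<?d. if l = k then 2 ^ part (lam ! k) i else 1)"
      unfolding weight_def by (intro prod.cong) auto
    then show ?thesis using k by simp
  qed
  ultimately have "(2::complex) ^ count_list ?x i = 2 ^ part (lam ! k) i" by simp
  then have "cmod (2 ^ count_list ?x i) = cmod (2 ^ part (lam ! k) i)" by (rule arg_cong)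
  then show ?thesis by (simp add: norm_power)
qed

lemma hw_fun_raising:
  assumes hw: "hw_fun n lam F" and cs: "set cs \<subseteq> idx n (length lam)" and k: "k < length lam"
    and i: "1 \<le> i" "i < n" and y: "set y \<subseteq> {1..n}" "length y = length cs"
  shows "raising i (\<lambda>x. F (put_row k cs x)) y = 0"
proof (rule raising_eq_zero_of_invariant[OF i y(1)])
  fix z
  let ?d = "length lam" and ?cs = "put_row k cs y"
  define A where "A = mat n n (\<lambda>(r, c). elementary i z (Suc r) (Suc c))"
  have unip: "in_row n ?d k A \<in> unipotent n ?d"
    by (rule in_row_unipotent) (auto simp: A_def elementary_def upper_triangular_def)
  have cs': "set ?cs \<subseteq> idx n ?d" using set_put_row[OF y(2) cs y(1)] .
  have "tensor_act {1..n} (elementary i z) (\<lambda>x. F (put_row k cs x)) y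
      = tensor_act {1..n} (entry A) (\<lambda>x. F (put_row k cs x)) y"
    by (rule tensor_act_cong_matrix) (use y in \<open>auto simp: A_def entry_def\<close>)
  \<comment> \<open>Rebasing at \<open>?cs\<close>, whose row \<open>k\<close> is \<open>y\<close>,
    gives the shape required by \<open>tensor_act_in_row\<close>.\<close>
  also have "\<dots> = tensor_act {1..n} (entry A) (\<lambda>x. F (put_row k ?cs x)) y"
    by (rule tensor_act_cong) (use y in \<open>auto simp: lists_of_def put_row_put_row\<close>)
  also have "\<dots> = tensor_act (idx n ?d) (act_coeff (in_row n ?d k A)) F ?cs"
    by (simp add: tensor_act_in_row[OF cs' k] table_row_put_row_same[OF y(2) cs k])
  also have "\<dots> = F ?cs" using hw unip cs' by (simp add: hw_fun_def)
  finally show "tensor_act {1..n} (elementary i z) (\<lambda>x. F (put_row k cs x)) y = F (put_row k cs y)" .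
qed

text \<open>The lattice condition is dropped one row at a time: each factor of the group acts on its
  own row, so with the other rows fixed \<open>highest_weight_eq_zero\<close> applies to row
  \<open>j\<close>.\<close>

lemma hw_fun_eq_zero:
  assumes hw: "hw_fun n lam F" and len: "\<And>p. p \<in> set lam \<Longrightarrow> length p \<le> n"
    and lattice: "\<And>cs. set cs \<subseteq> idx n (length lam) \<Longrightarrow>
      (\<forall>k<length lam. lattice_word (table_row k cs)) \<Longrightarrow> F cs = 0"
    and cs: "set cs \<subseteq> idx n (length lam)"
  shows "F cs = 0"
proof -
  have "\<forall>cs. set cs \<subseteq> idx n (length lam) \<longrightarrow>
      (\<forall>k. j \<le> k \<longrightarrow> k < length lam \<longrightarrow> lattice_word (table_row k cs)) \<longrightarrow> F cs = 0"
    if "j \<le> length lam" for j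
    using that
  proof (induction j)
    case 0
    then show ?case using lattice by blast
  next
    case (Suc j)
    show ?case
    proof (intro allI impI)
      fix cs
      assume cs: "set cs \<subseteq> idx n (length lam)"
        and rows: "\<forall>k. Suc j \<le> k \<longrightarrow> k < length lam \<longrightarrow> lattice_word (table_row k cs)"
      have j: "j < length lam" using Suc.prems by simp
      let ?good = "\<lambda>x. length x = length cs \<and> set x \<subseteq> {1..n}"
      \<comment> \<open>The cut-off supplies the support condition and makes
        \<open>raising i w\<close> vanish also for \<open>i \<ge> n\<close>, where no elementary
        matrix is available.\<close>
      define w where "w x = (if ?good x then F (put_row j cs x) else 0)" for x
      have put: "set (put_row j cs x) \<subseteq> idx n (length lam)" "table_row j (put_row j cs x) = x"
        if "?good x" for x
        using that set_put_row table_row_put_row_same cs j by blast+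
      have "w (table_row j cs) = 0"
      proof (rule highest_weight_eq_zero[where w = w and l = "length cs" and n = n
            and \<mu> = "part (lam ! j)"])
        fix y assume "w y \<noteq> 0"
        then have y: "?good y" "F (put_row j cs y) \<noteq> 0" by (auto simp: w_def split: if_splits)
        have "count_list y i = part (lam ! j) i" for i
          using hw_fun_content[OF hw len put(1)[OF y(1)] y(2) j] put(2)[OF y(1)] by simp
        then show "length y = length cs \<and> set y \<subseteq> {1..n} \<and> (\<forall>i. count_list y i = part (lam ! j) i)"
          using y by simp
      next
        fix i :: nat and y assume i: "1 \<le> i"
        show "raising i w y = 0"
        proof (rule ccontr)
          assume nz: "raising i w y \<noteq> 0"
          from raising_nonzeroD[OF nz] obtain x where x: "w x \<noteq> 0" "length x = length y"
            "Suc i \<in> set x" "set y \<subseteq> insert i (set x)" by blast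
          then have gx: "?good x" by (auto simp: w_def split: if_splits)
          then have in': "i < n" using x(3) by auto
          have gy: "?good y" using gx x(2,4) i in' by auto
          have "raising i w y = raising i (\<lambda>x. F (put_row j cs x)) y"
          proof (rule raising_cong_letters)
            fix x assume "length x = length y" "set x \<subseteq> insert (Suc i) (set y)"
            then have "?good x" using gy in' by auto
            then show "w x = F (put_row j cs x)" by (simp add: w_def)
          qed
          also have "\<dots> = 0" using hw_fun_raising[OF hw cs j i in'] gy by blast
          finally show False using nz by contradiction
        qed
      next
        fix y assume y: "lattice_word y"
        show "w y = 0"
        proof (cases "?good y")
          case True
          have "lattice_word (table_row k (put_row j cs y))" if "j \<le> k" "k < length lam" for k
            using that y rows put(2)[OF True] table_row_put_row_other[of y cs k j] True
            by (cases "k = j") auto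
          then have "F (put_row j cs y) = 0" using Suc.IH Suc.prems put(1)[OF True] by simp
          then show ?thesis by (simp add: w_def)
        next
          case False
          then show ?thesis by (simp only: w_def if_False)
        qed
      qed
      then show "F cs = 0" using set_table_row[OF cs j] by (simp add: w_def)
    qed
  qed
  from this[of "length lam"] cs show ?thesis by simp
qed

section \<open>The functions of tables\<close>

text \<open>Counts the cells of a Young diagram by columns instead of rows.\<close>

lemma sum_length_filter_ge:
  "\<forall>x\<in>set p. x \<le> M \<Longrightarrow> (\<Sum>j\<in>{1..M}. length (filter (\<lambda>x. j \<le> x) p)) = sum_list p"
proof (induction p)
  case (Cons x p)
  have "(\<Sum>j\<in>{1..M}. length (filter (\<lambda>y. j \<le> y) (x # p)))
      = (\<Sum>j\<in>{1..M}. (if j \<le> x then 1 else 0) + length (filter (\<lambda>y. j \<le> y) p))"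
    by (rule sum.cong) auto
  also have "\<dots> = card {j \<in> {1..M}. j \<le> x} + sum_list p"
    using Cons by (simp add: sum.distrib flip: sum.inter_filter)
  also have "{j \<in> {1..M}. j \<le> x} = {1..x}" using Cons.prems by auto
  finally show ?case by simp
qed simp

lemma sum_list_conjugate_partition: "sum_list (conjugate_partition p) = sum_list p"
proof -
  have "sum_list (conjugate_partition p)
      = (\<Sum>j\<in>{1..Max (insert 0 (set p))}. length (filter (\<lambda>x. j \<le> x) p))"
    unfolding conjugate_partition_def
    by (subst sum_list_distinct_conv_sum_set)
      (simp_all add: atLeastLessThanSuc_atLeastAtMost del: upt_Suc)
  also have "\<dots> = sum_list p" by (rule sum_length_filter_ge) auto
  finally show ?thesis .
qed

text \<open>The guard on the length is needed because \<^const>\<open>word_sgn\<close> takes junk values on words of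
  different lengths.\<close>

definition table_fun :: "nat \<Rightarrow> nat list list \<Rightarrow> nat list list \<Rightarrow> complex" where
  "table_fun m T cs =
     (if length cs = m then of_int (\<Prod>k<length T. word_sgn (T ! k) (table_row k cs)) else 0)"

lemma tensor_act_table_fun:
  assumes g: "g \<in> GL n (length T)" "\<forall>h\<in>set g. upper_triangular h"
    and T: "\<forall>t\<in>set T. length t = m" and cs: "set cs \<subseteq> idx n (length T)"
  shows "tensor_act (idx n (length T)) (act_coeff g) (table_fun m T) cs
    = (\<Prod>k<length T. \<Prod>a\<leftarrow>table_row k cs. entry (g ! k) a a) * table_fun m T cs"
proof (cases "length cs = m")
  case False
  then show ?thesis by (simp add: tensor_act_eq_sum lists_of_def table_fun_def)
next
  case True
  let ?d = "length T"
  have "tensor_act (idx n ?d) (act_coeff g) (table_fun m T) cs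
      = tensor_act (idx n ?d) (act_coeff g) (\<lambda>cs. \<Prod>k<?d. of_int (word_sgn (T ! k) (table_row k cs))) cs"
    by (rule tensor_act_cong) (simp add: lists_of_def table_fun_def True)
  also have "\<dots> = (\<Prod>k<?d. tensor_act {1..n} (entry (g ! k)) (\<lambda>x. of_int (word_sgn (T ! k) x)) (table_row k cs))"
    by (rule tensor_act_rows[where f = "\<lambda>k x. of_int (word_sgn (T ! k) x)"]) (use g in \<open>simp add: GL_def\<close>)
  also have "\<dots> = (\<Prod>k<?d. (\<Prod>a\<leftarrow>table_row k cs. entry (g ! k) a a) * of_int (word_sgn (T ! k) (table_row k cs)))"
  proof (rule prod.cong[OF refl])
    fix k assume k: "k \<in> {..<?d}"
    then have "g ! k \<in> set g" using g by (simp add: GL_def)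
    then have gk: "g ! k \<in> carrier_mat n n" "upper_triangular (g ! k)" using g by (auto simp: GL_def)
    show "tensor_act {1..n} (entry (g ! k)) (\<lambda>x. of_int (word_sgn (T ! k) x)) (table_row k cs)
        = (\<Prod>a\<leftarrow>table_row k cs. entry (g ! k) a a) * of_int (word_sgn (T ! k) (table_row k cs))"
    proof (rule tensor_act_word_sgn)
      fix a b assume "a \<in> {1..n}" "b \<in> {1..n}" "b < a"
      then show "entry (g ! k) a b = 0"
        using gk by (auto simp: entry_def intro!: upper_triangularD)
    next
      show "set (table_row k cs) \<subseteq> {1..n}" using set_table_row[OF cs] k by simp
      show "length (T ! k) = length (table_row k cs)" using T True k by simp
    qed
  qed
  finally show ?thesis using True by (simp add: table_fun_def prod.distrib)
qed

lemma prod_list_eq_part: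
  fixes h :: "nat \<Rightarrow> complex"
  assumes "\<And>i. count_list x i = part p i"
  shows "(\<Prod>a\<leftarrow>x. h a) = (\<Prod>j<length p. h (Suc j) ^ (p ! j))"
proof -
  have "i \<in> {1..length p}" if "i \<in> set x" for i
    using that assms[of i] count_list_0_iff[of x i] by (auto simp: part_def split: if_splits)
  then have "(\<Prod>a\<leftarrow>x. h a) = (\<Prod>i\<in>{1..length p}. h i ^ count_list x i)"
    by (intro prod_list_eq_prod_count) auto
  also have "\<dots> = (\<Prod>j<length p. h (Suc j) ^ (p ! j))"
    by (rule prod.reindex_bij_witness[of _ Suc "\<lambda>i. i - 1"]) (auto simp: assms part_def)
  finally show ?thesis .
qed

lemma tables_A_conjugate_rows:
  assumes "T \<in> tables_A (map conjugate_partition lam)" "\<forall>p\<in>set lam. sum_list p = m"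
  shows "length T = length lam" "\<forall>t\<in>set T. length t = m"
    "k < length lam \<Longrightarrow> T ! k \<in> words (conjugate_partition (lam ! k))"
proof -
  show len: "length T = length lam" and
    rows: "\<And>k. k < length lam \<Longrightarrow> T ! k \<in> words (conjugate_partition (lam ! k))"
    using assms(1) by (auto simp: tables_A_def)
  show "\<forall>t\<in>set T. length t = m"
  proof
    fix t assume "t \<in> set T"
    then obtain k where "k < length lam" "t = T ! k" using len by (auto simp: in_set_conv_nth)
    then show "length t = m"
      using rows[of k] assms(2) by (auto simp: words_def sum_list_conjugate_partition)
  qed
qed

text \<open>Upper triangular matrices multiply the function by their diagonal entries read along the
  rows. For the torus this is the weight, since every table in the support has row contents
  \<open>lam\<close>; for unipotent matrices it is 1.\<close>

lemma hw_fun_table_fun: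
  assumes T: "T \<in> tables_A (map conjugate_partition lam)"
    and lam: "\<forall>p\<in>set lam. is_partition m p"
  shows "hw_fun n lam (table_fun m T)"
proof -
  have sums: "\<forall>p\<in>set lam. sum_list p = m" using lam by (simp add: is_partition_def)
  note rows = tables_A_conjugate_rows[OF T sums]
  let ?d = "length lam"
  note act = tensor_act_table_fun[where T = T and m = m and n = n, OF _ _ rows(2), unfolded rows(1)]
  have "tensor_act (idx n ?d) (act_coeff t) (table_fun m T) cs = weight lam t * table_fun m T cs"
    if t: "t \<in> torus n ?d" and cs: "set cs \<subseteq> idx n ?d" for t cs
  proof -
    have GL: "t \<in> GL n ?d" and "\<forall>h\<in>set t. diagonal_mat h" using t by (auto simp: torus_def)
    then have "\<forall>h\<in>set t. upper_triangular h"
      by (auto simp: GL_def diagonal_mat_def upper_triangular_def)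
    then have "tensor_act (idx n ?d) (act_coeff t) (table_fun m T) cs
        = (\<Prod>k<?d. \<Prod>a\<leftarrow>table_row k cs. entry (t ! k) a a) * table_fun m T cs"
      using act[OF GL] cs by blast
    also have "\<dots> = weight lam t * table_fun m T cs"
    proof (cases "table_fun m T cs = 0")
      case False
      then have m: "length cs = m"
        and nz: "k < ?d \<Longrightarrow> word_sgn (T ! k) (table_row k cs) \<noteq> 0" for k
        by (auto simp: table_fun_def rows(1) split: if_splits)
      have "(\<Prod>a\<leftarrow>table_row k cs. entry (t ! k) a a)
          = (\<Prod>j<length (lam ! k). entry (t ! k) (Suc j) (Suc j) ^ (lam ! k ! j))" if k: "k < ?d" for k
      proof (rule prod_list_eq_part)
        fix i
        show "count_list (table_row k cs) i = part (lam ! k) i"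
        proof (rule count_list_of_word_sgn_conjugate[OF rows(3)[OF k] _ nz[OF k]])
          show "sorted_wrt (\<ge>) (lam ! k)" using lam k by (auto simp: is_partition_def)
          show "length (table_row k cs) = length (T ! k)" using rows(1,2) k m by simp
        qed
      qed
      then show ?thesis by (simp add: weight_def entry_def)
    qed simp
    finally show ?thesis .
  qed
  moreover have "tensor_act (idx n ?d) (act_coeff u) (table_fun m T) cs = table_fun m T cs"
    if u: "u \<in> unipotent n ?d" and cs: "set cs \<subseteq> idx n ?d" for u cs
  proof -
    have GL: "u \<in> GL n ?d" and ut: "\<forall>h\<in>set u. upper_triangular h" using u by (auto simp: unipotent_def)
    have "(\<Prod>a\<leftarrow>table_row k cs. entry (u ! k) a a) = 1" if k: "k < ?d" for k
    proof -
      have "u ! k \<in> set u" using GL k by (simp add: GL_def)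
      then have "entry (u ! k) a a = 1" if "a \<in> {1..n}" for a
        using u that by (auto simp: unipotent_def entry_def)
      then have "map (\<lambda>a. entry (u ! k) a a) (table_row k cs) = map (\<lambda>a. 1) (table_row k cs)"
        using set_table_row[OF cs k] by (intro map_cong) auto
      then show ?thesis by (simp add: map_replicate_const prod_list_replicate)
    qed
    then show ?thesis using act[OF GL ut] cs by simp
  qed
  ultimately show ?thesis by (simp add: hw_fun_def)
qed

section \<open>Row and column descriptions of a table\<close>

definition columns_of :: "nat \<Rightarrow> nat \<Rightarrow> nat list list \<Rightarrow> nat list list" where
  "columns_of d m Y = map (\<lambda>j. map (\<lambda>k. Y ! k ! j) [0..<d]) [0..<m]"

definition rows_of :: "nat \<Rightarrow> nat list list \<Rightarrow> nat list list" where
  "rows_of d cs = map (\<lambda>k. table_row k cs) [0..<d]"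

lemma length_columns_of [simp]: "length (columns_of d m Y) = m"
  by (simp add: columns_of_def)

lemma table_row_columns_of: "length (Y ! k) = m \<Longrightarrow> k < d \<Longrightarrow> table_row k (columns_of d m Y) = Y ! k"
  by (auto simp: table_row_def columns_of_def intro!: nth_equalityI)

lemma columns_of_rows_of:
  "set cs \<subseteq> idx n d \<Longrightarrow> columns_of d (length cs) (rows_of d cs) = cs"
  unfolding columns_of_def rows_of_def
  by (intro nth_equalityI) (auto simp: table_row_def subset_iff dest!: nth_mem idx_length)

lemma rows_of_columns_of:
  "length Y = d \<Longrightarrow> \<forall>y\<in>set Y. length y = m \<Longrightarrow> rows_of d (columns_of d m Y) = Y"
  by (intro nth_equalityI) (auto simp: rows_of_def table_row_columns_of)

text \<open>The bound \<open>d \<ge> 1\<close> matters: on a table without rows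
  \<open>List.transpose\<close> returns no columns, while \<open>columns_of\<close> returns
  \<open>m\<close> empty ones.\<close>

lemma transpose_eq_columns_of:
  assumes "length Y = d" "d \<ge> 1" "\<forall>y\<in>set Y. length y = m"
  shows "List.transpose Y = columns_of d m Y"
proof -
  have "List.transpose Y = map (\<lambda>i. map (\<lambda>j. Y ! j ! i) [0..<length Y]) [0..<m]"
  proof (rule transpose_rectangle)
    show "Y = [] \<Longrightarrow> m = 0" using assms by auto
  qed (use assms in auto)
  then show ?thesis by (simp add: columns_of_def assms)
qed

lemma columns_of_bij: "bij_betw (columns_of d m) (tables n d m) (lists_of (idx n d) m)"
proof (rule bij_betw_byWitness[where f' = "rows_of d"])
  show "\<forall>Y\<in>tables n d m. rows_of d (columns_of d m Y) = Y"
    by (simp add: tables_def rows_of_columns_of)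
  show "\<forall>cs\<in>lists_of (idx n d) m. columns_of d m (rows_of d cs) = cs"
    using columns_of_rows_of by (auto simp: lists_of_def)
  show "columns_of d m ` tables n d m \<subseteq> lists_of (idx n d) m"
  proof
    fix cs assume "cs \<in> columns_of d m ` tables n d m"
    then obtain Y where Y: "Y \<in> tables n d m" "cs = columns_of d m Y" by blast
    have "Y ! k ! j \<in> {1..n}" if "k < d" "j < m" for k j
      by (rule subsetD[of "set (Y ! k)"]) (use Y(1) that in \<open>auto simp: tables_def\<close>)
    then show "cs \<in> lists_of (idx n d) m"
      by (auto simp: Y(2) lists_of_def columns_of_def idx_def)
  qed
  show "rows_of d ` lists_of (idx n d) m \<subseteq> tables n d m"
  proof
    fix Y assume "Y \<in> rows_of d ` lists_of (idx n d) m"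
    then obtain cs where cs: "set cs \<subseteq> idx n d" "length cs = m" "Y = rows_of d cs"
      by (auto simp: lists_of_def)
    show "Y \<in> tables n d m"
      using set_table_row[OF cs(1)] cs(2) by (auto simp: cs(3) tables_def rows_of_def)
  qed
qed

lemma finite_words: "finite (words \<alpha>)"
  by (rule finite_subset[OF _ finite_lists_length_eq[of "{1..length \<alpha>}" "sum_list \<alpha>"]])
    (auto simp: words_def)

lemma finite_tables_A: "finite (tables_A \<alpha>s)"
proof (rule finite_subset)
  show "tables_A \<alpha>s \<subseteq> {T. set T \<subseteq> (\<Union>\<alpha>\<in>set \<alpha>s. words \<alpha>) \<and> length T = length \<alpha>s}"
    by (auto simp: tables_A_def in_set_conv_nth) (metis nth_mem)
  show "finite {T. set T \<subseteq> (\<Union>\<alpha>\<in>set \<alpha>s. words \<alpha>) \<and> length T = length \<alpha>s}"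
    by (rule finite_lists_length_eq) (simp add: finite_words)
qed

lemma list_le_of_nth_le:
  fixes xs ys :: "'a::linorder list"
  assumes "length xs = length ys" "\<And>k. k < length ys \<Longrightarrow> xs ! k \<le> ys ! k"
  shows "xs \<le> ys"
  using assms
proof (induction xs ys rule: list_induct2)
  case (Cons x xs y ys)
  have "xs \<le> ys" using Cons.prems[of "Suc _"] by (intro Cons.IH) auto
  moreover have "x \<le> y" using Cons.prems[of 0] by simp
  ultimately show ?case by (auto simp: le_less)
qed simp

lemma running_count_tables_A_plus:
  assumes "Y \<in> tables_A_plus lam"
  shows "map running_count Y \<in> tables_A_plus (map conjugate_partition lam)"
proof -
  have "0 \<notin> set t" if "t \<in> words p" for t p using that by (auto simp: words_def)
  then have "lattice_word (running_count (Y ! k))" if "k < length lam" for k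
    using assms running_count_lattice[of "Y ! k"] that by (auto simp: tables_A_plus_def tables_A_def)
  then show ?thesis
    using assms running_count_words
    by (auto simp: tables_A_plus_def tables_A_def in_set_conv_nth)
qed

text \<open>Interpolating \<open>F\<close> at the tables in \<open>tables_A_plus lam\<close> leaves
  a highest weight function that vanishes at all lattice tables: at those of content
  \<open>lam\<close> by interpolation, at the others by weight. Such a function is zero.\<close>

lemma hw_fun_decomposition:
  assumes hw: "hw_fun n lam F" and lam: "\<forall>p\<in>set lam. is_partition m p \<and> length p \<le> n"
    and "lam \<noteq> []"
  shows "\<exists>c. \<forall>cs. set cs \<subseteq> idx n (length lam) \<longrightarrow>
    F cs = (\<Sum>Y\<in>tables_A_plus lam. c Y * table_fun m (map running_count Y) cs)"
proof -
  let ?d = "length lam" and ?A = "tables_A_plus lam"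
  define v where "v Y X = complex_of_int (\<Prod>k<?d. word_sgn (running_count (Y ! k)) (X ! k))" for Y X
  have rows: "length Y = ?d" "k < ?d \<Longrightarrow> Y ! k \<in> words (lam ! k)" "k < ?d \<Longrightarrow> length (Y ! k) = m"
    "k < ?d \<Longrightarrow> running_count (running_count (Y ! k)) = Y ! k"
    if "Y \<in> ?A" for Y k
  proof -
    show "length Y = ?d" using that by (simp add: tables_A_plus_def tables_A_def)
    assume k: "k < ?d"
    show w: "Y ! k \<in> words (lam ! k)" using that k by (simp add: tables_A_plus_def tables_A_def)
    then show "length (Y ! k) = m" using lam k by (auto simp: words_def is_partition_def)
    have "lattice_word (Y ! k)" using that k by (auto simp: tables_A_plus_def tables_A_def)
    moreover have "0 \<notin> set (Y ! k)" using w by (auto simp: words_def)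
    ultimately show "running_count (running_count (Y ! k)) = Y ! k"
      using running_count_lattice by blast
  qed
  \<comment> \<open>Running counts are involutive on lattice words, so the function of
    \<open>map running_count Y\<close> has its diagonal position at \<open>Y\<close>. The order is
    lexicographic within rows and between rows.\<close>
  have "\<exists>c. \<forall>X\<in>?A. (\<Sum>Y\<in>?A. c Y * v Y X) = F (columns_of ?d m X)"
  proof (rule unitriangular_interpolation)
    show "finite ?A"
      by (rule finite_subset[OF _ finite_tables_A[of lam]]) (auto simp: tables_A_plus_def)
    show "v Y Y = 1" if Y: "Y \<in> ?A" for Y
    proof -
      have "word_sgn (running_count (Y ! k)) (Y ! k) = 1" if "k < ?d" for k
        using word_sgn_running_count[of "running_count (Y ! k)"] rows(4)[OF Y that] by simp
      then show ?thesis by (simp add: v_def)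
    qed
    show "Y \<le> X" if Y: "Y \<in> ?A" and X: "X \<in> ?A" and nz: "v Y X \<noteq> 0" for X Y
    proof (rule list_le_of_nth_le)
      show "length Y = length X" using rows(1)[OF Y] rows(1)[OF X] by simp
      fix k assume "k < length X"
      then have k: "k < ?d" using rows(1)[OF X] by simp
      have "word_sgn (running_count (Y ! k)) (X ! k) \<noteq> 0" using nz k by (auto simp: v_def)
      from running_count_le_of_word_sgn[OF this] show "Y ! k \<le> X ! k"
        using rows(3,4)[OF Y k] rows(3)[OF X k] by simp
    qed
  qed
  then obtain c where c: "\<And>X. X \<in> ?A \<Longrightarrow> (\<Sum>Y\<in>?A. c Y * v Y X) = F (columns_of ?d m X)" by blast
  define G where "G cs = F cs - (\<Sum>Y\<in>?A. c Y * table_fun m (map running_count Y) cs)" for cs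
  have hwG: "hw_fun n lam G"
    unfolding G_def
  proof (rule hw_fun_diff_sum[OF hw])
    fix Y assume "Y \<in> ?A"
    then show "hw_fun n lam (table_fun m (map running_count Y))"
      using lam running_count_tables_A_plus[of Y lam]
      by (intro hw_fun_table_fun) (auto simp: tables_A_plus_def)
  qed
  have "G cs = 0" if cs: "set cs \<subseteq> idx n ?d" for cs
  proof (rule hw_fun_eq_zero[OF hwG _ _ cs])
    show len: "length p \<le> n" if "p \<in> set lam" for p using lam that by blast
    fix cs assume cs: "set cs \<subseteq> idx n ?d" and lat: "\<forall>k<?d. lattice_word (table_row k cs)"
    show "G cs = 0"
    proof (rule ccontr)
      assume nz: "G cs \<noteq> 0"
      let ?X = "rows_of ?d cs"
      have w: "table_row k cs \<in> words (lam ! k)" if "k < ?d" for k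
        unfolding words_iff using hw_fun_content[OF hwG len cs nz that] by blast
      then have X: "?X \<in> ?A" using lat by (auto simp: tables_A_plus_def tables_A_def rows_of_def)
      have tf: "table_fun m (map running_count Y) cs = v Y ?X" if Y: "Y \<in> ?A" "length cs = m" for Y
        unfolding table_fun_def v_def using rows(1)[OF Y(1)] Y(2) by (simp add: rows_of_def)
      \<comment> \<open>The length is read off row 0, which exists because \<open>lam\<close> is
        nonempty.\<close>
      have m: "length cs = m" using rows(3)[OF X, of 0] assms(3) by (simp add: rows_of_def)
      have "columns_of ?d m ?X = cs" using columns_of_rows_of[OF cs] m by simp
      then show False using nz c[OF X] tf m by (simp add: G_def)
    qed
  qed
  then show ?thesis unfolding G_def by (intro exI[of _ c]) simp
qed

section \<open>Exchanging entries at equal columns of the table\<close>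

lemma letters_at_append:
  "length s = length x \<Longrightarrow> letters_at c (s @ s') (x @ x') = letters_at c s x @ letters_at c s' x'"
  by (induction s x rule: list_induct2) auto

text \<open>Both positions carry the letter \<open>c\<close>, so only the factor of \<open>c\<close>
  changes, by an exchange of two of its entries.\<close>

lemma word_sgn_swap:
  assumes "length s1 = length xs" "length s2 = length ys" "length s3 = length zs"
  shows "word_sgn (s1 @ c # s2 @ c # s3) (xs @ a # ys @ b # zs)
    = - word_sgn (s1 @ c # s2 @ c # s3) (xs @ b # ys @ a # zs)"
proof -
  let ?s = "s1 @ c # s2 @ c # s3" and ?x = "xs @ a # ys @ b # zs" and ?x' = "xs @ b # ys @ a # zs"
  have c: "c \<in> set ?s" by simp
  have "of_int (perm_sgn (letters_at c ?s ?x)) = (- 1 :: complex) * of_int (perm_sgn (letters_at c ?s ?x'))"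
    using swap_sym_distant[OF swap_sym_perm_sgn, of "letters_at c s1 xs" a "letters_at c s2 ys" b
        "letters_at c s3 zs"]
    by (simp add: letters_at_append assms)
  then have "complex_of_int (perm_sgn (letters_at c ?s ?x)) = of_int (- perm_sgn (letters_at c ?s ?x'))"
    by simp
  then have flip: "perm_sgn (letters_at c ?s ?x) = - perm_sgn (letters_at c ?s ?x')"
    by (simp only: of_int_eq_iff)
  have "word_sgn ?s ?x = perm_sgn (letters_at c ?s ?x) * (\<Prod>e\<in>set ?s - {c}. perm_sgn (letters_at e ?s ?x))"
    using assms by (subst word_sgn_eq, simp) (rule prod.remove[OF _ c], simp)
  also have "(\<Prod>e\<in>set ?s - {c}. perm_sgn (letters_at e ?s ?x))
      = (\<Prod>e\<in>set ?s - {c}. perm_sgn (letters_at e ?s ?x'))"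
    by (rule prod.cong[OF refl]) (auto simp: letters_at_append assms)
  also have "perm_sgn (letters_at c ?s ?x) * \<dots> = - (perm_sgn (letters_at c ?s ?x')
      * (\<Prod>e\<in>set ?s - {c}. perm_sgn (letters_at e ?s ?x')))"
    by (simp only: flip mult_minus_left)
  also have "perm_sgn (letters_at c ?s ?x') * (\<Prod>e\<in>set ?s - {c}. perm_sgn (letters_at e ?s ?x'))
      = word_sgn ?s ?x'"
    using assms by (subst word_sgn_eq, simp) (rule prod.remove[OF _ c, symmetric], simp)
  finally show ?thesis .
qed

lemma table_fun_swap:
  assumes T: "\<forall>t\<in>set T. length t = m" and eq: "\<And>k. k < length T \<Longrightarrow> T ! k ! i = T ! k ! j"
    and cs: "cs = ps @ a # qs @ b # rs" "length cs = m" "length ps = i" "i + Suc (length qs) = j"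
  shows "table_fun m T (ps @ b # qs @ a # rs) = (- 1) ^ length T * table_fun m T cs"
proof -
  have "word_sgn (T ! k) (table_row k (ps @ b # qs @ a # rs)) = - word_sgn (T ! k) (table_row k cs)"
    if k: "k < length T" for k
  proof -
    let ?t = "T ! k"
    have lt: "length ?t = m" using T k by simp
    have ij: "i < j" "j < m" using cs by auto
    have "?t = take i ?t @ ?t ! i # drop (Suc i) ?t" using ij lt by (simp add: id_take_nth_drop)
    also have "drop (Suc i) ?t = take (length qs) (drop (Suc i) ?t) @ drop (Suc i) ?t ! length qs
        # drop (Suc (length qs)) (drop (Suc i) ?t)"
      by (rule id_take_nth_drop) (use ij lt cs in auto)
    also have "drop (Suc i) ?t ! length qs = ?t ! i" using eq[OF k] ij lt cs by auto
    finally have t: "?t = take i ?t @ ?t ! i # take (length qs) (drop (Suc i) ?t) @ ?t ! i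
        # drop (Suc (length qs)) (drop (Suc i) ?t)" .
    have row: "table_row k (us @ x # vs @ y # ws)
        = table_row k us @ x ! k # table_row k vs @ y ! k # table_row k ws" for us x vs y ws
      by (simp add: table_row_def)
    show ?thesis
      unfolding cs(1) row
      by (subst (1 2) t, rule word_sgn_swap) (use lt cs ij in auto)
  qed
  then have "(\<Prod>k<length T. word_sgn (T ! k) (table_row k (ps @ b # qs @ a # rs)))
      = (- 1) ^ length T * (\<Prod>k<length T. word_sgn (T ! k) (table_row k cs))"
    by (simp add: prod.distrib[symmetric] prod_uminus)
  moreover have "length (ps @ b # qs @ a # rs) = m" using cs by simp
  ultimately show ?thesis using cs(2) by (simp only: table_fun_def simp_thms if_True of_int_mult of_int_power of_int_minus of_int_1)
qed

section \<open>Quotients of the tensor algebra\<close>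

text \<open>The symmetric and the exterior algebra as quotients of the tensor algebra: the image of the
  tensor \<open>e\<^bsub>c\<^sub>1\<^esub> \<otimes> \<cdots> \<otimes> e\<^bsub>c\<^sub>m\<^esub>\<close> is \<open>\<eta> cs\<close> times the basis vector \<open>key cs\<close>.\<close>

locale column_algebra =
  fixes n d :: nat and \<epsilon> :: complex and key :: "nat list list \<Rightarrow> 'a" and \<eta> :: "nat list list \<Rightarrow> complex"
    and act :: "complex mat list \<Rightarrow> ('a \<Rightarrow>\<^sub>0 complex) \<Rightarrow> ('a \<Rightarrow>\<^sub>0 complex)" and W :: "('a \<Rightarrow>\<^sub>0 complex) set"
  assumes eps: "\<epsilon> * \<epsilon> = 1"
    and eta_cases: "\<eta> cs = 0 \<or> \<eta> cs * \<eta> cs = 1"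
    and eta_swap: "swap_sym \<epsilon> \<eta>"
    and key_mset: "mset cs = mset cs' \<Longrightarrow> key cs = key cs'"
    and key_inj: "key cs = key cs' \<Longrightarrow> \<eta> cs \<noteq> 0 \<Longrightarrow> \<eta> cs' \<noteq> 0 \<Longrightarrow> mset cs = mset cs'"
    and eta_zero: "\<eta> cs = 0 \<Longrightarrow> \<epsilon> = - 1 \<and> \<not> distinct cs"
    and W_eq: "W = {p. \<forall>a\<in>Poly_Mapping.keys p. \<exists>cs. set cs \<subseteq> idx n d \<and> \<eta> cs \<noteq> 0 \<and> key cs = a}"
    and act_add: "act g (p + q) = act g p + act g q"
    and act_scale: "act g (scale c p) = scale c (act g p)"
    and act_monom: "length g = d \<Longrightarrow> set cs \<subseteq> idx n d \<Longrightarrow>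
      act g (Poly_Mapping.single (key cs) (\<eta> cs)) = (\<Sum>x\<in>lists_of (idx n d) (length cs).
        scale (tensor_coeff (act_coeff g) x cs) (Poly_Mapping.single (key x) (\<eta> x)))"
begin

definition mon :: "nat list list \<Rightarrow> ('a \<Rightarrow>\<^sub>0 complex)" where
  "mon cs = Poly_Mapping.single (key cs) (\<eta> cs)"

text \<open>The bound on the degree makes the projection from tensors a finite sum.\<close>

definition tensors :: "nat \<Rightarrow> nat list list set" where
  "tensors D = {cs. set cs \<subseteq> idx n d \<and> length cs \<le> D}"

definition proj :: "nat \<Rightarrow> (nat list list \<Rightarrow> complex) \<Rightarrow> ('a \<Rightarrow>\<^sub>0 complex)" where
  "proj D F = (\<Sum>cs\<in>tensors D. scale (F cs) (mon cs))"

lemma finite_tensors [simp]: "finite (tensors D)"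
  unfolding tensors_def by (rule finite_lists_length_le) simp

text \<open>Lists with the same key and nonzero \<eta> are rearrangements of each other, and
  \<open>F\<close> changes along them exactly as \<eta> does. Where \<eta> vanishes the list has a
  repetition, and antisymmetry makes \<open>F\<close> vanish too.\<close>

lemma swap_sym_factor:
  assumes "swap_sym \<epsilon> F"
  shows "\<exists>G. \<forall>cs. F cs = \<eta> cs * G (key cs)"
proof -
  define rep where "rep a = (SOME cs. \<eta> cs \<noteq> 0 \<and> key cs = a)" for a
  \<comment> \<open>This is the quotient of \<open>F\<close> by \<eta> at the representative, since
    \<eta> squares to 1 there.\<close>
  define G where "G a = \<eta> (rep a) * F (rep a)" for a
  have "F cs = \<eta> cs * G (key cs)" for cs
  proof (cases "\<eta> cs = 0")
    case True
    then show ?thesis using eta_zero[OF True] swap_sym_not_distinct[of F cs] assms by simp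
  next
    case False
    then have rep: "\<eta> (rep (key cs)) \<noteq> 0" "key (rep (key cs)) = key cs"
      unfolding rep_def by (metis (mono_tags, lifting) someI_ex)+
    have "\<epsilon> \<noteq> 0" using eps by auto
    from swap_sym_common_sign[OF assms eta_swap this key_inj[OF rep(2)[symmetric] False rep(1)]]
    obtain e where e: "F cs = e * F (rep (key cs))" "\<eta> cs = e * \<eta> (rep (key cs))" by blast
    have "\<eta> (rep (key cs)) * \<eta> (rep (key cs)) = 1" using rep(1) eta_cases by blast
    then have "\<eta> cs * G (key cs) = e * F (rep (key cs))"
      by (simp only: e(2) G_def mult.assoc) (simp only: mult.assoc[symmetric] mult_1_right)
    then show ?thesis using e(1) by simp
  qed
  then show ?thesis by blast
qed

text \<open>All orderings of a monomial contribute the same amount because \<eta> squares to 1.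
  Nothing cancels and only a multiplicity appears.\<close>

lemma lookup_proj:
  assumes "\<And>cs. F cs = \<eta> cs * G (key cs)"
  shows "poly_mapping.lookup (proj D F) a
    = of_nat (card {cs \<in> tensors D. key cs = a \<and> \<eta> cs \<noteq> 0}) * G a"
proof -
  have "poly_mapping.lookup (proj D F) a
      = (\<Sum>cs\<in>tensors D. if key cs = a \<and> \<eta> cs \<noteq> 0 then G a else 0)"
    unfolding proj_def lookup_sum
  proof (rule sum.cong[OF refl])
    fix cs
    show "poly_mapping.lookup (scale (F cs) (mon cs)) a = (if key cs = a \<and> \<eta> cs \<noteq> 0 then G a else 0)"
      using eta_cases[of cs]
      by (auto simp: lookup_scale mon_def lookup_single when_def assms mult.commute mult.left_commute)
  qed
  then show ?thesis by (simp add: sum.inter_filter[symmetric])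
qed

lemma proj_injective:
  assumes "swap_sym \<epsilon> F" "proj D F = 0" "cs \<in> tensors D"
  shows "F cs = 0"
proof -
  obtain G where G: "\<And>cs. F cs = \<eta> cs * G (key cs)" using swap_sym_factor[OF assms(1)] by blast
  show ?thesis
  proof (cases "\<eta> cs = 0")
    case False
    then have "card {x \<in> tensors D. key x = key cs \<and> \<eta> x \<noteq> 0} \<noteq> 0"
      using assms(3) by (auto simp: card_eq_0_iff)
    moreover have "of_nat (card {x \<in> tensors D. key x = key cs \<and> \<eta> x \<noteq> 0}) * G (key cs) = 0"
      using lookup_proj[OF G, of D "key cs"] assms(2) by (simp only: lookup_zero)
    ultimately have "G (key cs) = 0" by (simp only: mult_eq_0_iff of_nat_eq_0_iff simp_thms)
    then show ?thesis by (simp add: G)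
  qed (simp add: G)
qed

text \<open>Each coefficient is spread evenly over all orderings of its monomial. The bound
  \<open>m \<le> D\<close> is built in so that the table functions of degree \<open>m\<close> can be
  projected with the same \<open>D\<close>.\<close>

lemma proj_surjective:
  assumes "p \<in> W"
  shows "\<exists>F D. m \<le> D \<and> swap_sym \<epsilon> F \<and> p = proj D F \<and> (\<forall>cs. F cs \<noteq> 0 \<longrightarrow> length cs \<le> D)"
proof -
  obtain rep where rep: "set (rep a) \<subseteq> idx n d \<and> \<eta> (rep a) \<noteq> 0 \<and> key (rep a) = a"
    if "a \<in> Poly_Mapping.keys p" for a
    using assms unfolding W_eq by simp metis
  define D where "D = m + (\<Sum>a\<in>Poly_Mapping.keys p. length (rep a))"
  define N where "N a = card {cs \<in> tensors D. key cs = a \<and> \<eta> cs \<noteq> 0}" for a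
  define G where "G a = poly_mapping.lookup p a / of_nat (N a)" for a
  define F where "F cs = \<eta> cs * G (key cs)" for cs
  have len: "length (rep a) \<le> D" if "a \<in> Poly_Mapping.keys p" for a
    unfolding D_def using member_le_sum[of a "Poly_Mapping.keys p" "\<lambda>a. length (rep a)"] that by simp
  have "swap_sym \<epsilon> F"
  proof -
    have "F (xs @ a # b # ys) = \<epsilon> * F (xs @ b # a # ys)" for xs a b ys
    proof -
      have "key (xs @ a # b # ys) = key (xs @ b # a # ys)" by (rule key_mset) simp
      then show ?thesis
        unfolding F_def swap_symD[OF eta_swap, of xs a b ys] by (simp only: mult.assoc)
    qed
    then show ?thesis unfolding swap_sym_def by blast
  qed
  moreover have "p = proj D F"
  proof (rule poly_mapping_eqI)
    fix a
    show "poly_mapping.lookup p a = poly_mapping.lookup (proj D F) a"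
    proof (cases "a \<in> Poly_Mapping.keys p")
      case True
      then have "rep a \<in> {cs \<in> tensors D. key cs = a \<and> \<eta> cs \<noteq> 0}"
        using rep len by (simp add: tensors_def)
      then have "N a \<noteq> 0" unfolding N_def by (auto simp: card_eq_0_iff)
      then show ?thesis
        by (subst lookup_proj[where G = G]) (simp_all add: F_def G_def N_def)
    next
      case False
      then show ?thesis
        by (subst lookup_proj[where G = G]) (simp_all add: F_def G_def in_keys_iff)
    qed
  qed
  moreover have "length cs \<le> D" if "F cs \<noteq> 0" for cs
  proof -
    have "\<eta> cs \<noteq> 0" and k: "key cs \<in> Poly_Mapping.keys p"
      using that by (auto simp: F_def G_def in_keys_iff)
    then have "mset cs = mset (rep (key cs))" using key_inj[of cs "rep (key cs)"] rep[OF k] by simp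
    then have "length cs = length (rep (key cs))" by (rule mset_eq_length)
    with len[OF k] show ?thesis by simp
  qed
  moreover have "m \<le> D" by (simp add: D_def)
  ultimately show ?thesis by blast
qed

lemma act_sum: "act g (sum f A) = (\<Sum>a\<in>A. act g (f a))"
proof (induction A rule: infinite_finite_induct)
  case (insert a A)
  then show ?case by (simp add: act_add)
qed (use act_scale[of g 0 0] in simp_all)

text \<open>Exchanging the two sums moves the matrix coefficients from the monomials to
  \<open>F\<close>. The action preserves lengths and hence the bound \<open>D\<close>.\<close>

lemma act_proj:
  assumes "length g = d"
  shows "act g (proj D F) = proj D (tensor_act (idx n d) (act_coeff g) F)"
proof -
  have lists: "lists_of (idx n d) (length cs) = {x \<in> tensors D. length x = length cs}"
    if "cs \<in> tensors D" for cs
    using that by (auto simp: lists_of_def tensors_def)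
  let ?h = "\<lambda>cs x. scale (F cs) (scale (tensor_coeff (act_coeff g) x cs) (mon x))"
  have "act g (proj D F) = (\<Sum>cs\<in>tensors D. scale (F cs) (act g (mon cs)))"
    by (simp add: proj_def act_sum act_scale)
  also have "\<dots> = (\<Sum>cs\<in>tensors D. \<Sum>x | x \<in> tensors D \<and> length x = length cs. ?h cs x)"
  proof (rule sum.cong[OF refl])
    fix cs assume cs: "cs \<in> tensors D"
    then have "act g (mon cs) = (\<Sum>x | x \<in> tensors D \<and> length x = length cs.
        scale (tensor_coeff (act_coeff g) x cs) (mon x))"
      using act_monom[OF assms, of cs] lists[OF cs] by (simp add: tensors_def mon_def)
    then show "scale (F cs) (act g (mon cs)) = (\<Sum>x | x \<in> tensors D \<and> length x = length cs. ?h cs x)"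
      by (simp only: cvec.scale_sum_right)
  qed
  also have "\<dots> = (\<Sum>x\<in>tensors D. \<Sum>cs | cs \<in> tensors D \<and> length x = length cs. ?h cs x)"
    by (rule sum.swap_restrict) simp_all
  also have "\<dots> = proj D (tensor_act (idx n d) (act_coeff g) F)"
    unfolding proj_def
  proof (rule sum.cong[OF refl])
    fix x assume x: "x \<in> tensors D"
    have "{cs. cs \<in> tensors D \<and> length x = length cs} = lists_of (idx n d) (length x)"
      unfolding lists[OF x] by (rule Collect_cong) (metis (no_types))
    then show "(\<Sum>cs | cs \<in> tensors D \<and> length x = length cs. ?h cs x)
        = scale (tensor_act (idx n d) (act_coeff g) F x) (mon x)"
      by (simp add: tensor_act_eq_sum cvec.scale_sum_left mult.commute)
  qed
  finally show ?thesis .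
qed

lemma proj_cmult: "proj D (\<lambda>cs. c * F cs) = scale c (proj D F)"
  by (simp add: proj_def cvec.scale_sum_right)

lemma proj_diff: "proj D (\<lambda>cs. F cs - G cs) = proj D F - proj D G"
  by (simp add: proj_def cvec.scale_left_diff_distrib sum_subtractf)

lemma proj_sum: "proj D (\<lambda>cs. \<Sum>a\<in>A. c a * F a cs) = (\<Sum>a\<in>A. scale (c a) (proj D (F a)))"
  by (simp add: proj_def cvec.scale_sum_left cvec.scale_sum_right sum.swap[of _ A])

lemma proj_cong: "(\<And>cs. cs \<in> tensors D \<Longrightarrow> F cs = G cs) \<Longrightarrow> proj D F = proj D G"
  by (simp add: proj_def)

text \<open>The defect between the two sides is again swap-symmetric and projects to 0, so it
  vanishes up to length \<open>D\<close>; beyond \<open>D\<close> both sides are 0.\<close>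

lemma eigen_of_act_proj:
  assumes "length g = d" "swap_sym \<epsilon> F" "\<forall>cs. F cs \<noteq> 0 \<longrightarrow> length cs \<le> D"
    and "act g (proj D F) = scale \<chi> (proj D F)" and cs: "set cs \<subseteq> idx n d"
  shows "tensor_act (idx n d) (act_coeff g) F cs = \<chi> * F cs"
proof (cases "length cs \<le> D")
  case True
  let ?H = "\<lambda>cs. tensor_act (idx n d) (act_coeff g) F cs - \<chi> * F cs"
  have "swap_sym \<epsilon> ?H"
    unfolding swap_sym_def
  proof (intro allI)
    fix xs a b ys
    show "?H (xs @ a # b # ys) = \<epsilon> * ?H (xs @ b # a # ys)"
      unfolding swap_symD[OF assms(2), of xs a b ys]
        swap_symD[OF tensor_act_swap_sym[OF assms(2)], of _ _ xs a b ys]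
      by (simp only: right_diff_distrib mult.left_commute)
  qed
  moreover have "proj D ?H = 0"
    using assms(4) by (simp add: proj_diff proj_cmult act_proj[OF assms(1)])
  ultimately have "?H cs = 0"
    by (rule proj_injective) (use True cs in \<open>simp add: tensors_def\<close>)
  then show ?thesis by simp
next
  case False
  then have zero: "F x = 0" if "length x = length cs" for x using assms(3) that by fastforce
  then have "tensor_act (idx n d) (act_coeff g) F cs = tensor_act (idx n d) (act_coeff g) (\<lambda>x. 0) cs"
    by (intro tensor_act_cong) (simp add: lists_of_def)
  then show ?thesis using zero by (simp add: tensor_act_eq_sum)
qed

text \<open>Common form of \<open>Delta n T\<close> and \<open>Nabla n T\<close> without the scalar
  factor, with columns in place of rows.\<close>

definition table_vec :: "nat \<Rightarrow> nat list list \<Rightarrow> ('a \<Rightarrow>\<^sub>0 complex)" where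
  "table_vec m T = (\<Sum>cs\<in>lists_of (idx n d) m. scale (table_fun m T cs) (mon cs))"

lemma proj_table_fun: "m \<le> D \<Longrightarrow> proj D (table_fun m T) = table_vec m T"
  unfolding proj_def table_vec_def
  by (rule sum.mono_neutral_right, simp) (auto simp: tensors_def lists_of_def table_fun_def)

lemma subspace_W: "cvec.subspace W"
proof (rule cvec.subspaceI)
  show "x + y \<in> W" if "x \<in> W" "y \<in> W" for x y
    using that Poly_Mapping.keys_add[of x y] unfolding W_eq by blast
  show "scale c x \<in> W" if "x \<in> W" for c x
  proof -
    have "Poly_Mapping.keys (scale c x) \<subseteq> Poly_Mapping.keys x"
      by (auto simp: in_keys_iff lookup_scale)
    then show ?thesis using that unfolding W_eq by blast
  qed
qed (simp add: W_eq)

lemma proj_in_W: "proj D F \<in> W"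
proof -
  have "mon cs \<in> W" if "cs \<in> tensors D" for cs
    using that by (auto simp: W_eq mon_def tensors_def split: if_splits)
  then show ?thesis
    unfolding proj_def by (intro cvec.subspace_sum[OF subspace_W] cvec.subspace_scale[OF subspace_W])
qed

lemma subspace_HWV: "cvec.subspace (HWV n lam W act)"
proof (rule cvec.subspaceI)
  show "0 \<in> HWV n lam W act"
    using act_scale[of _ 0 0] cvec.subspace_0[OF subspace_W] by (simp add: HWV_def)
  show "x + y \<in> HWV n lam W act" if "x \<in> HWV n lam W act" "y \<in> HWV n lam W act" for x y
    using that cvec.subspace_add[OF subspace_W] by (simp add: HWV_def act_add cvec.scale_right_distrib)
  show "scale c x \<in> HWV n lam W act" if "x \<in> HWV n lam W act" for c x
    using that cvec.subspace_scale[OF subspace_W]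
    by (simp add: HWV_def act_scale mult.commute)
qed

text \<open>The part common to both algebras and both parities: table functions project to highest
  weight vectors, and conversely a highest weight vector is lifted, decomposed there and projected
  back.\<close>

theorem HWV_eq_span_table_vec:
  assumes d: "length lam = d" "d \<ge> 1" and lam: "\<forall>p\<in>set lam. is_partition m p \<and> length p \<le> n"
  shows "HWV n lam W act
    = cvec.span {table_vec m T | T. T \<in> tables_A_plus (map conjugate_partition lam)}"
proof
  let ?S = "{table_vec m T | T. T \<in> tables_A_plus (map conjugate_partition lam)}"
  show "cvec.span ?S \<subseteq> HWV n lam W act"
  proof (rule cvec.span_minimal[OF _ subspace_HWV])
    show "?S \<subseteq> HWV n lam W act"
    proof
      fix v assume "v \<in> ?S"
      then obtain T where v: "v = table_vec m T" and T: "T \<in> tables_A (map conjugate_partition lam)"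
        by (auto simp: tables_A_plus_def)
      then have v: "v = proj m (table_fun m T)" by (simp add: proj_table_fun)
      have "hw_fun n lam (table_fun m T)" by (rule hw_fun_table_fun[OF T]) (use lam in blast)
      then have hw: "t \<in> torus n d \<Longrightarrow> set cs \<subseteq> idx n d \<Longrightarrow>
          tensor_act (idx n d) (act_coeff t) (table_fun m T) cs = weight lam t * table_fun m T cs"
        "u \<in> unipotent n d \<Longrightarrow> set cs \<subseteq> idx n d \<Longrightarrow>
          tensor_act (idx n d) (act_coeff u) (table_fun m T) cs = table_fun m T cs" for t u cs
        unfolding hw_fun_def d by blast+
      have "act t v = scale (weight lam t) v" if "t \<in> torus n d" for t
      proof -
        have "length t = d" using that by (simp add: torus_def GL_def)
        then have "act t v = proj m (tensor_act (idx n d) (act_coeff t) (table_fun m T))"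
          by (simp only: v act_proj)
        also have "\<dots> = proj m (\<lambda>cs. weight lam t * table_fun m T cs)"
          by (rule proj_cong) (simp add: hw(1)[OF that] tensors_def)
        finally show ?thesis by (simp only: proj_cmult v)
      qed
      moreover have "act u v = v" if "u \<in> unipotent n d" for u
      proof -
        have "length u = d" using that by (simp add: unipotent_def GL_def)
        then have "act u v = proj m (tensor_act (idx n d) (act_coeff u) (table_fun m T))"
          by (simp only: v act_proj)
        also have "\<dots> = proj m (table_fun m T)"
          by (rule proj_cong) (simp add: hw(2)[OF that] tensors_def)
        finally show ?thesis by (simp only: v)
      qed
      ultimately show "v \<in> HWV n lam W act" using proj_in_W by (simp add: HWV_def d v)
    qed
  qed
  show "HWV n lam W act \<subseteq> cvec.span ?S"
  proof
    fix p assume p: "p \<in> HWV n lam W act"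
    then have "p \<in> W" by (simp add: HWV_def)
    from proj_surjective[OF this, of m] obtain F D where FD: "m \<le> D" "swap_sym \<epsilon> F" "p = proj D F"
      "\<forall>cs. F cs \<noteq> 0 \<longrightarrow> length cs \<le> D" by blast
    have "hw_fun n lam F"
      unfolding hw_fun_def d
    proof (intro allI impI conjI ballI)
      fix cs t assume cs: "set cs \<subseteq> idx n d" and t: "t \<in> torus n d"
      show "tensor_act (idx n d) (act_coeff t) F cs = weight lam t * F cs"
        by (rule eigen_of_act_proj[OF _ FD(2,4) _ cs])
          (use t p FD(3) in \<open>auto simp: HWV_def d torus_def GL_def\<close>)
    next
      fix cs u assume cs: "set cs \<subseteq> idx n d" and u: "u \<in> unipotent n d"
      have "tensor_act (idx n d) (act_coeff u) F cs = 1 * F cs"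
        by (rule eigen_of_act_proj[OF _ FD(2,4) _ cs])
          (use u p FD(3) in \<open>auto simp: HWV_def d unipotent_def GL_def\<close>)
      then show "tensor_act (idx n d) (act_coeff u) F cs = F cs" by simp
    qed
    moreover have "lam \<noteq> []" using d by auto
    ultimately obtain c where c: "\<And>cs. set cs \<subseteq> idx n d \<Longrightarrow>
        F cs = (\<Sum>Y\<in>tables_A_plus lam. c Y * table_fun m (map running_count Y) cs)"
      using hw_fun_decomposition[OF _ lam, of F] d by auto
    have "p = proj D (\<lambda>cs. \<Sum>Y\<in>tables_A_plus lam. c Y * table_fun m (map running_count Y) cs)"
      unfolding FD(3) by (rule proj_cong) (simp add: c tensors_def)
    also have "\<dots> = (\<Sum>Y\<in>tables_A_plus lam. scale (c Y) (table_vec m (map running_count Y)))"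
      by (simp add: proj_sum proj_table_fun[OF FD(1)])
    also have "\<dots> \<in> cvec.span ?S"
      using running_count_tables_A_plus
      by (intro cvec.span_sum cvec.span_scale cvec.span_base) blast
    finally show "p \<in> cvec.span ?S" .
  qed
qed

text \<open>Exchanging two columns of the summation variable at positions where \<open>T\<close> has equal
  columns multiplies the coefficient by \<open>(-1)\<^sup>d\<close> and the monomial by \<open>\<epsilon>\<close>.\<close>

lemma table_vec_eq_zero:
  assumes sign: "\<epsilon> * (- 1) ^ d = - 1" and T: "length T = d" "\<forall>t\<in>set T. length t = m"
    and rep: "\<not> distinct (columns_of d m T)"
  shows "table_vec m T = 0"
proof -
  obtain i j where ij: "i < j" "j < m" and "columns_of d m T ! i = columns_of d m T ! j"
    using rep unfolding distinct_conv_nth by (metis length_columns_of linorder_neqE_nat)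
  then have eq: "T ! k ! i = T ! k ! j" if "k < d" for k
    using that by (auto simp: columns_of_def)
  \<comment> \<open>The exchange is an involution of the index set, so the sum of the exchanged
    terms is the same vector; each exchanged term is also the negative of the original.\<close>
  define sw where "sw cs = cs[i := cs ! j, j := cs ! i]" for cs :: "nat list list"
  have sw_eq: "sw (ps @ a # qs @ b # rs) = ps @ b # qs @ a # rs"
    if "length ps = i" "i + Suc (length qs) = j" for ps a qs b rs
    unfolding sw_def that(2)[symmetric] that(1)[symmetric] by (simp add: nth_append list_update_append)
  have split: "\<exists>ps a qs b rs. cs = ps @ a # qs @ b # rs \<and> sw cs = ps @ b # qs @ a # rs
      \<and> length ps = i \<and> i + Suc (length qs) = j" if lcs: "length cs = m" for cs
  proof -
    have "cs = take i cs @ cs ! i # drop (Suc i) cs" using ij lcs by (simp add: id_take_nth_drop)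
    also have "drop (Suc i) cs = take (j - Suc i) (drop (Suc i) cs)
        @ drop (Suc i) cs ! (j - Suc i) # drop (Suc (j - Suc i)) (drop (Suc i) cs)"
      by (rule id_take_nth_drop) (use ij lcs in auto)
    finally have e: "cs = take i cs @ cs ! i # take (j - Suc i) (drop (Suc i) cs)
        @ drop (Suc i) cs ! (j - Suc i) # drop (Suc (j - Suc i)) (drop (Suc i) cs)" .
    have l: "length (take i cs) = i" "length (take (j - Suc i) (drop (Suc i) cs)) = j - Suc i"
      using ij lcs by auto
    obtain ps a qs b rs where cs: "cs = ps @ a # qs @ b # rs" "length ps = i" "length qs = j - Suc i"
      by (rule that[OF e l])
    have "sw cs = ps @ b # qs @ a # rs"
      unfolding cs(1) by (rule sw_eq) (use ij cs(2,3) in auto)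
    then show ?thesis using cs ij by (intro exI conjI) auto
  qed
  have "table_vec m T = (\<Sum>cs\<in>lists_of (idx n d) m. scale (table_fun m T (sw cs)) (mon (sw cs)))"
    unfolding table_vec_def
  proof (rule sum.reindex_bij_witness[of _ sw sw])
    have invol: "sw (sw cs) = cs \<and> set (sw cs) = set cs \<and> length (sw cs) = length cs"
      if m: "length cs = m" for cs
    proof -
      obtain ps a qs b rs where cs: "cs = ps @ a # qs @ b # rs" "sw cs = ps @ b # qs @ a # rs"
        "length ps = i" "i + Suc (length qs) = j" using split[OF m] by blast
      have "length (sw cs) = m" using m by (simp add: sw_def)
      have "sw (sw cs) = cs"
        unfolding cs(2) using sw_eq[OF cs(3,4)] by (simp add: cs(1))
      then show ?thesis using cs(1,2) by auto
    qed
    show "sw (sw cs) = cs" "sw cs \<in> lists_of (idx n d) m" if "cs \<in> lists_of (idx n d) m" for cs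
      using invol[of cs] that by (auto simp: lists_of_def)
    then show "sw (sw cs) = cs" "sw cs \<in> lists_of (idx n d) m" if "cs \<in> lists_of (idx n d) m" for cs
      using that by auto
    show "scale (table_fun m T (sw (sw cs))) (mon (sw (sw cs))) = scale (table_fun m T cs) (mon cs)"
      if "cs \<in> lists_of (idx n d) m" for cs
      using invol[of cs] that by (simp add: lists_of_def)
  qed
  also have "\<dots> = (\<Sum>cs\<in>lists_of (idx n d) m. scale (- 1) (scale (table_fun m T cs) (mon cs)))"
  proof (rule sum.cong[OF refl])
    fix cs assume "cs \<in> lists_of (idx n d) m"
    then have m: "length cs = m" by (simp add: lists_of_def)
    obtain ps a qs b rs where cs: "cs = ps @ a # qs @ b # rs" "sw cs = ps @ b # qs @ a # rs"
      "length ps = i" "i + Suc (length qs) = j" using split[OF m] by blast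
    have "table_fun m T (sw cs) = (- 1) ^ d * table_fun m T cs"
      unfolding cs(2) T(1)[symmetric]
      by (rule table_fun_swap[OF T(2) _ cs(1) m cs(3,4)]) (use eq T(1) in simp)
    moreover have "mon (sw cs) = scale \<epsilon> (mon cs)"
    proof -
      have "\<eta> (sw cs) = \<epsilon> * \<eta> cs"
        unfolding cs(2) unfolding cs(1) by (rule swap_sym_distant[OF eta_swap eps])
      moreover have "key (sw cs) = key cs"
        unfolding cs(2) unfolding cs(1) by (rule key_mset) simp
      ultimately show ?thesis by (simp add: mon_def)
    qed
    moreover have "(- 1) ^ d * table_fun m T cs * \<epsilon> = - table_fun m T cs"
      using sign by (metis mult.assoc mult.commute mult_minus1)
    ultimately show "scale (table_fun m T (sw cs)) (mon (sw cs))
        = scale (- 1) (scale (table_fun m T cs) (mon cs))"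
      by (simp only: cvec.scale_scale mult_minus1)
  qed
  also have "\<dots> = scale (- 1) (table_vec m T)"
    by (simp only: table_vec_def cvec.scale_sum_right)
  finally have neg: "table_vec m T = scale (- 1) (table_vec m T)" .
  have "poly_mapping.lookup (table_vec m T) a = 0" for a
  proof -
    have "poly_mapping.lookup (table_vec m T) a + poly_mapping.lookup (table_vec m T) a = 0"
      using arg_cong[OF neg, of "\<lambda>v. poly_mapping.lookup v a"]
      by (simp only: lookup_scale mult_minus1 eq_neg_iff_add_eq_0)
    then show ?thesis by (simp flip: mult_2)
  qed
  then show ?thesis by (intro poly_mapping_eqI) (simp only: lookup_zero)
qed

end

context column_algebra
begin

lemma sum_tables_eq_table_vec:
  assumes "length T = d" "d \<ge> 1" "\<forall>t\<in>set T. length t = m"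
    and M: "\<And>X. M X = mon (List.transpose X)"
  shows "(\<Sum>X\<in>tables n d m. scale (of_int (table_sgn T X)) (M X)) = table_vec m T"
proof -
  have "(\<Sum>X\<in>tables n d m. scale (of_int (table_sgn T X)) (M X))
      = (\<Sum>X\<in>tables n d m. scale (table_fun m T (columns_of d m X)) (mon (columns_of d m X)))"
  proof (rule sum.cong[OF refl])
    fix X assume "X \<in> tables n d m"
    then have X: "length X = d" "\<forall>x\<in>set X. length x = m" by (auto simp: tables_def)
    have "table_sgn T X = (\<Prod>k<length T. word_sgn (T ! k) (table_row k (columns_of d m X)))"
      unfolding table_sgn_def by (rule prod.cong) (use X assms(1) in \<open>auto simp: table_row_columns_of\<close>)
    then show "scale (of_int (table_sgn T X)) (M X)
        = scale (table_fun m T (columns_of d m X)) (mon (columns_of d m X))"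
      by (simp add: table_fun_def M transpose_eq_columns_of[OF X(1) assms(2) X(2)])
  qed
  also have "\<dots> = table_vec m T"
    unfolding table_vec_def by (rule sum.reindex_bij_betw[OF columns_of_bij])
  finally show ?thesis .
qed

text \<open>\<open>M\<close> and \<open>V\<close> stand for \<open>sym_monom\<close> and
  \<open>Delta\<close>, or for \<open>ext_monom\<close> and \<open>Nabla\<close>. The scalars in
  \<open>V\<close> are nonzero and do not affect spans; under the sign condition tables with
  repeated columns contribute zero vectors.\<close>

lemma HWV_eq_span:
  assumes d: "length lam = d" "d \<ge> 1" and lam: "\<forall>p\<in>set lam. is_partition m p \<and> length p \<le> n"
    and M: "\<And>X. M X = mon (List.transpose X)"
    and V: "\<And>T. V T = scale (of_int (table_sign T) / of_nat (table_norm T))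
      (\<Sum>X\<in>tables n (length T) (length (List.transpose T)). scale (of_int (table_sgn T X)) (M X))"
  shows "HWV n lam W act = cvec.span {V T | T. T \<in> tables_A_plus (map conjugate_partition lam)}"
    and "\<epsilon> * (- 1) ^ d = - 1 \<Longrightarrow>
      HWV n lam W act = cvec.span {V T | T. T \<in> tables_B_plus (map conjugate_partition lam)}"
proof -
  let ?A = "tables_A_plus (map conjugate_partition lam)"
  let ?B = "tables_B_plus (map conjugate_partition lam)"
  define r :: "nat list list \<Rightarrow> complex" where "r T = of_int (table_sign T) / of_nat (table_norm T)" for T
  have "table_sign T \<noteq> 0" for T
    by (induction T) (auto simp: table_sign_def word_sign_def)
  moreover have "table_norm T \<noteq> 0" for T
    by (simp add: table_norm_def)
  ultimately have r: "r T \<noteq> 0" for T by (simp add: r_def)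
  have sums: "\<forall>p\<in>set lam. sum_list p = m" using lam by (simp add: is_partition_def)
  have T: "length T = d" "\<forall>t\<in>set T. length t = m" if "T \<in> ?A" for T
    using tables_A_conjugate_rows[OF _ sums, of T] that d by (auto simp: tables_A_plus_def)
  have V_eq: "V T = scale (r T) (table_vec m T)" if "T \<in> ?A" for T
    using sum_tables_eq_table_vec[OF T(1)[OF that] d(2) T(2)[OF that] M]
      transpose_eq_columns_of[OF T(1)[OF that] d(2) T(2)[OF that]] T(1)[OF that]
    by (simp add: V r_def)
  have HWV: "HWV n lam W act = cvec.span {table_vec m T | T. T \<in> ?A}"
    by (rule HWV_eq_span_table_vec[OF d lam])
  \<comment> \<open>\<open>S\<close> will be \<open>?A\<close> for the first claim and
    \<open>?B\<close> for the second.\<close>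
  have span: "cvec.span {V T | T. T \<in> S} = cvec.span {table_vec m T | T. T \<in> ?A}"
    if S: "S \<subseteq> ?A" and zero: "\<And>T. T \<in> ?A - S \<Longrightarrow> table_vec m T = 0" for S
    unfolding cvec.span_eq
  proof (intro conjI subsetI)
    fix v assume "v \<in> {V T | T. T \<in> S}"
    then obtain T where "T \<in> ?A" and v: "v = scale (r T) (table_vec m T)" using S V_eq by auto
    then have "table_vec m T \<in> cvec.span {table_vec m T | T. T \<in> ?A}"
      by (intro cvec.span_base) blast
    then show "v \<in> cvec.span {table_vec m T | T. T \<in> ?A}"
      unfolding v by (rule cvec.span_scale)
  next
    fix v assume "v \<in> {table_vec m T | T. T \<in> ?A}"
    then obtain T where TA: "T \<in> ?A" and v: "v = table_vec m T" by blast
    show "v \<in> cvec.span {V T | T. T \<in> S}"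
    proof (cases "T \<in> S")
      case True
      have eq: "v = scale (inverse (r T)) (V T)" using r[of T] by (simp add: v V_eq[OF TA])
      have "V T \<in> cvec.span {V T | T. T \<in> S}" using True by (intro cvec.span_base) blast
      then show ?thesis unfolding eq by (rule cvec.span_scale)
    next
      case False
      then show ?thesis using zero TA v cvec.span_zero by simp
    qed
  qed
  show "HWV n lam W act = cvec.span {V T | T. T \<in> ?A}" using HWV span[of ?A] by simp
  assume sign: "\<epsilon> * (- 1) ^ d = - 1"
  have "cvec.span {V T | T. T \<in> ?B} = cvec.span {table_vec m T | T. T \<in> ?A}"
  proof (rule span)
    show "?B \<subseteq> ?A" by (auto simp: tables_B_plus_def)
    fix U assume U: "U \<in> ?A - ?B"
    then have UA: "U \<in> ?A" by blast
    have "\<not> distinct (List.transpose U)"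
      using U by (auto simp: tables_B_plus_def tables_B_def tables_A_plus_def)
    then show "table_vec m U = 0"
      using table_vec_eq_zero[OF sign T[OF UA]] transpose_eq_columns_of[OF T(1)[OF UA] d(2) T(2)[OF UA]]
      by simp
  qed
  then show "HWV n lam W act = cvec.span {V T | T. T \<in> ?B}" using HWV by simp
qed

end

text \<open>The shape shared by \<open>sym_act\<close> and \<open>ext_act\<close>, from which both
  inherit linearity.\<close>

definition lin_ext :: "('a \<Rightarrow> 'b \<Rightarrow>\<^sub>0 complex) \<Rightarrow> ('a \<Rightarrow>\<^sub>0 complex) \<Rightarrow> ('b \<Rightarrow>\<^sub>0 complex)" where
  "lin_ext \<Phi> p = (\<Sum>a\<in>Poly_Mapping.keys p. scale (poly_mapping.lookup p a) (\<Phi> a))"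

lemma lin_ext_superset:
  assumes "finite A" "Poly_Mapping.keys p \<subseteq> A"
  shows "lin_ext \<Phi> p = (\<Sum>a\<in>A. scale (poly_mapping.lookup p a) (\<Phi> a))"
  unfolding lin_ext_def by (rule sum.mono_neutral_left) (use assms in \<open>auto simp: in_keys_iff\<close>)

lemma lin_ext_add: "lin_ext \<Phi> (p + q) = lin_ext \<Phi> p + lin_ext \<Phi> q"
proof -
  let ?A = "Poly_Mapping.keys p \<union> Poly_Mapping.keys q"
  have "Poly_Mapping.keys (p + q) \<subseteq> ?A" by (rule Poly_Mapping.keys_add)
  then show ?thesis
    by (simp add: lin_ext_superset[of ?A] lookup_add cvec.scale_left_distrib sum.distrib)
qed

lemma lin_ext_scale: "lin_ext \<Phi> (scale c p) = scale c (lin_ext \<Phi> p)"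
proof -
  have "Poly_Mapping.keys (scale c p) \<subseteq> Poly_Mapping.keys p"
    by (auto simp: in_keys_iff lookup_scale)
  then show ?thesis
    by (simp add: lin_ext_superset[of "Poly_Mapping.keys p"] lookup_scale cvec.scale_sum_right)
qed

lemma lin_ext_single: "lin_ext \<Phi> (Poly_Mapping.single a c) = scale c (\<Phi> a)"
  by (cases "c = 0") (simp_all add: lin_ext_def)

section \<open>The symmetric algebra\<close>

definition sym_key :: "nat list list \<Rightarrow> (nat list \<Rightarrow>\<^sub>0 nat)" where
  "sym_key cs = (\<Sum>c\<leftarrow>cs. Poly_Mapping.single c 1)"

lemma lookup_sym_key: "poly_mapping.lookup (sym_key cs) c = count_list cs c"
  by (induction cs) (auto simp: sym_key_def lookup_add lookup_single)

lemma count_mset_eq_count_list: "count (mset xs) x = count_list xs x"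
  by (induction xs) auto

lemma sym_key_eq_iff: "sym_key cs = sym_key cs' \<longleftrightarrow> mset cs = mset cs'"
proof
  assume "sym_key cs = sym_key cs'"
  then have "count_list cs c = count_list cs' c" for c by (metis lookup_sym_key)
  then show "mset cs = mset cs'" by (simp add: multiset_eq_iff count_mset_eq_count_list)
next
  assume "mset cs = mset cs'"
  then have "count_list cs c = count_list cs' c" for c by (metis count_mset_eq_count_list)
  then show "sym_key cs = sym_key cs'" by (intro poly_mapping_eqI) (simp add: lookup_sym_key)
qed

lemma sym_key_surj: "\<exists>cs. sym_key cs = a"
proof -
  have "finite {x. 0 < poly_mapping.lookup a x}"
    using finite_keys[of a] by (simp add: keys.rep_eq)
  then obtain M where M: "count M = poly_mapping.lookup a"
    using count_Abs_multiset[of "poly_mapping.lookup a"] by blast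
  obtain cs where "mset cs = M" using ex_mset by blast
  then have "sym_key cs = a"
    by (intro poly_mapping_eqI) (simp add: lookup_sym_key M flip: count_mset_eq_count_list)
  then show ?thesis by blast
qed

lemma keys_sym_key: "Poly_Mapping.keys (sym_key cs) = set cs"
  by (auto simp: in_keys_iff lookup_sym_key count_list_0_iff)

lemma prod_list_sym_e: "(\<Prod>c\<leftarrow>cs. sym_e c) = Poly_Mapping.single (sym_key cs) 1"
proof (induction cs)
  case (Cons c cs)
  then show ?case by (simp add: sym_e_def sym_key_def mult_single)
qed (simp add: sym_key_def)

lemma scale_mult_left: "scale c p * q = scale c (p * q)" for p q :: sym
  by (simp add: scale_def mult_map_scale_conv_mult mult.assoc)

lemma scale_mult_right: "p * scale c q = scale c (p * q)" for p q :: sym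
  using scale_mult_left[of c q p] by (simp add: mult.commute)

text \<open>Multiplying out the linear forms: an ordered choice of generators occurs with its matrix
  coefficient on tensors.\<close>

lemma prod_list_sym_act_e:
  "(\<Prod>c\<leftarrow>cs. sym_act_e n g c) = (\<Sum>x\<in>lists_of (idx n (length g)) (length cs).
     scale (tensor_coeff (act_coeff g) x cs) (\<Prod>c\<leftarrow>x. sym_e c))"
proof (induction cs)
  case (Cons c cs)
  let ?I = "idx n (length g)"
  have "(\<Prod>c\<leftarrow>c # cs. sym_act_e n g c)
      = sym_act_e n g c * (\<Sum>x\<in>lists_of ?I (length cs).
          scale (tensor_coeff (act_coeff g) x cs) (\<Prod>c\<leftarrow>x. sym_e c))"
    by (simp add: Cons)
  also have "\<dots> = (\<Sum>b\<in>?I. \<Sum>x\<in>lists_of ?I (length cs).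
      scale (tensor_coeff (act_coeff g) (b # x) (c # cs)) (\<Prod>c\<leftarrow>b # x. sym_e c))"
    by (simp add: sym_act_e_def sum_product scale_mult_left scale_mult_right mult.commute)
  finally show ?case by (simp only: sum_lists_of_Suc length_Cons)
qed (simp add: tensor_coeff_def)

lemma sym_act_eq_lin_ext: "sym_act n g = lin_ext (\<lambda>a. \<Prod>i\<in>Poly_Mapping.keys a.
    sym_act_e n g i ^ poly_mapping.lookup a i)"
  by (rule ext) (simp add: sym_act_def lin_ext_def)

lemma column_algebra_sym: "column_algebra n d 1 sym_key (\<lambda>_. 1) (sym_act n) (sym_space n d)"
proof
  show "sym_space n d = {p. \<forall>a\<in>Poly_Mapping.keys p.
      \<exists>cs. set cs \<subseteq> idx n d \<and> (1::complex) \<noteq> 0 \<and> sym_key cs = a}"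
  proof -
    have "Poly_Mapping.keys a \<subseteq> idx n d \<longleftrightarrow> (\<exists>cs. set cs \<subseteq> idx n d \<and> (1::complex) \<noteq> 0 \<and> sym_key cs = a)" for a
      by (metis keys_sym_key sym_key_surj zero_neq_one)
    then show ?thesis by (simp add: sym_space_def)
  qed
  show "sym_act n g (Poly_Mapping.single (sym_key cs) 1) = (\<Sum>x\<in>lists_of (idx n d) (length cs).
      scale (tensor_coeff (act_coeff g) x cs) (Poly_Mapping.single (sym_key x) 1))"
    if "length g = d" "set cs \<subseteq> idx n d" for g cs
  proof -
    have "sym_act n g (Poly_Mapping.single (sym_key cs) 1) = (\<Prod>c\<leftarrow>cs. sym_act_e n g c)"
      by (simp add: sym_act_eq_lin_ext lin_ext_single keys_sym_key lookup_sym_key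
          prod_list_eq_prod_count[of cs "set cs"])
    then show ?thesis by (simp add: prod_list_sym_act_e prod_list_sym_e that)
  qed
qed (auto simp: swap_sym_def sym_key_eq_iff sym_act_eq_lin_ext lin_ext_add lin_ext_scale)

section \<open>The exterior algebra\<close>

lemma wedge_list_Nil [simp]: "wedge_list [] = ext_one"
  by (simp add: wedge_list_def)

lemma wedge_list_Cons [simp]: "wedge_list (f # fs) = f \<diamondop> wedge_list fs"
  by (simp add: wedge_list_def)

lemma wedge_list_append: "wedge_list (fs @ gs) = wedge_list fs \<diamondop> wedge_list gs"
  by (induction fs) (simp_all add: wedge_assoc)

text \<open>Stated coefficientwise because \<open>swap_sym\<close> concerns complex-valued
  functions. It serves for the generators and for their images under a group element.\<close>

lemma swap_sym_wedge_list:
  assumes anti: "\<And>i j. f i \<diamondop> f j = scale (- 1) (f j \<diamondop> f i)"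
  shows "swap_sym (- 1) (\<lambda>cs. poly_mapping.lookup (wedge_list (map f cs)) S)"
proof -
  have "poly_mapping.lookup (wedge_list (map f (xs @ a # b # ys))) S
      = - 1 * poly_mapping.lookup (wedge_list (map f (xs @ b # a # ys))) S" for xs a b ys
  proof -
    have "wedge_list (map f (a # b # ys)) = scale (- 1) (wedge_list (map f (b # a # ys)))"
      by (simp only: list.map wedge_list_Cons wedge_assoc[symmetric] anti[of a b] wedge_scale_left)
    then have "wedge_list (map f (xs @ a # b # ys)) = scale (- 1) (wedge_list (map f (xs @ b # a # ys)))"
      by (simp only: map_append wedge_list_append wedge_scale_right)
    then show ?thesis by (simp only: lookup_scale)
  qed
  then show ?thesis unfolding swap_sym_def by blast
qed

lemma scale_minus_one: "scale (- 1) p = - p"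
  by (simp add: cvec.scale_minus_left)

text \<open>The sign that sorts \<open>cs\<close>, or 0 if a column repeats. Reading it off the
  wedge product lets it inherit the swap rule from anticommutativity.\<close>

definition ext_eta :: "nat list list \<Rightarrow> complex" where
  "ext_eta cs = poly_mapping.lookup (wedge_list (map ext_e cs)) (fset_of_list cs)"

lemma wedge_list_ext_e:
  "wedge_list (map ext_e cs) = Poly_Mapping.single (fset_of_list cs) (ext_eta cs)"
proof -
  have "\<exists>c. wedge_list (map ext_e cs) = Poly_Mapping.single (fset_of_list cs) c"
  proof (induction cs)
    case (Cons a cs)
    then obtain c where "wedge_list (map ext_e cs) = Poly_Mapping.single (fset_of_list cs) c" by blast
    then have "wedge_list (map ext_e (a # cs)) = scale c (wedge_basis {|a|} (fset_of_list cs))"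
      by (simp add: ext_e_def[of a] wedge_single)
    then show ?case
      by (auto simp: wedge_basis_def intro: exI[of _ 0])
  qed (auto simp: ext_one_def)
  then show ?thesis by (auto simp: ext_eta_def)
qed

lemma ext_eta_Nil [simp]: "ext_eta [] = 1"
  by (simp add: ext_eta_def ext_one_def)

lemma ext_eta_Cons:
  "ext_eta (a # cs) = (if a \<in> set cs then 0 else (- 1) ^ shuffle_inv {|a|} (fset_of_list cs) * ext_eta cs)"
proof -
  have "{|a|} |\<inter>| fset_of_list cs = {||} \<longleftrightarrow> a \<notin> set cs"
    by (auto simp: fset_of_list_elem)
  then show ?thesis
    by (simp add: ext_eta_def[of "a # cs"] wedge_list_ext_e ext_e_def wedge_single wedge_basis_def
        mult.commute)
qed

lemma ext_eta_square: "ext_eta cs * ext_eta cs = (if distinct cs then 1 else 0)"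
proof (induction cs)
  case (Cons a cs)
  show ?case
  proof (cases "a \<in> set cs")
    case False
    let ?k = "shuffle_inv {|a|} (fset_of_list cs)"
    have "ext_eta (a # cs) * ext_eta (a # cs)
        = ((- 1) ^ ?k * (- 1) ^ ?k) * (ext_eta cs * ext_eta cs)"
      using False by (simp only: ext_eta_Cons if_False mult_ac)
    also have "(- 1 :: complex) ^ ?k * (- 1) ^ ?k = 1" by (simp flip: power_add mult_2)
    finally show ?thesis using False Cons by simp
  qed (simp add: ext_eta_Cons)
qed simp

lemma ext_eta_sorted: "sorted cs \<Longrightarrow> distinct cs \<Longrightarrow> ext_eta cs = 1"
proof (induction cs)
  case (Cons a cs)
  then have "{(x, b). x \<in> fset {|a|} \<and> b \<in> fset (fset_of_list cs) \<and> b < x} = {}"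
    by (auto simp: fset_of_list.rep_eq not_less[symmetric])
  then have "shuffle_inv {|a|} (fset_of_list cs) = 0" by (simp only: shuffle_inv_def card.empty)
  then show ?case using Cons by (simp add: ext_eta_Cons)
qed simp

lemma ext_e_anticommute_scale: "ext_e i \<diamondop> ext_e j = scale (- 1) (ext_e j \<diamondop> ext_e i)"
  by (simp only: scale_minus_one ext_e_anticommute[symmetric])

lemma fset_of_list_mset: "mset cs = mset cs' \<Longrightarrow> fset_of_list cs = fset_of_list cs'"
  by (metis fset_inverse fset_of_list.rep_eq mset_eq_setD)

lemma swap_sym_ext_eta: "swap_sym (- 1) ext_eta"
proof -
  have "ext_eta (xs @ a # b # ys) = - 1 * ext_eta (xs @ b # a # ys)" for xs a b ys
  proof -
    have "fset_of_list (xs @ a # b # ys) = fset_of_list (xs @ b # a # ys)"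
      by (rule fset_of_list_mset) simp
    then show ?thesis
      unfolding ext_eta_def
      by (simp only:) (rule swap_symD[OF swap_sym_wedge_list[OF ext_e_anticommute_scale]])
  qed
  then show ?thesis unfolding swap_sym_def by blast
qed

lemma ext_act_e_anticommute:
  "ext_act_e n g i \<diamondop> ext_act_e n g j = scale (- 1) (ext_act_e n g j \<diamondop> ext_act_e n g i)"
proof -
  let ?I = "idx n (length g)"
  have expand: "ext_act_e n g i \<diamondop> ext_act_e n g j = (\<Sum>a\<in>?I. \<Sum>b\<in>?I.
      scale (act_coeff g a i) (scale (act_coeff g b j) (ext_e a \<diamondop> ext_e b)))" for i j
    unfolding ext_act_e_def wedge_sum_left
    by (simp add: wedge_sum_right wedge_scale_left wedge_scale_right cvec.scale_sum_right mult.commute)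
  have "ext_act_e n g i \<diamondop> ext_act_e n g j = (\<Sum>a\<in>?I. \<Sum>b\<in>?I.
      scale (- 1) (scale (act_coeff g b j) (scale (act_coeff g a i) (ext_e b \<diamondop> ext_e a))))"
    unfolding expand
  proof (intro sum.cong refl)
    fix a b
    show "scale (act_coeff g a i) (scale (act_coeff g b j) (ext_e a \<diamondop> ext_e b))
        = scale (- 1) (scale (act_coeff g b j) (scale (act_coeff g a i) (ext_e b \<diamondop> ext_e a)))"
      unfolding ext_e_anticommute_scale[of a b] by (simp add: mult.commute)
  qed
  also have "\<dots> = scale (- 1) (ext_act_e n g j \<diamondop> ext_act_e n g i)"
    unfolding expand by (subst sum.swap) (simp only: cvec.scale_sum_right)
  finally show ?thesis .
qed

lemma wedge_list_ext_act_e: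
  "wedge_list (map (ext_act_e n g) cs) = (\<Sum>x\<in>lists_of (idx n (length g)) (length cs).
     scale (tensor_coeff (act_coeff g) x cs) (wedge_list (map ext_e x)))"
proof (induction cs)
  case (Cons c cs)
  let ?I = "idx n (length g)"
  have "wedge_list (map (ext_act_e n g) (c # cs))
      = ext_act_e n g c \<diamondop> (\<Sum>x\<in>lists_of ?I (length cs).
          scale (tensor_coeff (act_coeff g) x cs) (wedge_list (map ext_e x)))"
    by (simp add: Cons)
  also have "\<dots> = (\<Sum>b\<in>?I. \<Sum>x\<in>lists_of ?I (length cs).
      scale (tensor_coeff (act_coeff g) (b # x) (c # cs)) (wedge_list (map ext_e (b # x))))"
    unfolding ext_act_e_def wedge_sum_left
    by (simp add: wedge_sum_right wedge_scale_left wedge_scale_right cvec.scale_sum_right mult.commute)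
  finally show ?case by (simp only: sum_lists_of_Suc length_Cons)
qed (simp add: tensor_coeff_def)

text \<open>\<open>ext_act\<close> uses the increasing ordering. Passing from \<open>cs\<close> to
  it changes the wedge product and \<open>ext_eta\<close> by the same factor, and
  \<open>ext_eta\<close> is 1 there; if a column repeats, both sides vanish.\<close>

lemma scale_ext_eta_wedge_list:
  assumes anti: "\<And>i j. f i \<diamondop> f j = scale (- 1) (f j \<diamondop> f i)"
  shows "scale (ext_eta cs) (wedge_list (map f (sorted_list_of_fset (fset_of_list cs))))
    = wedge_list (map f cs)"
proof (rule poly_mapping_eqI)
  fix S
  let ?F = "\<lambda>cs. poly_mapping.lookup (wedge_list (map f cs)) S"
  let ?z = "sorted_list_of_fset (fset_of_list cs)"
  have F: "swap_sym (- 1) ?F" by (rule swap_sym_wedge_list[OF anti])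
  show "poly_mapping.lookup (scale (ext_eta cs) (wedge_list (map f ?z))) S
      = poly_mapping.lookup (wedge_list (map f cs)) S"
  proof (cases "distinct cs")
    case True
    have z: "sorted ?z" "distinct ?z" "set ?z = set cs"
      by (simp_all add: sorted_list_of_fset.rep_eq fset_of_list.rep_eq)
    then have "mset cs = mset ?z" using True by (simp flip: set_eq_iff_mset_eq_distinct)
    from swap_sym_common_sign[OF F swap_sym_ext_eta _ this]
    obtain e where "?F cs = e * ?F ?z" "ext_eta cs = e * ext_eta ?z" by auto
    then show ?thesis using ext_eta_sorted[OF z(1,2)] by (simp add: lookup_scale)
  next
    case False
    then have "ext_eta cs = 0" using ext_eta_square[of cs] by simp
    moreover have "?F cs = 0" by (rule swap_sym_not_distinct[OF F False])
    ultimately show ?thesis by (simp add: lookup_scale)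
  qed
qed

lemma ext_act_eq_lin_ext:
  "ext_act n g = lin_ext (\<lambda>S. wedge_list (map (ext_act_e n g) (sorted_list_of_fset S)))"
  by (rule ext) (simp add: ext_act_def lin_ext_def)

lemma column_algebra_ext: "column_algebra n d (- 1) fset_of_list ext_eta (ext_act n) (ext_space n d)"
proof
  have nz: "ext_eta cs \<noteq> 0 \<longleftrightarrow> distinct cs" for cs
    using ext_eta_square[of cs] by (auto split: if_splits)
  show "ext_eta cs = 0 \<or> ext_eta cs * ext_eta cs = 1" for cs
    using ext_eta_square[of cs] by (auto split: if_splits)
  show "fset_of_list cs = fset_of_list cs'" if "mset cs = mset cs'" for cs cs' :: "nat list list"
    using that by (rule fset_of_list_mset)
  show "mset cs = mset cs'"
    if "fset_of_list cs = fset_of_list cs'" "ext_eta cs \<noteq> 0" "ext_eta cs' \<noteq> 0" for cs cs'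
    using that unfolding nz by (metis fset_of_list.rep_eq set_eq_iff_mset_eq_distinct)
  show "- 1 = (- 1 :: complex) \<and> \<not> distinct cs" if "ext_eta cs = 0" for cs
    using that nz by blast
  show "ext_space n d = {p. \<forall>a\<in>Poly_Mapping.keys p.
      \<exists>cs. set cs \<subseteq> idx n d \<and> ext_eta cs \<noteq> 0 \<and> fset_of_list cs = a}"
  proof -
    have "fset S \<subseteq> idx n d \<longleftrightarrow> (\<exists>cs. set cs \<subseteq> idx n d \<and> ext_eta cs \<noteq> 0 \<and> fset_of_list cs = S)" for S
    proof
      assume "fset S \<subseteq> idx n d"
      then show "\<exists>cs. set cs \<subseteq> idx n d \<and> ext_eta cs \<noteq> 0 \<and> fset_of_list cs = S"
        by (intro exI[of _ "sorted_list_of_fset S"])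
          (simp add: nz sorted_list_of_fset.rep_eq fset_inject[symmetric] fset_of_list.rep_eq)
    qed (auto simp: fset_of_list.rep_eq)
    then show ?thesis by (simp add: ext_space_def)
  qed
  show "ext_act n g (Poly_Mapping.single (fset_of_list cs) (ext_eta cs))
      = (\<Sum>x\<in>lists_of (idx n d) (length cs).
        scale (tensor_coeff (act_coeff g) x cs) (Poly_Mapping.single (fset_of_list x) (ext_eta x)))"
    if "length g = d" "set cs \<subseteq> idx n d" for g cs
  proof -
    have "ext_act n g (Poly_Mapping.single (fset_of_list cs) (ext_eta cs))
        = wedge_list (map (ext_act_e n g) cs)"
      unfolding ext_act_eq_lin_ext lin_ext_single
      by (rule scale_ext_eta_wedge_list[OF ext_act_e_anticommute])
    then show ?thesis by (simp only: wedge_list_ext_act_e wedge_list_ext_e that(1))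
  qed
qed (simp_all add: swap_sym_ext_eta ext_act_eq_lin_ext lin_ext_add lin_ext_scale)

theorem mainTheorem4:
  fixes n d m :: nat and lam :: "nat list list"
  assumes "d \<ge> 1"
    and "length lam = d"
    and "\<forall>p\<in>set lam. is_partition m p \<and> length p \<le> n"
  shows "(odd d \<longrightarrow>
            HWV_sym n lam
              = cvec.span {Delta n T | T. T \<in> tables_B_plus (map conjugate_partition lam)} \<and>
            HWV_ext n lam
              = cvec.span {Nabla n S | S. S \<in> tables_A_plus (map conjugate_partition lam)}) \<and>
         (even d \<longrightarrow>
            HWV_sym n lam
              = cvec.span {Delta n T | T. T \<in> tables_A_plus (map conjugate_partition lam)} \<and>
            HWV_ext n lam
              = cvec.span {Nabla n S | S. S \<in> tables_B_plus (map conjugate_partition lam)})"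
proof -
  interpret sym: column_algebra n d 1 sym_key "\<lambda>_. 1" "sym_act n" "sym_space n d"
    by (rule column_algebra_sym)
  interpret ext: column_algebra n d "- 1" fset_of_list ext_eta "ext_act n" "ext_space n d"
    by (rule column_algebra_ext)
  have sym_mon: "sym_monom X = sym.mon (List.transpose X)" for X
    by (simp add: sym_monom_def sym.mon_def prod_list_sym_e)
  have ext_mon: "ext_monom X = ext.mon (List.transpose X)" for X
    by (simp add: ext_monom_def ext.mon_def wedge_list_ext_e)
  note sym = sym.HWV_eq_span[OF assms(2,1,3) sym_mon Delta_def]
  note ext = ext.HWV_eq_span[OF assms(2,1,3) ext_mon Nabla_def]
  \<comment> \<open>The goals left to \<open>simp_all\<close> include the sign conditions: for
    \<epsilon> = 1 they hold when \<open>d\<close> is odd, for \<epsilon> = -1 when \<open>d\<close>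
    is even.\<close>
  show ?thesis
    unfolding HWV_sym_def HWV_ext_def assms(2)
    by (intro conjI impI sym(1) ext(1) sym(2) ext(2)) simp_all
qed

end
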